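(* For $n=0,1,2,\dots$ let $x_n:=\frac{1}{2^n}$ and $y_n:=\frac{1}{2^n e^{3^n}}$, and let $$D:=\{z\in\mathbb{C}:\operatorname{Re} z>0\}\setminus\bigcup_{n\geq 0} \{z\in\mathbb{C}:\operatorname{Re} z=x_n,\ |\operatorname{Im} z|\geq y_n\}.$$ Let $g:\mathbb{D}\to D$ be a Riemann map. Then $g$ has non-tangential limit at every point of $\partial\mathbb{D}$, and there exists $\sigma_0\in\partial\mathbb{D}$ such that $g$ has unrestricted limit at every point of $\partial\mathbb{D}\setminus\{\sigma_0\}$ and $g$ does not have $H$-limit at $\sigma_0$. Also, the domain $D$ fails to have the Denjoy-Wolff Property.
   Context: $\mathbb{D}$ is the open unit disc, $\mathbb{C}_\infty$ the Riemann sphere; all limits of $g$ are taken in $\mathbb{C}_\infty$, and $\partial D$ is the boundary of $D$ in $\mathbb{C}_\infty$. A Riemann map of $D$ is a biholomorphism $g:\mathbb{D}\to D$. Unrestricted limit at $\sigma$ means that $\lim_{\mathbb{D}\ni z\to\sigma}g(z)$ exists. For $\sigma\in\partial\mathbb{D}$ and $R>0$ let $E(\sigma,R)=\{z\in\mathbb{D}: \frac{|\sigma-z|^2}{1-|z|^2}<R\}$. A function $g:\mathbb{D}\to\mathbb{C}$ has $H$-limit $L\in\mathbb{C}_\infty$ at $\sigma\in\partial\mathbb{D}$ if for every sequence $\{z_n\}\subset\mathbb{D}$ converging to $\sigma$ that is eventually contained in $E(\sigma,R)$ for some $R>0$, the sequence $\{g(z_n)\}$ converges to $L$; $g$ has $H$-limit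 at $\sigma$ if such an $L$ exists. A simply connected domain $\Omega$ has the Denjoy-Wolff Property if for every holomorphic $f:\Omega\to\Omega$ without fixed points in $\Omega$ there is $\tau\in\partial\Omega$ such that the iterates $f^{\circ n}$ converge to $\tau$ uniformly on compacta of $\Omega$ (as maps into $\mathbb{C}_\infty$). *)

theory Defs
  imports "HOL-Complex_Analysis.Complex_Analysis" "HOL-Real_Asymp.Real_Asymp"
begin

text \<open>The Riemann sphere is the one-point compactification of the plane, with \<^term>\<open>None\<close> as
  the point at infinity.\<close>

definition riemann_sphere :: "complex option topology" where
  "riemann_sphere = Alexandroff_compactification euclidean"

text \<open>Inverse stereographic projection, with the unit sphere of \<open>\<real>\<^sup>3\<close> sitting in
  \<^typ>\<open>complex \<times> real\<close>. It induces the topology of \<^term>\<open>riemann_sphere\<close> (see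
  \<open>embedding_map_sphere_point\<close> below), and the distance of the images is the chordal metric; uniform
  convergence of maps into the sphere is understood with respect to this metric.\<close>

definition sphere_point :: "complex option \<Rightarrow> complex \<times> real" where
  "sphere_point p = (case p of
      None \<Rightarrow> (0, 1)
    | Some z \<Rightarrow> (2 * z / complex_of_real ((cmod z)\<^sup>2 + 1), ((cmod z)\<^sup>2 - 1) / ((cmod z)\<^sup>2 + 1)))"

definition sphere_boundary :: "complex set \<Rightarrow> complex option set" where
  "sphere_boundary \<Omega> = riemann_sphere frontier_of (Some ` \<Omega>)"

definition riemann_map :: "(complex \<Rightarrow> complex) \<Rightarrow> complex set \<Rightarrow> bool" where
  "riemann_map g \<Omega> \<longleftrightarrow>
     g holomorphic_on ball 0 1 \<and> bij_betw g (ball 0 1) \<Omega> \<and>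
     inv_into (ball 0 1) g holomorphic_on \<Omega>"

definition unrestricted_limit :: "(complex \<Rightarrow> complex) \<Rightarrow> complex \<Rightarrow> complex option \<Rightarrow> bool" where
  "unrestricted_limit g \<sigma> L \<longleftrightarrow>
     limitin riemann_sphere (\<lambda>z. Some (g z)) L (at \<sigma> within ball 0 1)"

text \<open>Stolz regions in the unit disc; they are empty for \<open>M \<le> 1\<close>.\<close>

definition stolz_region :: "complex \<Rightarrow> real \<Rightarrow> complex set" where
  "stolz_region \<sigma> M = {z \<in> ball 0 1. cmod (\<sigma> - z) < M * (1 - cmod z)}"

definition nontangential_limit :: "(complex \<Rightarrow> complex) \<Rightarrow> complex \<Rightarrow> complex option \<Rightarrow> bool" where
  "nontangential_limit g \<sigma> L \<longleftrightarrow>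
     (\<forall>M>1. limitin riemann_sphere (\<lambda>z. Some (g z)) L (at \<sigma> within stolz_region \<sigma> M))"

definition horosphere :: "complex \<Rightarrow> real \<Rightarrow> complex set" where
  "horosphere \<sigma> R = {z \<in> ball 0 1. (cmod (\<sigma> - z))\<^sup>2 / (1 - (cmod z)\<^sup>2) < R}"

definition H_limit :: "(complex \<Rightarrow> complex) \<Rightarrow> complex \<Rightarrow> complex option \<Rightarrow> bool" where
  "H_limit g \<sigma> L \<longleftrightarrow>
     (\<forall>z::nat \<Rightarrow> complex.
        (\<forall>n. z n \<in> ball 0 1) \<and> z \<longlonglongrightarrow> \<sigma> \<and>
        (\<exists>R>0. \<forall>\<^sub>F n in sequentially. z n \<in> horosphere \<sigma> R)
        \<longrightarrow> limitin riemann_sphere (\<lambda>n. Some (g (z n))) L sequentially)"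

text \<open>Meant for simply connected domains \<open>\<Omega>\<close>.\<close>

definition denjoy_wolff_property :: "complex set \<Rightarrow> bool" where
  "denjoy_wolff_property \<Omega> \<longleftrightarrow>
     (\<forall>f. f holomorphic_on \<Omega> \<and> f ` \<Omega> \<subseteq> \<Omega> \<and> (\<forall>z\<in>\<Omega>. f z \<noteq> z) \<longrightarrow>
        (\<exists>\<tau>\<in>sphere_boundary \<Omega>. \<forall>K. compact K \<and> K \<subseteq> \<Omega> \<longrightarrow>
           uniform_limit K (\<lambda>n z. sphere_point (Some ((f ^^ n) z)))
             (\<lambda>_. sphere_point \<tau>) sequentially))"

definition slit_x :: "nat \<Rightarrow> real" where
  "slit_x n = 1 / 2 ^ n"

definition slit_y :: "nat \<Rightarrow> real" where
  "slit_y n = 1 / (2 ^ n * exp (3 ^ n))"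

definition slit_domain :: "complex set" where
  "slit_domain = {z. Re z > 0} - (\<Union>n. {z. Re z = slit_x n \<and> \<bar>Im z\<bar> \<ge> slit_y n})"

lemma topspace_riemann_sphere [simp]: "topspace riemann_sphere = UNIV"
  by (simp add: riemann_sphere_def UNIV_option_conv)

lemma embedding_map_sphere_point: "embedding_map riemann_sphere euclidean sphere_point"
proof (rule injective_closed_imp_embedding_map)
  let ?s = "\<lambda>z. sphere_point (Some z)"
  have nz: "(cmod z)\<^sup>2 + 1 \<noteq> 0" for z
    by (smt (verit) zero_le_power2)
  have cont: "continuous_on UNIV ?s"
    unfolding sphere_point_def option.case
    by (intro continuous_intros) (use nz in \<open>simp_all del: of_real_add of_real_power\<close>)
  have "((\<lambda>r::real. (r\<^sup>2 - 1) / (r\<^sup>2 + 1)) \<longlongrightarrow> 1) at_top"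
    "((\<lambda>r::real. 2 * r / (r\<^sup>2 + 1)) \<longlongrightarrow> 0) at_top"
    by real_asymp+
  then have lim2: "((\<lambda>z. ((cmod z)\<^sup>2 - 1) / ((cmod z)\<^sup>2 + 1)) \<longlongrightarrow> 1) at_infinity"
    and lim1': "((\<lambda>z. 2 * cmod z / ((cmod z)\<^sup>2 + 1)) \<longlongrightarrow> 0) at_infinity"
    by (auto intro: filterlim_compose[OF _ filterlim_norm_at_top])
  have "cmod (2 * z / complex_of_real ((cmod z)\<^sup>2 + 1)) = 2 * cmod z / ((cmod z)\<^sup>2 + 1)" for z
    by (simp only: norm_divide norm_mult norm_of_real) simp
  then have lim1: "((\<lambda>z. 2 * z / complex_of_real ((cmod z)\<^sup>2 + 1)) \<longlongrightarrow> 0) at_infinity"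
    using lim1' by (subst tendsto_norm_zero_iff[symmetric]) (simp only:)
  have lim: "(?s \<longlongrightarrow> sphere_point None) at_infinity"
    unfolding sphere_point_def option.case by (intro tendsto_Pair lim1 lim2)
  have "continuous_map riemann_sphere euclidean sphere_point"
    unfolding continuous_map_def
  proof (intro conjI allI impI)
    fix U :: "(complex \<times> real) set"
    assume "openin euclidean U"
    then have U: "open U" by simp
    have V: "open (?s -` U)"
      by (rule open_vimage[OF U cont])
    show "openin riemann_sphere {p \<in> topspace riemann_sphere. sphere_point p \<in> U}"
    proof (cases "sphere_point None \<in> U")
      case False
      then have "{p. sphere_point p \<in> U} = Some ` (?s -` U)"
        by (intro set_eqI) (case_tac x; auto)
      moreover have "openin riemann_sphere (Some ` (?s -` U))"
        using V by (simp add: riemann_sphere_def)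
      ultimately show ?thesis
        by simp
    next
      case True
      then have "\<forall>\<^sub>F z in at_infinity. ?s z \<in> U"
        by (rule topological_tendstoD[OF lim U])
      then obtain b where b: "\<And>z. cmod z \<ge> b \<Longrightarrow> ?s z \<in> U"
        by (auto simp: eventually_at_infinity)
      then have "bounded (- (?s -` U))"
        by (intro boundedI[of _ b]) (force simp: not_le[symmetric])
      then have C: "compact (- (?s -` U))"
        using V by (simp add: compact_eq_bounded_closed closed_Compl)
      moreover have "{p. sphere_point p \<in> U} = insert None (Some ` (UNIV - (- (?s -` U))))"
        using True by (intro set_eqI) (case_tac x; auto)
      moreover have "openin riemann_sphere (insert None (Some ` (UNIV - (- (?s -` U)))))"
        unfolding riemann_sphere_def openin_Alexandroff_compactification
        using C compact_imp_closed[OF C]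
        by (intro disjI2 exI[of _ "- (?s -` U)"])
           (simp only: compactin_euclidean_iff closed_closedin topspace_euclidean)
      ultimately show ?thesis
        by simp
    qed
  qed auto
  then show "continuous_map riemann_sphere euclidean sphere_point" .
  then show "closed_map riemann_sphere euclidean sphere_point"
    by (rule T1_Spaces.continuous_imp_closed_map) (auto simp: riemann_sphere_def)
  have inv: "z = fst (?s z) / complex_of_real (1 - snd (?s z))" for z
  proof -
    have "1 - snd (?s z) = 2 / ((cmod z)\<^sup>2 + 1)"
      using nz[of z] by (simp add: sphere_point_def field_simps)
    moreover have "complex_of_real ((cmod z)\<^sup>2 + 1) \<noteq> 0"
      using nz[of z] by (simp only: of_real_eq_0_iff not_False_eq_True)
    ultimately show ?thesis
      by (simp add: sphere_point_def)
  qed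
  have ninf: "?s z \<noteq> sphere_point None" for z
    using nz[of z] by (simp add: sphere_point_def field_simps)
  have "p = q" if "sphere_point p = sphere_point q" for p q
    using that ninf inv by (cases p; cases q) metis+
  then show "inj_on sphere_point (topspace riemann_sphere)"
    by (auto intro: inj_onI)
qed

lemma slit_domain_simply_connected_domain:
  "open slit_domain" "connected slit_domain" "simply_connected slit_domain" "slit_domain \<noteq> {}"
proof -
  have y: "slit_y n > 0" for n
    by (simp add: slit_y_def)
  have real: "complex_of_real r \<in> slit_domain" if "r > 0" for r
    using that y by (auto simp: slit_domain_def not_le)
  then show "slit_domain \<noteq> {}"
    using zero_less_one by blast
  let ?W = "\<lambda>c. {z. Re z > c} - (\<Union>n\<in>{n. slit_x n > c}. {z. Re z = slit_x n \<and> \<bar>Im z\<bar> \<ge> slit_y n})"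
  have fin: "finite {n. slit_x n > c}" if "c > 0" for c
  proof -
    have "slit_x \<longlonglongrightarrow> 0"
      unfolding slit_x_def by real_asymp
    then have "\<forall>\<^sub>F n in sequentially. slit_x n < c"
      using that by (rule order_tendstoD)
    then obtain N where "\<And>n. n \<ge> N \<Longrightarrow> slit_x n < c"
      by (auto simp: eventually_sequentially)
    then have "{n. slit_x n > c} \<subseteq> {..<N}"
      by (force simp: not_le[symmetric])
    then show ?thesis
      using finite_subset by blast
  qed
  have W: "open (?W c)" if "c > 0" for c
  proof (intro open_Diff closed_UN fin that ballI)
    show "open {z. Re z > c}"
      by (rule open_halfspace_Re_gt)
    show "closed {z. Re z = slit_x n \<and> \<bar>Im z\<bar> \<ge> slit_y n}" for n
      by (intro closed_Collect_conj closed_Collect_eq closed_Collect_le continuous_intros)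
  qed
  have "slit_domain = (\<Union>c\<in>{0<..}. ?W c)"
  proof (intro equalityI subsetI)
    fix z assume z: "z \<in> slit_domain"
    then have "Re z / 2 \<in> {0<..}" "z \<in> ?W (Re z / 2)"
      by (auto simp: slit_domain_def)
    then show "z \<in> (\<Union>c\<in>{0<..}. ?W c)"
      by blast
  next
    fix z assume "z \<in> (\<Union>c\<in>{0<..}. ?W c)"
    then show "z \<in> slit_domain"
      by (fastforce simp: slit_domain_def)
  qed
  then show "open slit_domain"
    by (metis (lifting) W open_UN greaterThan_iff)
  have seg: "closed_segment z (complex_of_real (Re z)) \<subseteq> slit_domain" if "z \<in> slit_domain" for z
  proof
    fix w assume "w \<in> closed_segment z (complex_of_real (Re z))"
    then obtain u where u: "0 \<le> u" "u \<le> 1" "w = (1 - u) *\<^sub>R z + u *\<^sub>R complex_of_real (Re z)"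
      by (auto simp: closed_segment_def)
    have "Re w = Re z" "Im w = (1 - u) * Im z"
      by (simp_all add: u(3) algebra_simps)
    moreover have "\<bar>(1 - u) * Im z\<bar> \<le> \<bar>Im z\<bar>"
      using u by (simp add: abs_mult mult_left_le_one_le)
    ultimately show "w \<in> slit_domain"
      using that unfolding slit_domain_def by fastforce
  qed
  have seg1: "closed_segment (complex_of_real (Re z)) 1 \<subseteq> slit_domain" if "z \<in> slit_domain" for z
  proof -
    have "Re z > 0"
      using that by (simp add: slit_domain_def)
    have "closed_segment (complex_of_real (Re z)) (complex_of_real 1) \<subseteq> of_real ` {0<..}"
      unfolding closed_segment_of_real using \<open>Re z > 0\<close>
      by (auto simp: closed_segment_eq_real_ivl split: if_splits)
    then show ?thesis
      using real by auto
  qed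
  have "homotopic_with_canon (\<lambda>_. True) slit_domain slit_domain id (\<lambda>z. complex_of_real (Re z))"
    using seg by (intro homotopic_with_linear continuous_intros) auto
  moreover have "homotopic_with_canon (\<lambda>_. True) slit_domain slit_domain (\<lambda>z. complex_of_real (Re z)) (\<lambda>z. 1)"
    using seg1 by (intro homotopic_with_linear continuous_intros) auto
  ultimately have "contractible slit_domain"
    unfolding contractible_def using homotopic_with_trans by blast
  then show sc: "simply_connected slit_domain"
    by (rule contractible_imp_simply_connected)
  then show "connected slit_domain"
    by (rule simply_connected_imp_connected)
qed

end

theory Submission
  imports Defs
begin

text \<open>Normalize the inverse \<open>h\<close> of the Riemann map to commute with conjugation and to tend to 1 as
  the positive real axis runs into 0. Except at the imaginary axis, each boundary point and each end of
  the domain has a flat chart on a half disc. Since \<open>|h|\<close> tends to 1 on the diameter, an explicit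
  barrier and the Schwarz--Pick lemma make \<open>h\<close> Lipschitz there, so that it extends by reflection,
  and by openness of the extension the Riemann map has an unrestricted limit at the corresponding point of the
  circle. The same estimate shows that the images of the gates \<open>Re z = x\<^sub>n\<close> shrink to 1, so 1 is the only
  point of the circle not covered by charts; the non-tangential limit 0 at 1 follows from the
  Schwarz--Pick lemma, because the Riemann map is real on the real axis.

  Let \<open>u\<close> be the real part of \<open>(1 + h) / (1 - h)\<close>. Comparison with the plane minus the \<open>n\<close>-th pair of
  slits gives \<open>u \<ge> exp (3\<^sup>n)\<close> at the real centre of the \<open>n\<close>-th strip, and climbing to height 1
  inside the strip costs only a Harnack factor \<open>exp (O(2\<^sup>n))\<close>. Hence the horocycle \<open>u = 1\<close> attains height 1
  in almost all strips, although it crosses almost all gates, which shrink to 0. So the Riemann map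
  diverges along a horocycle at 1, and so do the iterates of the parabolic automorphism that moves points
  along it.\<close>

section \<open>Boundary behaviour along a segment\<close>

text \<open>The obstacle is that nothing is known beforehand about \<open>h\<close> at the boundary
  except properness: \<open>norm h\<close> tends to 1. The estimate on half discs must turn this
  into continuity. It is scale invariant and keeps the defect \<delta> of \<open>norm h\<close> as a
  factor, so the same bound also measures the images of the gates, whatever their width. The
  symmetry under conjugation is there because the bad end at the imaginary axis has no chart: the
  real axis is a path into that end whose image is known, namely a radius, and the gates cut the end
  off from the rest of the disc. The exponent \<open>3 ^ n\<close> in \<open>slit_y n\<close> is a
  matter of growth. Gate \<open>n\<close> forces a lower bound \<open>exp (3 ^ n)\<close>, while
  reaching height 1 in a strip of width \<open>slit_x n / 2\<close> takes \<open>8 * 2 ^ n\<close>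
  Harnack steps with factor 3 each; \<open>3 ^ n\<close> eventually exceeds
  \<open>16 * 2 ^ n\<close>. The shape of the image of the horocycle is never determined. Its points
  at height 1 come from the intermediate value theorem, between the centre of a strip, where
  \<open>u\<close> is at least 1, and a point beside a slit, where \<open>u\<close> is less than
  1.\<close>

lemma maximum_modulus_limsup:
  fixes f :: "complex \<Rightarrow> complex"
  assumes holf: "f holomorphic_on S" and S: "open S" "connected S" "bounded S"
    and lim: "\<And>p e. p \<in> frontier S \<Longrightarrow> 0 < e \<Longrightarrow> \<forall>\<^sub>F z in at p within S. norm (f z) < B + e"
    and z: "z \<in> S"
  shows "norm (f z) \<le> B"
proof (rule ccontr)
  assume "\<not> norm (f z) \<le> B"
  then have gt: "norm (f z) > B" by simp
  define e where "e = (norm (f z) - B) / 2"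
  have e: "e > 0" "norm (f z) > B + e"
    using gt by (auto simp: e_def field_simps)
  define T where "T = {w \<in> S. norm (f w) \<ge> B + e}"
  have contf: "continuous_on S f"
    by (simp add: holf holomorphic_on_imp_continuous_on)
  \<comment> \<open>The boundary hypothesis keeps the superlevel set away from the frontier. So it
    is closed in the plane, hence compact, and the supremum of \<open>norm f\<close> over
    \<open>S\<close> is attained; then \<open>f\<close> is constant, which contradicts the
    hypothesis at any frontier point.\<close>
  have "closed T"
    unfolding closed_limpt
  proof (intro allI impI)
    fix p assume p: "p islimpt T"
    then have pS: "p islimpt S"
      by (rule islimpt_subset) (auto simp: T_def)
    have nt: "at p within T \<noteq> bot"
      using p by (simp add: trivial_limit_within)
    show "p \<in> T"
    proof (cases "p \<in> S")
      case True
      have "((\<lambda>w. norm (f w)) \<longlongrightarrow> norm (f p)) (at p within T)"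
        by (rule tendsto_within_subset[of _ _ _ S])
          (use contf True in \<open>auto simp: T_def continuous_on_def intro!: tendsto_norm\<close>)
      moreover have "\<forall>\<^sub>F w in at p within T. B + e \<le> norm (f w)"
        by (auto simp: eventually_at_filter T_def)
      ultimately have "B + e \<le> norm (f p)"
        using nt tendsto_lowerbound by blast
      then show ?thesis using True by (simp add: T_def)
    next
      case False
      then have "p \<in> frontier S"
        using pS S(1) by (simp add: frontier_def closure_def interior_open)
      then have "\<forall>\<^sub>F w in at p within S. norm (f w) < B + e"
        using lim e(1) by blast
      then have "\<forall>\<^sub>F w in at p within T. norm (f w) < B + e"
        by (rule filter_leD[rotated]) (auto simp: T_def intro: at_le)
      moreover have "\<forall>\<^sub>F w in at p within T. B + e \<le> norm (f w)"
        by (auto simp: eventually_at_filter T_def)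
      ultimately have "\<forall>\<^sub>F w in at p within T. False"
        by eventually_elim auto
      then show ?thesis using nt by auto
    qed
  qed
  then have "compact T"
    using S(3) by (auto simp: compact_eq_bounded_closed T_def intro: bounded_subset)
  moreover have "z \<in> T"
    using z e by (simp add: T_def)
  moreover have "continuous_on T (\<lambda>w. norm (f w))"
    by (intro continuous_on_norm continuous_on_subset[OF contf]) (auto simp: T_def)
  ultimately obtain w where w: "w \<in> T" "\<And>v. v \<in> T \<Longrightarrow> norm (f v) \<le> norm (f w)"
    using continuous_attains_sup[of T "\<lambda>w. norm (f w)"] by blast
  have "norm (f v) \<le> norm (f w)" if "v \<in> S" for v
    using that w unfolding T_def by force
  then have "f constant_on S"
    using maximum_modulus_principle[OF holf S(1,2) S(1) order_refl, of w] w(1) by (auto simp: T_def)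
  then obtain c where c: "\<And>v. v \<in> S \<Longrightarrow> f v = c"
    by (auto simp: constant_on_def)
  have "frontier S \<noteq> {}"
    using z S(3) by (simp add: frontier_eq_empty) (metis UNIV_I bounded_subset not_bounded_UNIV empty_iff)
  then obtain p where p: "p \<in> frontier S" by blast
  have "at p within S \<noteq> bot"
    using p S(1) by (auto simp: trivial_limit_within frontier_def closure_def interior_open)
  moreover have "\<forall>\<^sub>F w in at p within S. norm (f w) < B + e"
    using lim[OF p e(1)] .
  then have "\<forall>\<^sub>F w in at p within S. False"
    unfolding eventually_at_filter
    by eventually_elim (use c z e(2) in auto)
  ultimately show False by auto
qed

section \<open>Schwarz-Pick estimates\<close>

lemma norm_diff_less_norm_add_cnj:
  assumes "Re a > 0" "Re b > 0"
  shows "norm (a - b) < norm (a + cnj b)"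
proof -
  have "(norm (a - b))\<^sup>2 < (norm (a + cnj b))\<^sup>2"
    unfolding cmod_power2 using mult_pos_pos[OF assms] by (simp add: power2_eq_square algebra_simps)
  then show ?thesis by (rule power2_less_imp_less) simp
qed

lemma Schwarz_Pick_halfplane_0:
  assumes holf: "f holomorphic_on ball 0 1" and pos: "\<And>z. z \<in> ball 0 1 \<Longrightarrow> Re (f z) > 0"
    and z: "norm z < 1"
  shows "norm (f z - f 0) \<le> norm z * norm (f z + cnj (f 0))"
proof -
  let ?\<phi> = "\<lambda>z. (f z - f 0) / (f z + cnj (f 0))"
  have nz: "f w + cnj (f 0) \<noteq> 0" if "norm w < 1" for w
    using pos[of w] pos[of 0] that by (auto simp: complex_eq_iff)
  have "norm (?\<phi> z) \<le> norm z"
  proof (rule Schwarz_Lemma(1)[OF _ _ _ z])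
    show "?\<phi> holomorphic_on ball 0 1"
      by (intro holomorphic_intros holf) (use nz in auto)
    show "norm (?\<phi> w) < 1" if "norm w < 1" for w
      using norm_diff_less_norm_add_cnj[of "f w" "f 0"] pos[of w] pos[of 0] nz[OF that] that
      by (simp add: norm_divide)
  qed auto
  then show ?thesis
    using nz[OF z] by (simp add: norm_divide field_simps)
qed

lemma Schwarz_Pick_halfplane:
  assumes holf: "f holomorphic_on ball 0 1" and pos: "\<And>z. z \<in> ball 0 1 \<Longrightarrow> Re (f z) > 0"
    and zw: "norm z < 1" "norm w < 1"
  shows "norm (f z - f w) \<le> norm (Moebius_function 0 w z) * norm (f z + cnj (f w))"
proof -
  let ?m = "Moebius_function 0 (-w)"
  have hm: "?m holomorphic_on ball 0 1" and m: "?m ` ball 0 1 \<subseteq> ball 0 1"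
    using Moebius_function_holomorphic[of "-w" 0] Moebius_function_norm_lt_1[of "-w"] zw by auto
  let ?v = "Moebius_function 0 w z"
  have v: "norm ?v < 1" "?m ?v = z" "?m 0 = w"
    using Moebius_function_norm_lt_1[OF zw(2,1)] Moebius_function_compose[of "-w" w z] zw
    by (auto simp: Moebius_function_of_zero)
  have "norm ((f \<circ> ?m) ?v - (f \<circ> ?m) 0) \<le> norm ?v * norm ((f \<circ> ?m) ?v + cnj ((f \<circ> ?m) 0))"
    by (rule Schwarz_Pick_halfplane_0[OF holomorphic_on_compose_gen[OF hm holf m]])
      (use m pos v in \<open>auto simp: image_subset_iff\<close>)
  then show ?thesis using v by simp
qed

text \<open>It converts a bound on the defect \<open>1 - norm (f z)\<close> into a bound on the
  derivative; every Lipschitz estimate for \<open>h\<close> below comes from it.\<close>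

lemma Schwarz_Pick_deriv:
  assumes holf: "f holomorphic_on ball z r" and r: "r > 0"
    and bd: "\<And>w. w \<in> ball z r \<Longrightarrow> norm (f w) < 1"
  shows "r * norm (deriv f z) \<le> 1 - (norm (f z))\<^sup>2"
proof -
  define a where "a = f z"
  have a: "norm a < 1" using bd[of z] r by (simp add: a_def)
  let ?m = "Moebius_function 0 a"
  let ?l = "\<lambda>w. z + of_real r * w"
  have l: "?l w \<in> ball z r" if "norm w < 1" for w
    using that r by (simp add: dist_norm norm_mult)
  let ?F = "\<lambda>w. ?m (f (?l w))"
  have hfl: "(\<lambda>w. f (?l w)) holomorphic_on ball 0 1"
  proof -
    have "?l holomorphic_on ball 0 1" by (intro holomorphic_intros)
    then show ?thesis
      using holomorphic_on_compose_gen[of ?l "ball 0 1" f "ball z r"] l holf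
      by (auto simp: o_def image_subset_iff)
  qed
  have hF: "?F holomorphic_on ball 0 1"
    using holomorphic_on_compose_gen[OF hfl Moebius_function_holomorphic[OF a, of 0]] bd l
    by (auto simp: o_def image_subset_iff)
  have F0: "?F 0 = 0" by (simp add: a_def Moebius_function_eq_zero)
  have "norm (deriv ?F 0) \<le> 1"
    by (rule Schwarz_Lemma(2)[OF hF F0 _, of 0]) (use bd l a Moebius_function_norm_lt_1 in auto)
  moreover have "deriv ?F 0 = of_real r * deriv f z / (1 - (norm a)\<^sup>2)"
  proof (rule DERIV_imp_deriv)
    have df: "(f has_field_derivative deriv f z) (at z)"
      using holf r by (intro holomorphic_derivI[of f "ball z r"]) auto
    have na: "1 - cnj a * a \<noteq> 0"
      using a by (metis complex_mod_cnj eq_iff_diff_eq_0 less_irrefl norm_mult_less norm_one mult_1)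
    have c: "((\<lambda>w. f (?l w)) has_field_derivative deriv f z * of_real r) (at 0)"
      by (rule DERIV_chain2[of f]) (use df in \<open>auto intro!: derivative_eq_intros\<close>)
    have eq: "(complex_of_real (norm a))\<^sup>2 = cnj a * a"
      by (metis complex_norm_square mult.commute of_real_power)
    have "((\<lambda>w. (f (?l w) - a) / (1 - cnj a * f (?l w))) has_field_derivative
        of_real r * deriv f z / (1 - (norm a)\<^sup>2)) (at 0)"
      apply (rule derivative_eq_intros c refl)+
      using na apply (simp add: a_def)
      apply (use na in \<open>simp add: a_def[symmetric] eq divide_simps\<close>)
      done
    then show "(?F has_field_derivative of_real r * deriv f z / (1 - (norm a)\<^sup>2)) (at 0)"
      by (simp add: Moebius_function_simple)
  qed
  moreover have "1 - (norm a)\<^sup>2 > 0"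
    using a by (simp add: power_less_one_iff)
  moreover have "cmod (1 - (complex_of_real (norm a))\<^sup>2) = \<bar>1 - (norm a)\<^sup>2\<bar>"
    by (metis norm_of_real of_real_1 of_real_diff of_real_power)
  ultimately have "r * norm (deriv f z) / (1 - (norm a)\<^sup>2) \<le> 1" "1 - (norm a)\<^sup>2 > 0"
    using r by (simp_all add: norm_divide norm_mult)
  then show ?thesis
    by (simp add: a_def divide_le_eq)
qed

section \<open>Half discs: decay, Lipschitz bound and reflection\<close>

definition half_ball :: "real \<Rightarrow> real \<Rightarrow> complex set" where
  "half_ball x r = ball (complex_of_real x) r \<inter> {z. Im z > 0}"

lemma open_half_ball: "open (half_ball x r)"
  by (auto simp: half_ball_def open_halfspace_Im_gt)

lemma convex_half_ball: "convex (half_ball x r)"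
  by (auto simp: half_ball_def intro!: convex_Int convex_halfspace_Im_gt)

lemma bounded_half_ball: "bounded (half_ball x r)"
  by (auto simp: half_ball_def intro: bounded_subset)

lemma half_ball_mono: "\<bar>x - y\<bar> + r \<le> s \<Longrightarrow> half_ball x r \<subseteq> half_ball y s"
proof -
  assume le: "\<bar>x - y\<bar> + r \<le> s"
  have "dist (complex_of_real x) (complex_of_real y) = \<bar>x - y\<bar>"
    by (simp add: dist_of_real dist_real_def)
  then have "ball (complex_of_real x) r \<subseteq> ball (complex_of_real y) s"
    using le by (simp add: ball_subset_ball_iff)
  then show ?thesis
    by (auto simp: half_ball_def)
qed

text \<open>The maximum principle is applied to the quotient \<open>E / H\<close>, where
  \<open>norm E\<close> is the exponential of the negative barrier: at most 1 on the diameter, and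
  at most \<open>1 - \<delta>\<close>, hence at most \<open>norm H\<close>, on the arc. The constant
  is 12 because \<open>- ln (1 - \<delta>)\<close> is at most \<open>2 * \<delta>\<close>, the
  barrier at \<open>z\<close> is at most \<open>2 * Im z / \<rho>\<close>, and
  \<open>\<rho> = b / 3\<close>.\<close>

lemma flat_boundary_decay:
  assumes holH: "H holomorphic_on half_ball 0 b" and b: "b > 0"
    and bd: "\<And>z. z \<in> half_ball 0 b \<Longrightarrow> norm (H z) < 1"
    and lim: "\<And>t. \<bar>t\<bar> < b \<Longrightarrow> ((\<lambda>z. norm (H z)) \<longlongrightarrow> 1) (at (complex_of_real t) within half_ball 0 b)"
    and \<delta>: "0 < \<delta>" "\<delta> \<le> 1/2" and low: "\<And>z. z \<in> half_ball 0 b \<Longrightarrow> norm (H z) \<ge> 1 - \<delta>"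
    and z: "z \<in> half_ball 0 b" "\<bar>Re z\<bar> < b / 3" "Im z < b / 3"
  shows "1 - norm (H z) \<le> 12 * \<delta> * Im z / b"
proof -
  define \<rho> where "\<rho> = b / 3"
  define x where "x = Re z"
  define y where "y = Im z"
  define M where "M = - ln (1 - \<delta>)"
  have \<rho>: "\<rho> > 0" using b by (simp add: \<rho>_def)
  have y: "0 < y" "y < \<rho>" using z by (auto simp: y_def \<rho>_def half_ball_def)
  have M0: "M > 0" using \<delta> by (simp add: M_def)
  have "- ln (1 - \<delta>) = ln (1 / (1 - \<delta>))"
    using \<delta> by (simp add: ln_div)
  also have "\<dots> \<le> 1 / (1 - \<delta>) - 1"
    using \<delta> by (intro ln_le_minus_one) auto
  also have "\<dots> = \<delta> / (1 - \<delta>)"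
    using \<delta> by (simp add: field_simps)
  also have "\<dots> \<le> \<delta> / (1/2)"
    using \<delta> by (intro divide_left_mono) auto
  finally have M: "M \<le> 2 * \<delta>" by (simp add: M_def)
  have eM: "exp (- M) = 1 - \<delta>" using \<delta> by (simp add: M_def)
  \<comment> \<open>The real part of \<open>w\<^sup>2 - 2 * \<i> * w\<close> is nonnegative on the diameter and at least 1 on the unit
    half circle, but vanishes linearly at 0: it is a barrier for \<open>- ln (norm H)\<close>.\<close>
  define \<beta> where "\<beta> w = w\<^sup>2 - 2 * \<i> * w" for w :: complex
  have Re\<beta>: "Re (\<beta> w) = (Re w)\<^sup>2 - (Im w)\<^sup>2 + 2 * Im w" for w
    by (simp add: \<beta>_def power2_eq_square)
  define \<kappa> where "\<kappa> w = (w - of_real x) / of_real \<rho>" for w :: complex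
  have Re\<kappa>: "Re (\<kappa> w) = (Re w - x) / \<rho>" and Im\<kappa>: "Im (\<kappa> w) = Im w / \<rho>" for w
    by (simp_all add: \<kappa>_def)
  define E where "E w = exp (- of_real M * \<beta> (\<kappa> w))" for w
  have nE: "norm (E w) = exp (- M * Re (\<beta> (\<kappa> w)))" for w
    by (simp add: E_def)
  \<comment> \<open>Centred at the foot of the perpendicular from \<open>z\<close>, so that
    \<open>\<kappa> z\<close> is purely imaginary; the radius \<open>b / 3\<close> keeps the closed
    disc inside the disc of radius \<open>b\<close>.\<close>
  define U where "U = half_ball x \<rho>"
  have cU: "closure U \<subseteq> cball (of_real x) \<rho> \<inter> {z. Im z \<ge> 0}"
    unfolding U_def half_ball_def
    by (rule closure_minimal) (auto intro!: closed_Int closed_halfspace_Im_ge)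
  have Ub: "cball (of_real x) \<rho> \<subseteq> ball (0::complex) b"
  proof
    fix w assume "w \<in> cball (complex_of_real x) \<rho>"
    then have "norm w \<le> norm (complex_of_real x) + \<rho>"
      using norm_triangle_ineq2[of w "complex_of_real x"] by (auto simp: dist_norm norm_minus_commute)
    also have "\<dots> < b" using z(2) b by (simp add: x_def \<rho>_def)
    finally show "w \<in> ball 0 b" by simp
  qed
  have UH: "U \<subseteq> half_ball 0 b"
    unfolding U_def half_ball_def using order_trans[OF ball_subset_cball Ub] by (simp add: Int_lower2 le_infI1)
  have nz: "H w \<noteq> 0" if "w \<in> half_ball 0 b" for w
    using low[OF that] \<delta> by auto
  define K where "K w = E w / H w" for w
  have hE: "E holomorphic_on A" for A
    using \<rho> unfolding E_def \<beta>_def \<kappa>_def by (intro holomorphic_intros) auto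
  have hK: "K holomorphic_on half_ball 0 b"
    unfolding K_def by (intro holomorphic_intros hE holH nz)
  have zU: "z \<in> U"
  proof -
    have "z - of_real x = \<i> * of_real y"
      by (simp add: complex_eq_iff x_def y_def)
    then have "norm (z - of_real x) = y"
      using y by (simp add: norm_mult)
    then show ?thesis using y z by (simp add: U_def half_ball_def dist_norm norm_minus_commute)
  qed
  have "norm (K z) \<le> 1"
  proof (rule maximum_modulus_limsup[where S = U and f = K])
    show "K holomorphic_on U" using hK UH holomorphic_on_subset by blast
    show "open U" "connected U" "bounded U" "z \<in> U"
      using zU by (auto simp: U_def open_half_ball bounded_half_ball intro: convex_connected convex_half_ball)
    fix p e assume p: "p \<in> frontier U" and e: "0 < (e::real)"
    have pc: "p \<in> closure U" "p \<notin> U"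
      using p open_half_ball by (auto simp: frontier_def U_def interior_open)
    then have p1: "norm (p - of_real x) \<le> \<rho>" "Im p \<ge> 0" "norm p < b"
      using cU Ub by (auto simp: dist_norm norm_minus_commute subset_iff)
    show "\<forall>\<^sub>F w in at p within U. norm (K w) < 1 + e"
    proof (cases "Im p = 0")
      case True
      define t where "t = Re p"
      have pt: "p = of_real t" using True by (simp add: t_def complex_eq_iff)
      have "((\<lambda>w. norm (H w)) \<longlongrightarrow> 1) (at p within half_ball 0 b)"
        using lim[of t] p1(3) by (simp add: pt)
      then have "((\<lambda>w. norm (H w)) \<longlongrightarrow> 1) (at p within U)"
        using UH by (rule tendsto_within_subset)
      moreover have "(E \<longlongrightarrow> E p) (at p within U)"
        using holomorphic_on_imp_continuous_on[OF hE[of UNIV]]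
        by (metis UNIV_I continuous_on_def subset_UNIV tendsto_within_subset)
      ultimately have "((\<lambda>w. norm (K w)) \<longlongrightarrow> norm (E p) / 1) (at p within U)"
        unfolding K_def norm_divide by (intro tendsto_intros) auto
      moreover have "norm (E p) \<le> 1"
        using True M0 by (simp add: nE Re\<beta> Re\<kappa> Im\<kappa>)
      ultimately show ?thesis
        using e by (auto elim: order_tendstoD(2))
    next
      case False
      then have Ip: "Im p > 0" using p1 by simp
      have pH: "p \<in> half_ball 0 b" using Ip p1 by (simp add: half_ball_def)
      have "norm (p - of_real x) = \<rho>"
        using pc(2) p1 Ip by (auto simp: U_def half_ball_def dist_norm norm_minus_commute)
      then have sq: "(Re p - x)\<^sup>2 + (Im p)\<^sup>2 = \<rho>\<^sup>2"
        by (metis cmod_power2 minus_complex.simps Re_complex_of_real Im_complex_of_real diff_zero)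
      then have Ile: "Im p \<le> \<rho>"
        using \<rho> by (metis abs_le_square_iff abs_of_nonneg abs_of_pos le_add_same_cancel2 p1(2) zero_le_power2)
      have "(Re (\<kappa> p))\<^sup>2 + (Im (\<kappa> p))\<^sup>2 = 1"
        using sq \<rho> by (simp add: Re\<kappa> Im\<kappa> power_divide add_divide_distrib[symmetric])
      then have "Re (\<beta> (\<kappa> p)) = 1 + 2 * Im (\<kappa> p) * (1 - Im (\<kappa> p))"
        by (simp add: Re\<beta> power2_eq_square algebra_simps)
      moreover have "Im (\<kappa> p) \<ge> 0" "Im (\<kappa> p) \<le> 1"
        using \<rho> Ile Ip by (auto simp: Im\<kappa>)
      ultimately have "Re (\<beta> (\<kappa> p)) \<ge> 1" by simp
      then have "norm (E p) \<le> exp (-M)"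
        using M0 by (simp add: nE)
      then have "norm (K p) \<le> 1"
        using low[OF pH] nz[OF pH] \<delta> eM by (simp add: K_def norm_divide divide_simps)
      moreover have "((\<lambda>w. norm (K w)) \<longlongrightarrow> norm (K p)) (at p within U)"
        using holomorphic_on_imp_continuous_on[OF hK] pH UH
        by (intro tendsto_norm) (meson continuous_on_def tendsto_within_subset)
      ultimately show ?thesis
        using e by (auto elim: order_tendstoD(2))
    qed
  qed
  then have "norm (E z) \<le> norm (H z)"
    using nz[OF z(1)] by (simp add: K_def norm_divide divide_simps)
  moreover have "Re (\<beta> (\<kappa> z)) \<le> 2 * y / \<rho>"
    by (simp add: Re\<beta> Re\<kappa> Im\<kappa> x_def y_def)
  then have "M * Re (\<beta> (\<kappa> z)) \<le> M * (2 * y / \<rho>)"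
    using M0 by (intro mult_left_mono) auto
  ultimately have "exp (- (M * (2 * y / \<rho>))) \<le> norm (H z)"
    unfolding nE by (smt (verit) exp_le_cancel_iff mult_minus_left)
  then have "1 - norm (H z) \<le> M * (2 * y / \<rho>)"
    using exp_ge_add_one_self[of "- (M * (2 * y / \<rho>))"] by simp
  also have "\<dots> \<le> (2 * \<delta>) * (2 * y / \<rho>)"
    using M y \<rho> by (intro mult_right_mono) auto
  also have "\<dots> = 12 * \<delta> * Im z / b"
    by (simp add: \<rho>_def y_def)
  finally show ?thesis .
qed

text \<open>Schwarz-Pick on the disc around \<open>u\<close> that touches the diameter bounds
  \<open>Im u * norm (deriv H u)\<close> by twice the defect of \<open>norm (H u)\<close>. The
  defect decays like \<open>Im u\<close>, so this factor cancels and the bound is uniform up to the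
  diameter.\<close>

lemma flat_boundary_Lipschitz:
  assumes holH: "H holomorphic_on half_ball 0 b" and b: "b > 0"
    and bd: "\<And>z. z \<in> half_ball 0 b \<Longrightarrow> norm (H z) < 1"
    and lim: "\<And>t. \<bar>t\<bar> < b \<Longrightarrow> ((\<lambda>z. norm (H z)) \<longlongrightarrow> 1) (at (complex_of_real t) within half_ball 0 b)"
    and \<delta>: "0 < \<delta>" "\<delta> \<le> 1/2" and low: "\<And>z. z \<in> half_ball 0 b \<Longrightarrow> norm (H z) \<ge> 1 - \<delta>"
    and zw: "z \<in> half_ball 0 (b/3)" "w \<in> half_ball 0 (b/3)"
  shows "norm (H z - H w) \<le> 24 * \<delta> / b * norm (z - w)"
proof (rule field_differentiable_bound[where S = "half_ball 0 (b/3)" and f' = "deriv H"])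
  have sub: "half_ball 0 (b/3) \<subseteq> half_ball 0 b"
    using b by (intro half_ball_mono) auto
  show "(H has_field_derivative deriv H u) (at u within half_ball 0 (b/3))"
    if "u \<in> half_ball 0 (b/3)" for u
    using that sub holomorphic_derivI[OF holH open_half_ball, of u] by (blast intro: has_field_derivative_at_within)
  show "norm (deriv H u) \<le> 24 * \<delta> / b" if u: "u \<in> half_ball 0 (b/3)" for u
  proof -
    have Iu: "Im u > 0" "norm u < b / 3" using u by (auto simp: half_ball_def)
    have Ru: "\<bar>Re u\<bar> < b / 3" "Im u < b / 3"
      using Iu abs_Re_le_cmod[of u] abs_Im_le_cmod[of u] by auto
    have bsub: "ball u (Im u) \<subseteq> half_ball 0 b"
    proof
      fix v assume "v \<in> ball u (Im u)"
      then have d: "norm (v - u) < Im u" by (simp add: dist_norm norm_minus_commute)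
      then have "Im v > 0" using abs_Im_le_cmod[of "v - u"] by simp
      moreover have "norm v < b"
        using norm_triangle_ineq2[of v u] d Iu Ru b by simp
      ultimately show "v \<in> half_ball 0 b" by (simp add: half_ball_def)
    qed
    have "Im u * norm (deriv H u) \<le> 1 - (norm (H u))\<^sup>2"
      by (rule Schwarz_Pick_deriv) (use Iu bsub bd holH in \<open>auto intro: holomorphic_on_subset\<close>)
    also have "\<dots> = (1 - norm (H u)) * (1 + norm (H u))"
      by (simp add: power2_eq_square algebra_simps)
    also have "\<dots> \<le> (12 * \<delta> * Im u / b) * 2"
      using flat_boundary_decay[OF holH b bd lim \<delta> low _ Ru] u sub bd[of u] \<delta> b Iu
      by (intro mult_mono) auto
    also have "\<dots> = Im u * (24 * \<delta> / b)" by simp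
    finally show ?thesis using Iu by (simp only: mult_le_cancel_left_pos)
  qed
qed (use zw convex_half_ball in auto)

lemma at_within_half_ball_neq_bot:
  assumes "\<bar>t - x\<bar> < r"
  shows "at (complex_of_real t) within half_ball x r \<noteq> bot"
proof -
  have "of_real t islimpt half_ball x r"
    unfolding islimpt_approachable
  proof (intro allI impI)
    fix e :: real assume "e > 0"
    define s where "s = min e (r - \<bar>t - x\<bar>) / 2"
    have s: "s > 0" "s < e" "s < r - \<bar>t - x\<bar>"
      using \<open>e > 0\<close> assms by (auto simp: s_def min_def)
    let ?w = "complex_of_real t + \<i> * of_real s"
    have "norm (?w - of_real x) \<le> norm (complex_of_real (t - x)) + norm (\<i> * complex_of_real s)"
      using norm_triangle_ineq[of "complex_of_real (t - x)" "\<i> * of_real s"] by (simp add: algebra_simps)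
    also have "\<dots> = \<bar>t - x\<bar> + s"
      using s unfolding norm_mult norm_of_real by simp
    finally have "norm (of_real x - ?w) < r"
      using s by (simp add: norm_minus_commute)
    then have "?w \<in> half_ball x r"
      using s by (simp add: half_ball_def dist_norm)
    moreover have "?w \<noteq> of_real t" "dist ?w (of_real t) < e"
      using s by (auto simp: dist_norm norm_mult)
    ultimately show "\<exists>x'\<in>half_ball x r. x' \<noteq> complex_of_real t \<and> dist x' (complex_of_real t) < e"
      by blast
  qed
  then show ?thesis by (simp add: trivial_limit_within)
qed

lemma Re_Cayley:
  fixes s w :: complex
  shows "Re ((s - w) / (s + w)) = ((norm s)\<^sup>2 - (norm w)\<^sup>2) / (norm (s + w))\<^sup>2"
proof -
  have "Re ((s - w) * cnj (s + w)) = (norm s)\<^sup>2 - (norm w)\<^sup>2"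
    unfolding cmod_power2 by (simp add: power2_eq_square algebra_simps)
  then show ?thesis
    by (simp add: complex_div_cnj[of "s - w"] Re_divide_of_real del: of_real_power flip: of_real_power)
qed

text \<open>\<open>H\<close> need not be injective: the last conclusion, that small half discs cover
  one-sided neighbourhoods of \<sigma>, comes from the open mapping theorem for the reflected
  function.\<close>

lemma flat_boundary_value:
  assumes holH: "H holomorphic_on half_ball 0 a" and a: "a > 0"
    and bd: "\<And>z. z \<in> half_ball 0 a \<Longrightarrow> norm (H z) < 1"
    and lim: "\<And>t. \<bar>t\<bar> < a \<Longrightarrow> ((\<lambda>z. norm (H z)) \<longlongrightarrow> 1) (at (complex_of_real t) within half_ball 0 a)"
  obtains \<sigma> where "norm \<sigma> = 1" "(H \<longlongrightarrow> \<sigma>) (at 0 within half_ball 0 a)"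
    "\<And>r. r > 0 \<Longrightarrow> \<exists>d>0. ball 0 1 \<inter> ball \<sigma> d \<subseteq> H ` (half_ball 0 a \<inter> ball 0 r)"
proof -
  \<comment> \<open>Shrinking the half disc until \<open>norm H > 1/2\<close> makes the Lipschitz
    bound available with \<open>\<delta> = 1/2\<close>.\<close>
  have "\<forall>\<^sub>F z in at 0 within half_ball 0 a. norm (H z) > 1/2"
    using lim[of 0] a by (intro order_tendstoD(1)[of _ 1]) auto
  then obtain b' where b': "b' > 0" "\<And>z. z \<in> half_ball 0 a \<Longrightarrow> z \<noteq> 0 \<Longrightarrow> norm z < b' \<Longrightarrow> norm (H z) > 1/2"
    by (auto simp: eventually_at)
  define b where "b = min a b'"
  have b: "b > 0" "b \<le> a" "b \<le> b'" using a b' by (auto simp: b_def)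
  have suba: "half_ball 0 s \<subseteq> half_ball 0 a" if "s \<le> a" for s
    using that by (intro half_ball_mono) auto
  define \<rho> where "\<rho> = b / 3"
  have \<rho>: "\<rho> > 0" "\<rho> \<le> b" "\<rho> \<le> a" using b by (auto simp: \<rho>_def)
  have Lip: "norm (H z - H w) \<le> 12 / b * norm (z - w)"
    if "z \<in> half_ball 0 \<rho>" "w \<in> half_ball 0 \<rho>" for z w
  proof -
    have "norm (H z - H w) \<le> 24 * (1/2) / b * norm (z - w)"
    proof (rule flat_boundary_Lipschitz[OF _ b(1)])
      show "H holomorphic_on half_ball 0 b"
        using holH suba[OF b(2)] by (rule holomorphic_on_subset)
      show "((\<lambda>z. norm (H z)) \<longlongrightarrow> 1) (at (complex_of_real t) within half_ball 0 b)" if "\<bar>t\<bar> < b" for t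
        using lim[of t] that b suba[OF b(2)] tendsto_within_subset by fastforce
      show "1 - 1/2 \<le> norm (H u)" if "u \<in> half_ball 0 b" for u
        using b'(2)[of u] that suba[OF b(2)] b by (force simp: half_ball_def)
    qed (use bd suba[OF b(2)] that in \<open>auto simp: \<rho>_def\<close>)
    then show ?thesis by simp
  qed
  have "(12/b)-lipschitz_on (half_ball 0 \<rho>) H"
    using Lip b by (intro lipschitz_onI) (auto simp: dist_norm)
  then have "uniformly_continuous_on (half_ball 0 \<rho>) H"
    by (rule lipschitz_on_uniformly_continuous)
  then obtain G where G: "uniformly_continuous_on (closure (half_ball 0 \<rho>)) G"
      "\<And>z. z \<in> half_ball 0 \<rho> \<Longrightarrow> H z = G z"
    by (rule uniformly_continuous_on_extension_on_closure) auto
  have contG: "continuous_on (closure (half_ball 0 \<rho>)) G"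
    using G(1) by (rule uniformly_continuous_imp_continuous)
  have real_cl: "of_real t \<in> closure (half_ball 0 \<rho>)" if "\<bar>t\<bar> < \<rho>" for t
    using at_within_half_ball_neq_bot[of t 0 \<rho>] that
    by (auto simp: trivial_limit_within closure_def)
  have limG: "(H \<longlongrightarrow> G (of_real t)) (at (of_real t) within half_ball 0 \<rho>)" if "\<bar>t\<bar> < \<rho>" for t
  proof -
    have "(G \<longlongrightarrow> G (of_real t)) (at (of_real t) within half_ball 0 \<rho>)"
      using contG real_cl[OF that] closure_subset
      by (meson continuous_on_def tendsto_within_subset)
    then show ?thesis
      by (rule Lim_transform_eventually) (auto simp: eventually_at_filter G(2))
  qed
  have G1: "norm (G (of_real t)) = 1" if "\<bar>t\<bar> < \<rho>" for t
  proof (rule tendsto_unique)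
    show "at (complex_of_real t) within half_ball 0 \<rho> \<noteq> bot"
      using that by (intro at_within_half_ball_neq_bot) auto
    show "((\<lambda>z. norm (H z)) \<longlongrightarrow> norm (G (of_real t))) (at (complex_of_real t) within half_ball 0 \<rho>)"
      by (intro tendsto_norm limG that)
    show "((\<lambda>z. norm (H z)) \<longlongrightarrow> 1) (at (complex_of_real t) within half_ball 0 \<rho>)"
      using lim[of t] that \<rho> suba[OF \<rho>(3)] tendsto_within_subset by fastforce
  qed
  define \<sigma> where "\<sigma> = G 0"
  have \<sigma>: "norm \<sigma> = 1" using G1[of 0] \<rho> by (simp add: \<sigma>_def)
  have lim\<sigma>: "(H \<longlongrightarrow> \<sigma>) (at 0 within half_ball 0 a)"
  proof -
    have "at 0 within half_ball 0 a = at 0 within half_ball 0 \<rho>"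
      by (rule at_within_nhd[where S = "ball 0 \<rho>"]) (use \<rho> in \<open>auto simp: half_ball_def\<close>)
    then show ?thesis using limG[of 0] \<rho> by (simp add: \<sigma>_def)
  qed
  have "\<exists>d>0. \<forall>z\<in>closure (half_ball 0 \<rho>). dist z 0 < d \<longrightarrow> dist (G z) (G 0) < 1"
    using contG real_cl[of 0] \<rho> unfolding continuous_on_iff by (metis abs_zero of_real_0 zero_less_one)
  then obtain d where d: "d > 0" "\<And>z. z \<in> closure (half_ball 0 \<rho>) \<Longrightarrow> norm z < d \<Longrightarrow> norm (G z - \<sigma>) < 1"
    by (auto simp: dist_norm \<sigma>_def)
  \<comment> \<open>On this smaller half disc \<open>G\<close> stays within distance 1 of \<sigma>,
    away from the pole \<open>- \<sigma>\<close> of the map \<open>C\<close> defined below.\<close>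
  define \<rho>' where "\<rho>' = min \<rho> d"
  have \<rho>': "\<rho>' > 0" "\<rho>' \<le> \<rho>" "\<rho>' \<le> d" using \<rho> d by (auto simp: \<rho>'_def)
  have cl: "z \<in> closure (half_ball 0 \<rho>)" if "norm z < \<rho>" "Im z \<ge> 0" for z
  proof (cases "Im z = 0")
    case True
    then have "z = of_real (Re z)" by (simp add: complex_eq_iff)
    then show ?thesis using real_cl[of "Re z"] that abs_Re_le_cmod[of z] by simp
  next
    case False
    then have "z \<in> half_ball 0 \<rho>" using that by (simp add: half_ball_def)
    then show ?thesis using closure_subset by blast
  qed
  \<comment> \<open>The Cayley map with zero \<sigma> and pole \<open>- \<sigma>\<close>: it takes
    the disc to the upper half-plane and the rest of the circle to the real line, so that Schwarz
    reflection applies to \<open>C \<circ> G\<close>.\<close>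
  define C where "C w = \<i> * ((\<sigma> - w) / (\<sigma> + w))" for w
  have nz: "\<sigma> + w \<noteq> 0" if "norm (w - \<sigma>) < 1" for w
    using that \<sigma> norm_triangle_ineq[of "w - \<sigma>" "\<sigma> - (-\<sigma>)"] norm_triangle_ineq2[of "2 * \<sigma>" "w - \<sigma>"]
    by (auto simp: add_eq_0_iff2)
  have Cinj: "w = v" if "C w = C v" "norm (w - \<sigma>) < 1" "norm (v - \<sigma>) < 1" for w v
  proof -
    have "(\<sigma> - w) * (\<sigma> + v) = (\<sigma> - v) * (\<sigma> + w)"
      using that nz[of w] nz[of v] by (simp add: C_def frac_eq_eq)
    then have "2 * \<sigma> * (w - v) = 0" by (auto simp: algebra_simps)
    moreover have "\<sigma> \<noteq> 0" using \<sigma> by auto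
    ultimately show ?thesis by simp
  qed
  have ImC: "Im (C w) = (1 - (norm w)\<^sup>2) / (norm (\<sigma> + w))\<^sup>2" for w
    by (simp add: C_def Re_Cayley \<sigma> del: times_divide_eq_right)
  define f where "f z = C (G z)" for z
  define S where "S = ball (0::complex) \<rho>'"
  define F where "F z = (if 0 \<le> Im z then f z else cnj (f (cnj z)))" for z
  have near: "norm (G z - \<sigma>) < 1" if "norm z < \<rho>'" "Im z \<ge> 0" for z
    using d(2)[of z] cl[of z] that \<rho>' by auto
  have hGS: "G holomorphic_on (S \<inter> {z. 0 < Im z})"
  proof (rule holomorphic_transform)
    have "S \<inter> {z. 0 < Im z} \<subseteq> half_ball 0 \<rho>"
      using \<rho>' by (auto simp: S_def half_ball_def)
    then show "H holomorphic_on S \<inter> {z. 0 < Im z}" "\<And>z. z \<in> S \<inter> {z. 0 < Im z} \<Longrightarrow> H z = G z"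
      using holH suba[OF \<rho>(3)] G(2) by (blast intro: holomorphic_on_subset)+
  qed
  have cGS: "continuous_on (S \<inter> {z. 0 \<le> Im z}) G"
    by (rule continuous_on_subset[OF contG]) (use cl \<rho>' in \<open>auto simp: S_def\<close>)
  have holF: "F holomorphic_on S"
    unfolding F_def
  proof (rule Schwarz_reflection)
    show "open S" "cnj ` S \<subseteq> S" by (auto simp: S_def)
    show "f holomorphic_on S \<inter> {z. 0 < Im z}"
      unfolding f_def C_def by (intro holomorphic_intros hGS) (use near nz in \<open>auto simp: S_def\<close>)
    show "continuous_on (S \<inter> {z. 0 \<le> Im z}) f"
      unfolding f_def C_def by (intro continuous_intros cGS) (use near nz in \<open>auto simp: S_def\<close>)
    fix z assume "z \<in> S" "z \<in> \<real>"
    then obtain t where t: "z = of_real t" "\<bar>t\<bar> < \<rho>"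
      using \<rho>' by (auto simp: S_def Reals_def)
    then have "Im (f z) = 0" by (simp add: f_def ImC G1)
    then show "f z \<in> \<real>" by (simp add: complex_is_Real_iff)
  qed
  have fpos: "Im (f z) > 0" if "z \<in> S" "Im z > 0" for z
  proof -
    have zh: "z \<in> half_ball 0 \<rho>" using that \<rho>' by (simp add: S_def half_ball_def)
    then have "norm (G z) < 1" using bd[of z] G(2)[of z] suba[OF \<rho>(3)] by auto
    moreover have "\<sigma> + G z \<noteq> 0" using near[of z] that nz by (auto simp: S_def)
    ultimately show ?thesis by (simp add: f_def ImC power_less_one_iff)
  qed
  have F0: "F 0 = 0" by (simp add: F_def f_def C_def \<sigma>_def)
  have nconst: "\<not> F constant_on S"
  proof
    assume "F constant_on S"
    moreover have "\<i> * of_real (\<rho>'/2) \<in> S" "0 \<in> S"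
      using \<rho>' by (auto simp: S_def norm_mult)
    ultimately have "F (\<i> * of_real (\<rho>'/2)) = F 0"
      unfolding constant_on_def by metis
    moreover have "Im (F (\<i> * of_real (\<rho>'/2))) > 0"
      using fpos[of "\<i> * of_real (\<rho>'/2)"] \<rho>' \<open>\<i> * of_real (\<rho>'/2) \<in> S\<close> by (simp add: F_def)
    ultimately show False using F0 by simp
  qed
  have "\<exists>e>0. ball 0 1 \<inter> ball \<sigma> e \<subseteq> H ` (half_ball 0 a \<inter> ball 0 r)" if r: "r > 0" for r
  proof -
    define r' where "r' = min r \<rho>'"
    have r': "r' > 0" "r' \<le> r" "r' \<le> \<rho>'" using r \<rho>' by (auto simp: r'_def)
    have "open (F ` ball 0 r')"
      by (rule open_mapping_thm[OF holF _ _ _ _ nconst]) (use r' in \<open>auto simp: S_def\<close>)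
    moreover have "0 \<in> F ` ball 0 r'"
      using F0 r' by (metis centre_in_ball image_eqI)
    ultimately obtain \<eta> where \<eta>: "\<eta> > 0" "ball 0 \<eta> \<subseteq> F ` ball 0 r'"
      by (meson open_contains_ball)
    have "isCont C \<sigma>"
      unfolding C_def using \<sigma> by (intro continuous_intros) auto
    then have "\<exists>e>0. \<forall>w. dist w \<sigma> < e \<longrightarrow> dist (C w) (C \<sigma>) < \<eta>"
      using \<eta>(1) by (simp add: continuous_at_eps_delta dist_norm)
    then obtain e where e: "e > 0" "\<And>w. norm (w - \<sigma>) < e \<Longrightarrow> norm (C w) < \<eta>"
      by (auto simp: dist_norm C_def)
    show ?thesis
    proof (intro exI[of _ "min e 1"] conjI subsetI)
      show "min e 1 > 0" using e by simp
      fix w assume "w \<in> ball 0 1 \<inter> ball \<sigma> (min e 1)"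
      then have w: "norm w < 1" "norm (w - \<sigma>) < e" "norm (w - \<sigma>) < 1"
        by (auto simp: dist_norm norm_minus_commute)
      then have "C w \<in> F ` ball 0 r'" using e(2) \<eta> by (auto simp: subset_iff)
      then obtain \<zeta> where \<zeta>: "norm \<zeta> < r'" "C w = F \<zeta>" by auto
      have ImCw: "Im (C w) > 0"
        using w nz[of w] by (simp add: ImC power_less_one_iff)
      \<comment> \<open>The reflected \<open>F\<close> is real on the diameter and has negative
        imaginary part below it, whereas \<open>Im (C w) > 0\<close>; so the preimage lies in the
        original half disc.\<close>
      have "Im \<zeta> > 0"
      proof (rule ccontr)
        assume "\<not> Im \<zeta> > 0"
        then consider "Im \<zeta> = 0" | "Im \<zeta> < 0" by linarith
        then show False
        proof cases
          case 1
          then have "\<zeta> = of_real (Re \<zeta>)" by (simp add: complex_eq_iff)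
          moreover have "\<bar>Re \<zeta>\<bar> < \<rho>" using abs_Re_le_cmod[of \<zeta>] \<zeta> r' \<rho>' by linarith
          ultimately have "norm (G \<zeta>) = 1" using G1 by metis
          then show ?thesis using \<zeta> 1 ImCw by (simp add: F_def f_def ImC)
        next
          case 2
          then have "Im (f (cnj \<zeta>)) > 0" using \<zeta> r' by (intro fpos) (auto simp: S_def)
          then show ?thesis using \<zeta> 2 ImCw by (simp add: F_def)
        qed
      qed
      then have "C w = C (G \<zeta>)" using \<zeta> by (simp add: F_def f_def)
      moreover have "norm (G \<zeta> - \<sigma>) < 1" using near[of \<zeta>] \<zeta> r' \<open>Im \<zeta> > 0\<close> by simp
      ultimately have "w = G \<zeta>" using Cinj w by blast
      moreover have "\<zeta> \<in> half_ball 0 \<rho>" using \<zeta> r' \<rho>' \<open>Im \<zeta> > 0\<close> by (simp add: half_ball_def)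
      ultimately show "w \<in> H ` (half_ball 0 a \<inter> ball 0 r)"
        using G(2)[of \<zeta>] suba[OF \<rho>(3)] \<zeta> r' by (intro image_eqI[of _ _ \<zeta>]) auto
    qed
  qed
  then show ?thesis using that \<sigma> lim\<sigma> by blast
qed

section \<open>Charts at the boundary of the slit domain\<close>

lemma limitin_riemann_sphere_Some:
  assumes "(f \<longlongrightarrow> l) F"
  shows "limitin riemann_sphere (\<lambda>x. Some (f x)) (Some l) F"
  unfolding limitin_def
proof (intro conjI allI impI)
  fix U assume U: "openin riemann_sphere U \<and> Some l \<in> U"
  have "open {z. Some z \<in> U}"
  proof -
    have "{z. Some z \<in> U} = V" if "U = Some ` V" for V using that by auto
    moreover have "{z. Some z \<in> U} = - C" if "U = insert None (Some ` (UNIV - C))" for C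
      using that by auto
    ultimately show ?thesis
      using U unfolding riemann_sphere_def openin_Alexandroff_compactification
      by (auto simp: open_Compl)
  qed
  then have "\<forall>\<^sub>F x in F. f x \<in> {z. Some z \<in> U}"
    using U by (intro topological_tendstoD[OF assms]) auto
  then show "\<forall>\<^sub>F x in F. Some (f x) \<in> U" by simp
qed simp

lemma limitin_riemann_sphere_None:
  assumes "filterlim f at_infinity F"
  shows "limitin riemann_sphere (\<lambda>x. Some (f x)) None F"
  unfolding limitin_def
proof (intro conjI allI impI)
  fix U assume U: "openin riemann_sphere U \<and> None \<in> U"
  then obtain C where C: "compact C" "U = insert None (Some ` (UNIV - C))"
    unfolding riemann_sphere_def openin_Alexandroff_compactification by auto
  then obtain B where B: "\<And>z. z \<in> C \<Longrightarrow> norm z \<le> B"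
    using compact_imp_bounded bounded_iff by metis
  have "\<forall>\<^sub>F z in at_infinity. z \<notin> C"
    unfolding eventually_at_infinity using B by (intro exI[of _ "B + 1"]) force
  then have "\<forall>\<^sub>F x in F. f x \<notin> C"
    using assms by (rule eventually_compose_filterlim)
  then show "\<forall>\<^sub>F x in F. Some (f x) \<in> U"
    by eventually_elim (use C in auto)
qed simp

lemma limitin_riemann_sphere_tendsto:
  assumes "limitin riemann_sphere f L F"
  shows "((\<lambda>x. sphere_point (f x)) \<longlongrightarrow> sphere_point L) F"
proof -
  have "continuous_map riemann_sphere euclidean sphere_point"
    using embedding_map_sphere_point unfolding embedding_map_def
    by (metis continuous_map_in_subtopology homeomorphic_imp_continuous_map)
  from continuous_map_limit[OF this assms] show ?thesis by (simp add: o_def)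
qed

section \<open>Elementary geometry of slits, gates and strips\<close>

lemma slit_x_pos: "slit_x n > 0"
  by (simp add: slit_x_def)

lemma slit_x_Suc: "slit_x (Suc n) = slit_x n / 2"
  by (simp add: slit_x_def)

lemma slit_x_le: "m \<le> n \<Longrightarrow> slit_x n \<le> slit_x m"
  by (simp add: slit_x_def divide_simps)

lemma slit_x_le_1: "slit_x n \<le> 1"
  using slit_x_le[of 0 n] by (simp add: slit_x_def)

lemma slit_y_pos: "slit_y n > 0"
  by (simp add: slit_y_def)

lemma slit_y_eq: "slit_y n = slit_x n / exp (3 ^ n)"
  by (simp add: slit_x_def slit_y_def)

lemma slit_y_le_half: "slit_y n \<le> slit_x n / 2"
proof -
  have "(2::real) \<le> 1 + 3 ^ n" by simp
  also have "\<dots> \<le> exp (3 ^ n)" by (rule exp_ge_add_one_self)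
  finally show ?thesis
    using slit_x_pos[of n] unfolding slit_y_eq by (intro divide_left_mono) auto
qed

lemma slit_y_less_1: "slit_y n < 1"
  using slit_y_le_half[of n] slit_x_le_1[of n] by simp

lemma slit_x_tendsto_0: "slit_x \<longlonglongrightarrow> 0"
  unfolding slit_x_def by real_asymp

lemma slit_domainI:
  assumes "Re z > 0" "\<And>n. Re z = slit_x n \<Longrightarrow> \<bar>Im z\<bar> < slit_y n"
  shows "z \<in> slit_domain"
  using assms by (fastforce simp: slit_domain_def)

lemma slit_domain_Re_pos: "z \<in> slit_domain \<Longrightarrow> Re z > 0"
  by (simp add: slit_domain_def)

lemma slit_domain_gate: "z \<in> slit_domain \<Longrightarrow> Re z = slit_x n \<Longrightarrow> \<bar>Im z\<bar> < slit_y n"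
  by (force simp: slit_domain_def)

lemma strip_subset_slit_domain:
  assumes "slit_x (Suc n) < Re z" "Re z < slit_x n"
  shows "z \<in> slit_domain"
proof (rule slit_domainI)
  show "Re z > 0" using assms slit_x_pos[of "Suc n"] by linarith
  fix m assume "Re z = slit_x m"
  moreover have "m \<le> n \<or> Suc n \<le> m" by linarith
  ultimately show "\<bar>Im z\<bar> < slit_y m"
    using assms slit_x_le[of m n] slit_x_le[of "Suc n" m] by auto
qed

text \<open>The nearest other slit line is \<open>Re z = slit_x n / 2\<close>, so in this range only
  the \<open>n\<close>-th pair of slits can interfere.\<close>

lemma near_slit_in_slit_domain:
  assumes "\<bar>Re z - slit_x n\<bar> < slit_x n / 2" "Re z = slit_x n \<Longrightarrow> \<bar>Im z\<bar> < slit_y n"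
  shows "z \<in> slit_domain"
proof (rule slit_domainI)
  show "Re z > 0" using assms(1) slit_x_pos[of n] by linarith
  fix m assume m: "Re z = slit_x m"
  consider "m = n" | "Suc n \<le> m" | "Suc m \<le> n" by linarith
  then show "\<bar>Im z\<bar> < slit_y m"
  proof cases
    case 1 then show ?thesis using m assms(2) by simp
  next
    case 2 then show ?thesis
      using m assms(1) slit_x_le[of "Suc n" m] by (simp add: slit_x_Suc abs_if split: if_splits)
  next
    case 3 then show ?thesis
      using m assms(1) slit_x_le[of "Suc m" n] slit_x_pos[of n] by (simp add: slit_x_Suc abs_if split: if_splits)
  qed
qed

lemma Re_gt_1_slit_domain: "Re z > 1 \<Longrightarrow> z \<in> slit_domain"
  by (rule slit_domainI) (auto dest: less_le_trans[OF _ slit_x_le_1])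

lemma of_real_slit_domain: "t > 0 \<Longrightarrow> complex_of_real t \<in> slit_domain"
  by (rule slit_domainI) (auto simp: slit_y_pos)

lemma slit_in_complement: "Re z = slit_x n \<Longrightarrow> slit_y n \<le> \<bar>Im z\<bar> \<Longrightarrow> z \<notin> slit_domain"
  by (auto simp: slit_domain_def)

lemma cnj_slit_domain: "z \<in> slit_domain \<Longrightarrow> cnj z \<in> slit_domain"
  by (auto simp: slit_domain_def)

section \<open>Flat charts at boundary points and ends\<close>

lemma eventually_not_in_compact_tendsto:
  assumes "(f \<longlongrightarrow> p) F" "p \<notin> K" "compact (K::complex set)"
  shows "\<forall>\<^sub>F x in F. f x \<notin> K"
  using topological_tendstoD[OF assms(1), of "- K"] assms(2,3)
  by (auto simp: compact_imp_closed open_Compl)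

lemma eventually_not_in_compact_at_infinity:
  assumes "filterlim f at_infinity F" "compact (K::complex set)"
  shows "\<forall>\<^sub>F x in F. f x \<notin> K"
proof -
  obtain B where B: "\<And>z. z \<in> K \<Longrightarrow> norm z \<le> B"
    using compact_imp_bounded[OF assms(2)] bounded_iff by metis
  have "\<forall>\<^sub>F z in at_infinity. z \<notin> K"
    unfolding eventually_at_infinity using B by (intro exI[of _ "B + 1"]) force
  then show ?thesis using assms(1) by (rule eventually_compose_filterlim)
qed

text \<open>Flat coordinates at a boundary point (or at an end) of the slit domain, centred at 0 and tending
  to \<open>L\<close> there. The lower bound on the real part keeps the chart away from the end at the
  imaginary axis.\<close>

definition boundary_chart :: "(complex \<Rightarrow> complex) \<Rightarrow> real \<Rightarrow> complex option \<Rightarrow> bool" where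
  "boundary_chart \<psi> a L \<longleftrightarrow>
     0 < a \<and> \<psi> holomorphic_on half_ball 0 a \<and> \<psi> ` half_ball 0 a \<subseteq> slit_domain \<and>
     (\<forall>t K. \<bar>t\<bar> < a \<longrightarrow> compact K \<longrightarrow> K \<subseteq> slit_domain \<longrightarrow>
        (\<forall>\<^sub>F z in at (complex_of_real t) within half_ball 0 a. \<psi> z \<notin> K)) \<and>
     limitin riemann_sphere (\<lambda>z. Some (\<psi> z)) L (at 0 within half_ball 0 a) \<and>
     (\<exists>c>0. \<forall>z\<in>half_ball 0 a. c \<le> Re (\<psi> z))"

text \<open>The square opens the upper (\<open>s = 1\<close>) or lower (\<open>s = -1\<close>) slit: its two sides
  correspond to the real \<open>\<zeta> > - a\<close> and \<open>\<zeta> < - a\<close>, and its tip to \<open>\<zeta> = - a\<close>.\<close>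

definition slit_chart :: "nat \<Rightarrow> real \<Rightarrow> real \<Rightarrow> complex \<Rightarrow> complex" where
  "slit_chart n s a \<zeta> = of_real (slit_x n) + \<i> * of_real s * (of_real (slit_y n) + (of_real a + \<zeta>)\<^sup>2)"

lemma Re_slit_chart: "Re (slit_chart n s a z) = slit_x n - 2 * s * (a + Re z) * Im z"
  by (simp add: slit_chart_def power2_eq_square algebra_simps)

lemma Im_slit_chart: "Im (slit_chart n s a z) = s * (slit_y n + (a + Re z)\<^sup>2 - (Im z)\<^sup>2)"
  by (simp add: slit_chart_def power2_eq_square algebra_simps)

lemma slit_chart_near:
  assumes s: "s = 1 \<or> s = -1" and r: "2 * (\<bar>a\<bar> + r) * r \<le> slit_x n / 2" and z: "z \<in> half_ball 0 r"
  shows "\<bar>Re (slit_chart n s a z) - slit_x n\<bar> < slit_x n / 2"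
proof -
  have "norm z < r" "Im z > 0" using z by (auto simp: half_ball_def)
  then have "\<bar>Re z\<bar> < r" "\<bar>Im z\<bar> < r"
    using abs_Re_le_cmod[of z] abs_Im_le_cmod[of z] by auto
  then have "\<bar>a + Re z\<bar> * \<bar>Im z\<bar> < (\<bar>a\<bar> + r) * r"
    by (intro mult_strict_mono') auto
  moreover have "2 * ((\<bar>a\<bar> + r) * r) \<le> slit_x n / 2"
    using r by (simp only: mult.assoc)
  moreover have "\<bar>Re (slit_chart n s a z) - slit_x n\<bar> = 2 * (\<bar>a + Re z\<bar> * \<bar>Im z\<bar>)"
    using s by (auto simp: Re_slit_chart abs_mult)
  ultimately show ?thesis by linarith
qed

text \<open>Of the two smallness conditions on \<open>r\<close>, the second keeps the image away
  from the neighbouring slits. The first is needed on the axis \<open>a + Re z = 0\<close>, which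
  runs from the tip through the gate: there the height is \<open>slit_y n - (Im z)\<^sup>2\<close>
  up to sign, and it must not reach the opposite slit.\<close>

lemma boundary_chart_slit:
  assumes s: "s = 1 \<or> s = -1" and r: "r > 0" "r\<^sup>2 \<le> 2 * slit_y n" "2 * (\<bar>a\<bar> + r) * r \<le> slit_x n / 2"
  shows "boundary_chart (slit_chart n s a) r (Some (slit_chart n s a 0))"
proof -
  let ?\<psi> = "slit_chart n s a"
  have abs_s: "\<bar>s\<bar> = 1" using s by auto
  have cont: "continuous_on UNIV ?\<psi>"
    unfolding slit_chart_def by (intro continuous_intros)
  have lim: "(?\<psi> \<longlongrightarrow> ?\<psi> p) (at p within A)" for p A
    using cont by (metis UNIV_I continuous_on_def subset_UNIV tendsto_within_subset)
  have near: "\<bar>Re (?\<psi> z) - slit_x n\<bar> < slit_x n / 2" if "z \<in> half_ball 0 r" for z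
    using slit_chart_near[OF s r(3) that] .
  show ?thesis
    unfolding boundary_chart_def
  proof (intro conjI allI impI)
    show "?\<psi> holomorphic_on half_ball 0 r"
      unfolding slit_chart_def by (intro holomorphic_intros)
    show "?\<psi> ` half_ball 0 r \<subseteq> slit_domain"
    proof
      fix w assume "w \<in> ?\<psi> ` half_ball 0 r"
      then obtain z where z: "z \<in> half_ball 0 r" "w = ?\<psi> z" by blast
      have nz: "norm z < r" "Im z > 0" using z by (auto simp: half_ball_def)
      have "\<bar>Im w\<bar> < slit_y n" if "Re w = slit_x n"
      proof -
        have "a + Re z = 0" using that z nz s by (auto simp: Re_slit_chart)
        moreover have "(Im z)\<^sup>2 < 2 * slit_y n"
        proof -
          have "Im z < r" using nz abs_Im_le_cmod[of z] by simp
          then have "(Im z)\<^sup>2 < r\<^sup>2" using nz by (intro power_strict_mono) auto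
          then show ?thesis using r by simp
        qed
        moreover have "(Im z)\<^sup>2 > 0" using nz by simp
        ultimately have "\<bar>slit_y n - (Im z)\<^sup>2\<bar> < slit_y n"
          using slit_y_pos[of n] by linarith
        then show ?thesis using abs_s \<open>a + Re z = 0\<close> by (simp add: z Im_slit_chart abs_mult)
      qed
      then show "w \<in> slit_domain" using near[OF z(1)] z(2) by (intro near_slit_in_slit_domain) auto
    qed
    show "\<forall>\<^sub>F z in at (complex_of_real t) within half_ball 0 r. ?\<psi> z \<notin> K"
      if "\<bar>t\<bar> < r" "compact K" "K \<subseteq> slit_domain" for t K
    proof (rule eventually_not_in_compact_tendsto[OF lim])
      have "?\<psi> (of_real t) \<notin> slit_domain"
        by (rule slit_in_complement[of _ n]) (use abs_s slit_y_pos[of n] in \<open>auto simp: Re_slit_chart Im_slit_chart abs_mult\<close>)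
      then show "?\<psi> (of_real t) \<notin> K" using that by blast
    qed (use that in auto)
    show "limitin riemann_sphere (\<lambda>z. Some (?\<psi> z)) (Some (?\<psi> 0)) (at 0 within half_ball 0 r)"
      by (intro limitin_riemann_sphere_Some lim)
    show "\<exists>c>0. \<forall>z\<in>half_ball 0 r. c \<le> Re (?\<psi> z)"
    proof (intro exI[of _ "slit_x n / 2"] conjI ballI)
      show "slit_x n / 2 \<le> Re (?\<psi> z)" if "z \<in> half_ball 0 r" for z
        using near[OF that] by linarith
    qed (simp add: slit_x_pos)
  qed (use r in auto)
qed

text \<open>The upper (\<open>s = 1\<close>) or lower (\<open>s = -1\<close>) end of the strip between \<open>slit_x (Suc n)\<close> and
  \<open>slit_x n\<close>, with \<open>\<infinity>\<close> at \<open>\<zeta> = 0\<close>.\<close>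

definition strip_chart :: "nat \<Rightarrow> real \<Rightarrow> complex \<Rightarrow> complex" where
  "strip_chart n s \<zeta> = of_real (3/4 * slit_x n) - \<i> * of_real (s * slit_x n / (2 * pi)) * Ln (- \<i> * \<zeta>)"

text \<open>For \<open>Im \<zeta> > 0\<close> the argument of \<open>- \<i> * \<zeta>\<close> lies
  between \<open>- pi / 2\<close> and \<open>pi / 2\<close>; scaling by
  \<open>slit_x n / (2 * pi)\<close> and centring at \<open>3/4 * slit_x n\<close> gives exactly the
  strip. The radius is chosen such that heights are at least 1: nonzero real \<zeta> then land on a
  slit and not in a gate.\<close>

lemma boundary_chart_strip:
  assumes s: "s = 1 \<or> s = -1"
  shows "boundary_chart (strip_chart n s) (exp (- (2 * pi / slit_x n))) None"
proof -
  let ?\<psi> = "strip_chart n s"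
  define x where "x = slit_x n"
  define r where "r = exp (- (2 * pi / x))"
  have x: "x > 0" by (simp add: x_def slit_x_pos)
  have r: "r > 0" by (simp add: r_def)
  have abs_s: "\<bar>s\<bar> = 1" using s by auto
  have Re\<psi>: "Re (?\<psi> z) = 3/4 * x + s * x / (2 * pi) * Im (Ln (- \<i> * z))" for z
    by (simp add: strip_chart_def x_def)
  have Im\<psi>: "Im (?\<psi> z) = - s * x / (2 * pi) * ln (norm z)" if "z \<noteq> 0" for z
    using that by (simp add: strip_chart_def x_def norm_mult)
  have lnr: "\<bar>x / (2 * pi) * ln (norm z)\<bar> \<ge> 1" if "norm z < r" "z \<noteq> 0" for z :: complex
  proof -
    have "ln (norm z) < ln r" using that r by (intro ln_less_cancel_iff[THEN iffD2]) auto
    then have "ln (norm z) \<le> - (2 * pi / x)" by (simp add: r_def)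
    then have "x / (2 * pi) * ln (norm z) \<le> x / (2 * pi) * (- (2 * pi / x))"
      using x by (intro mult_left_mono) auto
    also have "\<dots> = -1" using x by (simp add: field_simps)
    finally show ?thesis by linarith
  qed
  have strip: "x / 2 < Re (?\<psi> z)" "Re (?\<psi> z) < x" if "Im z > 0" for z
  proof -
    have "\<bar>Im (Ln (- \<i> * z))\<bar> < pi / 2"
      using that by (subst Re_Ln_pos_lt) auto
    then have "x / (2 * pi) * \<bar>Im (Ln (- \<i> * z))\<bar> < x / (2 * pi) * (pi / 2)"
      using x by (intro mult_strict_left_mono) auto
    then have "\<bar>s * x / (2 * pi) * Im (Ln (- \<i> * z))\<bar> < x / 4"
      using x abs_s by (simp add: abs_mult)
    then show "x / 2 < Re (?\<psi> z)" "Re (?\<psi> z) < x"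
      unfolding Re\<psi> by linarith+
  qed
  have inf: "filterlim ?\<psi> at_infinity (at 0 within half_ball 0 r)"
  proof (rule filterlim_norm_at_top_imp_at_infinity, rule filterlim_at_top_mono)
    have "filterlim (\<lambda>u. (x / (2 * pi)) * (- ln u)) at_top (at_right 0)"
      by (rule filterlim_tendsto_pos_mult_at_top[OF tendsto_const])
        (use x ln_at_0 in \<open>auto simp: filterlim_uminus_at_top\<close>)
    then have "filterlim (\<lambda>u. - (x / (2 * pi)) * ln u) at_top (at_right 0)" by simp
    moreover have "filterlim norm (at_right 0) (at (0::complex) within half_ball 0 r)"
      unfolding filterlim_at by (auto simp: eventually_at_filter intro!: tendsto_norm_zero tendsto_ident_at)
    ultimately show "filterlim (\<lambda>z. - (x / (2 * pi)) * ln (norm z)) at_top (at (0::complex) within half_ball 0 r)"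
      by (rule filterlim_compose)
    show "\<forall>\<^sub>F z in at 0 within half_ball 0 r. - (x / (2 * pi)) * ln (norm z) \<le> norm (?\<psi> z)"
      unfolding eventually_at_filter
    proof (rule eventuallyI, intro impI)
      fix z :: complex assume z: "z \<noteq> 0"
      have "\<bar>Im (?\<psi> z)\<bar> = \<bar>x / (2 * pi) * ln (norm z)\<bar>"
        unfolding Im\<psi>[OF z] using abs_s by (simp add: abs_mult)
      then show "- (x / (2 * pi)) * ln (norm z) \<le> norm (?\<psi> z)"
        using abs_Im_le_cmod[of "?\<psi> z"] by (simp add: abs_le_iff)
    qed
  qed
  have "boundary_chart ?\<psi> r None"
    unfolding boundary_chart_def
  proof (intro conjI allI impI)
    show "?\<psi> holomorphic_on half_ball 0 r"
      unfolding strip_chart_def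
      by (intro holomorphic_intros) (auto simp: half_ball_def complex_nonpos_Reals_iff)
    show "?\<psi> ` half_ball 0 r \<subseteq> slit_domain"
      using strip by (auto simp: half_ball_def x_def slit_x_Suc intro!: strip_subset_slit_domain[of n])
    show "\<forall>\<^sub>F z in at (complex_of_real t) within half_ball 0 r. ?\<psi> z \<notin> K"
      if t: "\<bar>t\<bar> < r" and K: "compact K" "K \<subseteq> slit_domain" for t K
    proof (cases "t = 0")
      case True
      then show ?thesis using eventually_not_in_compact_at_infinity[OF inf K(1)] by simp
    next
      case False
      have "(?\<psi> \<longlongrightarrow> ?\<psi> (of_real t)) (at (complex_of_real t) within half_ball 0 r)"
        unfolding strip_chart_def
        by (intro tendsto_intros) (use False in \<open>auto simp: complex_nonpos_Reals_iff\<close>)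
      moreover have "?\<psi> (of_real t) \<notin> slit_domain"
      proof -
        define I where "I = Im (Ln (- \<i> * complex_of_real t))"
        have "\<bar>I\<bar> \<le> pi / 2" "\<not> \<bar>I\<bar> < pi / 2"
          unfolding I_def using False by (subst Re_Ln_pos_le Re_Ln_pos_lt; simp)+
        then have "I = pi / 2 \<or> I = - (pi / 2)" by linarith
        moreover have "Re (?\<psi> (of_real t)) = 3/4 * x + s * x / (2 * pi) * I"
          unfolding I_def by (rule Re\<psi>)
        ultimately have "Re (?\<psi> (of_real t)) = 3/4 * x + s * x / 4 \<or> Re (?\<psi> (of_real t)) = 3/4 * x - s * x / 4"
          by (elim disjE) simp_all
        then have "Re (?\<psi> (of_real t)) = slit_x n \<or> Re (?\<psi> (of_real t)) = slit_x (Suc n)"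
          using s by (auto simp: slit_x_Suc x_def[symmetric])
        moreover have "\<bar>Im (?\<psi> (of_real t))\<bar> \<ge> 1"
          using lnr[of "of_real t"] False t abs_s by (simp add: Im\<psi> abs_mult)
        then have "slit_y m \<le> \<bar>Im (?\<psi> (of_real t))\<bar>" for m
          using slit_y_less_1[of m] by linarith
        ultimately show ?thesis using slit_in_complement by blast
      qed
      ultimately show ?thesis using K by (intro eventually_not_in_compact_tendsto) auto
    qed
    show "limitin riemann_sphere (\<lambda>z. Some (?\<psi> z)) None (at 0 within half_ball 0 r)"
      by (rule limitin_riemann_sphere_None[OF inf])
    show "\<exists>c>0. \<forall>z\<in>half_ball 0 r. c \<le> Re (?\<psi> z)"
      using strip x by (intro exI[of _ "x / 2"]) (auto simp: half_ball_def intro: less_imp_le)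
  qed (rule r)
  then show ?thesis by (simp add: r_def x_def)
qed

text \<open>No slit enters \<open>Re z > 1\<close>, so one chart serves both directions to
  \<infinity>. Radius 1 gives nonzero real \<zeta> an image on the line \<open>Re z = 1\<close> at
  height above 1, hence on a slit with \<open>n = 0\<close>.\<close>

lemma boundary_chart_halfplane: "boundary_chart (\<lambda>\<zeta>. 1 + \<i> / \<zeta>) 1 None"
proof -
  have inf: "filterlim (\<lambda>\<zeta>. 1 + \<i> / \<zeta>) at_infinity (at 0 within half_ball 0 1)"
  proof (rule tendsto_add_filterlim_at_infinity[OF tendsto_const])
    have "filterlim (\<lambda>\<zeta>. inverse \<zeta>) at_infinity (at (0::complex) within half_ball 0 1)"
      by (rule filterlim_mono[OF filterlim_inverse_at_infinity]) (auto intro: at_le)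
    then show "filterlim (\<lambda>\<zeta>. \<i> / \<zeta>) at_infinity (at 0 within half_ball 0 1)"
      unfolding divide_inverse by (intro tendsto_mult_filterlim_at_infinity[OF tendsto_const]) auto
  qed
  have Re: "Re (1 + \<i> / z) = 1 + Im z / (norm z)\<^sup>2" for z
    by (simp add: Re_divide cmod_power2)
  have gt: "Re (1 + \<i> / z) > 1" if "Im z > 0" for z
    using that unfolding Re by (auto simp: zero_less_divide_iff)
  show ?thesis
    unfolding boundary_chart_def
  proof (intro conjI allI impI)
    show "(\<lambda>\<zeta>. 1 + \<i> / \<zeta>) holomorphic_on half_ball 0 1"
      by (intro holomorphic_intros) (auto simp: half_ball_def)
    show "(\<lambda>\<zeta>. 1 + \<i> / \<zeta>) ` half_ball 0 1 \<subseteq> slit_domain"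
      using gt by (auto simp: half_ball_def intro!: Re_gt_1_slit_domain)
    show "\<forall>\<^sub>F z in at (complex_of_real t) within half_ball 0 1. 1 + \<i> / z \<notin> K"
      if t: "\<bar>t\<bar> < 1" and K: "compact K" "K \<subseteq> slit_domain" for t K
    proof (cases "t = 0")
      case True
      then show ?thesis using eventually_not_in_compact_at_infinity[OF inf K(1)] by simp
    next
      case False
      have "((\<lambda>\<zeta>. 1 + \<i> / \<zeta>) \<longlongrightarrow> 1 + \<i> / of_real t) (at (complex_of_real t) within half_ball 0 1)"
        by (intro tendsto_intros) (use False in auto)
      moreover have "1 + \<i> / of_real t \<notin> slit_domain"
      proof (rule slit_in_complement[of _ 0])
        show "Re (1 + \<i> / of_real t) = slit_x 0" by (simp add: slit_x_def)
        have "1 \<le> 1 / \<bar>t\<bar>" using t False by (simp add: divide_simps)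
        then have "slit_y 0 \<le> 1 / \<bar>t\<bar>" using slit_y_less_1[of 0] by linarith
        then show "slit_y 0 \<le> \<bar>Im (1 + \<i> / of_real t)\<bar>"
          using False by (simp add: Im_divide power2_eq_square)
      qed
      ultimately show ?thesis using K by (intro eventually_not_in_compact_tendsto) auto
    qed
    show "limitin riemann_sphere (\<lambda>z. Some (1 + \<i> / z)) None (at 0 within half_ball 0 1)"
      by (rule limitin_riemann_sphere_None[OF inf])
    show "\<exists>c>0. \<forall>z\<in>half_ball 0 1. c \<le> Re (1 + \<i> / z)"
      using gt by (intro exI[of _ 1]) (auto simp: half_ball_def intro: less_imp_le)
  qed simp
qed

lemma boundary_chart_slit_exists:
  assumes s: "s = 1 \<or> s = -1"
  obtains r where "boundary_chart (slit_chart n s a) r (Some (slit_chart n s a 0))"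
proof -
  define r where "r = min (min 1 (sqrt (2 * slit_y n))) (slit_x n / (4 * (\<bar>a\<bar> + 1)))"
  have r: "r > 0" "r \<le> 1" "r \<le> sqrt (2 * slit_y n)" "r \<le> slit_x n / (4 * (\<bar>a\<bar> + 1))"
    using slit_x_pos[of n] slit_y_pos[of n] by (auto simp: r_def add_nonneg_pos)
  have "r\<^sup>2 \<le> (sqrt (2 * slit_y n))\<^sup>2"
    using r by (intro power_mono) auto
  then have 1: "r\<^sup>2 \<le> 2 * slit_y n" using slit_y_pos[of n] by simp
  have "2 * (\<bar>a\<bar> + r) * r \<le> 2 * (\<bar>a\<bar> + 1) * (slit_x n / (4 * (\<bar>a\<bar> + 1)))"
    using r by (intro mult_mono) auto
  also have "\<dots> = slit_x n / 2"
    by (simp add: field_simps)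
  finally show ?thesis
    using that boundary_chart_slit[OF s r(1) 1] by blast
qed

text \<open>The bound \<open>n < N\<close> matters: points with real part at least \<open>e\<close>
  meet only finitely many strips, so infinitely many terms of a sequence share one.\<close>

lemma in_some_strip:
  assumes "0 < e" "e \<le> x" "x < 1" "\<And>m. x \<noteq> slit_x m" "slit_x N < e"
  shows "\<exists>n<N. slit_x (Suc n) < x \<and> x < slit_x n"
proof -
  define m where "m = (LEAST m. slit_x m < x)"
  have ex: "slit_x N < x" using assms by simp
  have m: "slit_x m < x" "m \<le> N"
    unfolding m_def using ex by (rule LeastI, rule Least_le)
  have "m \<noteq> 0"
    using m(1) assms(3) by (intro notI) (simp add: slit_x_def)
  then obtain n where n: "m = Suc n" by (cases m) auto
  have "\<not> slit_x n < x"
    using not_less_Least[of n "\<lambda>m. slit_x m < x"] n by (simp add: m_def)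
  then have "x < slit_x n" using assms(4)[of n] by simp
  then show ?thesis using m n by (intro exI[of _ n]) auto
qed

lemma Re_csqrt_pos:
  assumes "v \<notin> \<real>\<^sub>\<le>\<^sub>0"
  shows "Re (csqrt v) > 0"
proof -
  have "Re (csqrt v) \<noteq> 0"
  proof
    assume "Re (csqrt v) = 0"
    then have eq: "csqrt v = \<i> * of_real (Im (csqrt v))" by (simp add: complex_eq_iff)
    obtain u where "csqrt v = \<i> * of_real u" using eq by blast
    then have "v = (\<i> * of_real u)\<^sup>2" by (metis power2_csqrt)
    then have "v = of_real (- (u\<^sup>2))" by (simp add: power_mult_distrib)
    moreover have "complex_of_real (- (u\<^sup>2)) \<in> \<real>\<^sub>\<le>\<^sub>0"
      by (subst nonpos_Reals_of_real_iff) simp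
    ultimately show False using assms by simp
  qed
  then show ?thesis using csqrt_principal[of v] by auto
qed

text \<open>This is the compactness of the boundary away from the imaginary axis, in sequential
  form. A bounded subsequence accumulates at a slit point and is resolved by a square root;
  otherwise the sequence tends to \<infinity>, and by pigeonhole a subsequence stays in one of
  finitely many ends.\<close>

lemma boundary_chart_cover:
  fixes p :: "nat \<Rightarrow> complex"
  assumes pD: "\<And>k. p k \<in> slit_domain" and e: "e > 0" and eRe: "\<And>k. e \<le> Re (p k)"
    and leave: "\<And>K. compact K \<Longrightarrow> K \<subseteq> slit_domain \<Longrightarrow> \<forall>\<^sub>F k in sequentially. p k \<notin> K"
  obtains \<psi> a L \<zeta> \<phi> where "boundary_chart \<psi> a L" "strict_mono (\<phi> :: nat \<Rightarrow> nat)"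
    "\<And>k. \<zeta> k \<in> half_ball 0 a" "\<zeta> \<longlonglongrightarrow> 0" "\<And>k. \<psi> (\<zeta> k) = p (\<phi> k)"
proof -
  note result = that
  have finish: thesis
    if ch: "boundary_chart \<psi> a L" and \<phi>: "strict_mono (\<phi> :: nat \<Rightarrow> nat)" and Im: "\<And>k. Im (\<zeta> k) > 0"
      and lim: "\<zeta> \<longlonglongrightarrow> 0" and eq: "\<And>k. \<psi> (\<zeta> k) = p (\<phi> k)" for \<psi> a L \<zeta> \<phi>
  proof -
    have "a > 0" using ch by (simp add: boundary_chart_def)
    then have "\<forall>\<^sub>F k in sequentially. norm (\<zeta> k) < a"
      using lim by (intro order_tendstoD(2)[of _ 0]) (auto simp: tendsto_norm_zero_iff)
    then obtain N where N: "\<And>k. k \<ge> N \<Longrightarrow> norm (\<zeta> k) < a"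
      by (auto simp: eventually_sequentially)
    show thesis
    proof (rule result[OF ch, where \<zeta> = "\<lambda>k. \<zeta> (k + N)" and \<phi> = "\<lambda>k. \<phi> (k + N)"])
      show "strict_mono (\<lambda>k. \<phi> (k + N))" using \<phi> by (simp add: strict_mono_def)
      show "(\<lambda>k. \<zeta> (k + N)) \<longlonglongrightarrow> 0" using lim by (rule LIMSEQ_ignore_initial_segment)
    qed (use N Im eq in \<open>auto simp: half_ball_def\<close>)
  qed
  show thesis
  proof (cases "\<exists>R. infinite {k. norm (p k) \<le> R}")
    case True
    then obtain R where "infinite {k. norm (p k) \<le> R}" by blast
    then obtain \<phi>1 :: "nat \<Rightarrow> nat" where \<phi>1: "strict_mono \<phi>1" "\<And>k. \<phi>1 k \<in> {k. norm (p k) \<le> R}"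
      using infinite_enumerate by blast
    have "\<forall>k. (p \<circ> \<phi>1) k \<in> cball 0 R" using \<phi>1(2) by simp
    then obtain l \<phi>2 where \<phi>2: "strict_mono (\<phi>2 :: nat \<Rightarrow> nat)" "((p \<circ> \<phi>1) \<circ> \<phi>2) \<longlonglongrightarrow> l"
      using compact_cball[of "0::complex" R] unfolding compact_def by blast
    define q where "q k = p (\<phi>1 (\<phi>2 k))" for k
    have q: "q \<longlonglongrightarrow> l" using \<phi>2(2) by (simp add: q_def[abs_def] o_def)
    have sm: "strict_mono (\<lambda>k. \<phi>1 (\<phi>2 k))"
      using \<phi>1(1) \<phi>2(1) by (simp add: strict_mono_def)
    have Rel: "e \<le> Re l"
      by (rule tendsto_lowerbound[OF tendsto_Re[OF q]]) (auto simp: q_def eRe)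
    have "l \<notin> slit_domain"
    proof
      assume "l \<in> slit_domain"
      then obtain d where d: "d > 0" "cball l d \<subseteq> slit_domain"
        using slit_domain_simply_connected_domain(1) open_contains_cball by blast
      have "\<forall>\<^sub>F k in sequentially. p k \<notin> cball l d"
        using d by (intro leave) auto
      then have "\<forall>\<^sub>F k in sequentially. q k \<notin> cball l d"
        unfolding q_def by (rule eventually_subseq[OF sm])
      moreover have "\<forall>\<^sub>F k in sequentially. q k \<in> ball l d"
        using q d(1) by (intro topological_tendstoD) auto
      ultimately have "\<forall>\<^sub>F k in sequentially. False"
        by eventually_elim auto
      then show False by simp
    qed
    moreover have "Re l > 0" using Rel e by simp
    ultimately obtain n where n: "Re l = slit_x n" "slit_y n \<le> \<bar>Im l\<bar>"
      using slit_domainI[of l] by force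
    define s :: real where "s = (if Im l \<ge> 0 then 1 else -1)"
    have s: "s = 1 \<or> s = -1" "s * s = 1" "s * \<bar>Im l\<bar> = Im l" by (auto simp: s_def)
    define v where "v = \<bar>Im l\<bar> - slit_y n"
    have v: "v \<ge> 0" using n by (simp add: v_def)
    define V where "V k = - \<i> * of_real s * (q k - of_real (slit_x n)) - of_real (slit_y n)" for k
    have "V \<longlonglongrightarrow> - \<i> * of_real s * (l - of_real (slit_x n)) - of_real (slit_y n)"
      unfolding V_def by (intro tendsto_intros q)
    also have "- \<i> * of_real s * (l - of_real (slit_x n)) - of_real (slit_y n) = of_real v"
      using n(1) s by (auto simp: complex_eq_iff v_def s_def)
    finally have V: "V \<longlonglongrightarrow> of_real v" .
    \<comment> \<open>The square root of \<open>V k\<close> in the upper half-plane, which inverts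
      the square in \<open>slit_chart\<close>. It is well placed because nonnegative real values of
      \<open>V k\<close> would mean that \<open>q k\<close> lies on the slit.\<close>
    define w where "w k = \<i> * csqrt (- V k)" for k
    have w2: "(w k)\<^sup>2 = V k" for k
      by (simp add: w_def power_mult_distrib)
    have qV: "q k = of_real (slit_x n) + \<i> * of_real s * (of_real (slit_y n) + V k)" for k
    proof -
      have "of_real s * of_real s = (1::complex)" using s(2) by (metis of_real_1 of_real_mult)
      moreover have "\<i> * of_real s * (of_real (slit_y n) + V k)
          = of_real s * of_real s * (q k - of_real (slit_x n))"
        unfolding V_def by (simp add: algebra_simps)
      ultimately show ?thesis by simp
    qed
    have Imw: "Im (w k) > 0" for k
    proof -
      have "- V k \<notin> \<real>\<^sub>\<le>\<^sub>0"
      proof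
        assume "- V k \<in> \<real>\<^sub>\<le>\<^sub>0"
        then obtain u where u: "V k = of_real u" "u \<ge> 0"
          by (auto elim: nonneg_Reals_cases)
        have "Re (q k) = slit_x n" "\<bar>Im (q k)\<bar> \<ge> slit_y n"
          using s(1) slit_y_pos[of n] u(2) unfolding qV[of k] u(1) by (auto simp: abs_if)
        then show False using slit_in_complement pD by (metis q_def)
      qed
      then have "Re (csqrt (- V k)) > 0" by (rule Re_csqrt_pos)
      then show ?thesis by (simp add: w_def)
    qed
    have "bounded (range w)"
    proof -
      have "bounded (range V)" using V by (simp add: convergent_imp_bounded)
      then obtain B where B: "\<And>k. norm (V k) \<le> B" by (auto simp: bounded_iff)
      have "norm (w k) \<le> sqrt B" for k
      proof -
        have "(norm (w k))\<^sup>2 \<le> B" using B[of k] w2[of k] by (metis norm_power)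
        then show ?thesis by (rule real_le_rsqrt)
      qed
      then show ?thesis by (auto simp: bounded_iff)
    qed
    \<comment> \<open>\<open>V\<close> converges, but \<open>w\<close> may alternate between the
      neighbourhoods of \<open>sqrt v\<close> and \<open>- sqrt v\<close>, the two sides of the
      slit. A further subsequence selects one side and thereby the centre \<open>a\<close> of the
      chart.\<close>
    then obtain l' \<phi>3 where \<phi>3: "strict_mono (\<phi>3 :: nat \<Rightarrow> nat)" "(w \<circ> \<phi>3) \<longlonglongrightarrow> l'"
      using bounded_imp_convergent_subsequence by blast
    have "(\<lambda>k. (w (\<phi>3 k))\<^sup>2) \<longlonglongrightarrow> l'\<^sup>2"
      using \<phi>3(2) by (intro tendsto_power) (simp add: o_def)
    moreover have "(\<lambda>k. (w (\<phi>3 k))\<^sup>2) \<longlonglongrightarrow> of_real v"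
      unfolding w2 using LIMSEQ_subseq_LIMSEQ[OF V \<phi>3(1)] by (simp add: o_def)
    ultimately have "l'\<^sup>2 = of_real v" by (rule LIMSEQ_unique)
    then have "l'\<^sup>2 = (of_real (sqrt v))\<^sup>2" using v by (simp flip: of_real_power)
    then have "l' = of_real (sqrt v) \<or> l' = of_real (- sqrt v)" by (simp add: power2_eq_iff)
    then obtain a where a: "l' = of_real a" by blast
    obtain r where r: "boundary_chart (slit_chart n s a) r (Some (slit_chart n s a 0))"
      using boundary_chart_slit_exists[OF s(1)] .
    show thesis
    proof (rule finish[OF r, where \<phi> = "\<lambda>k. \<phi>1 (\<phi>2 (\<phi>3 k))" and \<zeta> = "\<lambda>k. w (\<phi>3 k) - of_real a"])
      show "strict_mono (\<lambda>k. \<phi>1 (\<phi>2 (\<phi>3 k)))"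
        using sm \<phi>3(1) by (simp add: strict_mono_def)
      show "Im (w (\<phi>3 k) - complex_of_real a) > 0" for k using Imw by simp
      show "(\<lambda>k. w (\<phi>3 k) - complex_of_real a) \<longlonglongrightarrow> 0"
        using \<phi>3(2) a by (simp add: o_def LIM_zero)
      show "slit_chart n s a (w (\<phi>3 k) - complex_of_real a) = p (\<phi>1 (\<phi>2 (\<phi>3 k)))" for k
        using qV[of "\<phi>3 k"] by (simp add: slit_chart_def w2 q_def)
    qed
  next
    case False
    then have fin: "finite {k. norm (p k) \<le> R}" for R by blast
    have inf: "filterlim p at_infinity sequentially"
      unfolding filterlim_at_infinity[OF order_refl]
    proof (intro allI impI)
      fix R :: real assume "R > 0"
      obtain N where "\<forall>k\<in>{k. norm (p k) \<le> R}. k < N"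
        using finite_nat_set_iff_bounded[of "{k. norm (p k) \<le> R}"] fin[of R] by blast
      then show "\<forall>\<^sub>F k in sequentially. R \<le> norm (p k)"
        unfolding eventually_sequentially by (metis leD linear mem_Collect_eq)
    qed
    show thesis
    proof (cases "infinite {k. Re (p k) > 1}")
      case True
      then obtain \<phi> :: "nat \<Rightarrow> nat" where \<phi>: "strict_mono \<phi>" "\<And>k. \<phi> k \<in> {k. Re (p k) > 1}"
        using infinite_enumerate by blast
      have inf': "filterlim (\<lambda>k. - 1 + p (\<phi> k)) at_infinity sequentially"
        by (rule tendsto_add_filterlim_at_infinity[OF tendsto_const])
          (rule filterlim_compose[OF inf filterlim_subseq[OF \<phi>(1)]])
      show thesis
      proof (rule finish[OF boundary_chart_halfplane \<phi>(1), where \<zeta> = "\<lambda>k. \<i> / (- 1 + p (\<phi> k))"])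
        show "Im (\<i> / (- 1 + p (\<phi> k))) > 0" for k
        proof -
          have "Re (- 1 + p (\<phi> k)) > 0" using \<phi>(2)[of k] by simp
          then show ?thesis
            by (auto simp: Im_divide zero_less_divide_iff add_pos_nonneg)
        qed
        show "(\<lambda>k. \<i> / (- 1 + p (\<phi> k))) \<longlonglongrightarrow> 0"
          by (rule tendsto_divide_0[OF tendsto_const inf'])
        show "1 + \<i> / (\<i> / (- 1 + p (\<phi> k))) = p (\<phi> k)" for k
          by simp
      qed
    next
      case False
      define S where "S n s = {k. slit_x (Suc n) < Re (p k) \<and> Re (p k) < slit_x n \<and> s * Im (p k) > 1}" for n and s :: real
      obtain N where N: "slit_x N < e"
        using order_tendstoD(2)[OF slit_x_tendsto_0 e] by (auto simp: eventually_sequentially)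
      \<comment> \<open>A point with modulus above 3 and real part in the interval from
        \<open>e\<close> to 1 has height above 1, hence cannot sit in a gate and lies in one of the
        first \<open>N\<close> strips.\<close>
      have "UNIV \<subseteq> {k. norm (p k) \<le> 3} \<union> {k. Re (p k) > 1} \<union> (\<Union>n<N. S n 1 \<union> S n (-1))"
      proof
        fix k :: nat
        show "k \<in> {k. norm (p k) \<le> 3} \<union> {k. Re (p k) > 1} \<union> (\<Union>n<N. S n 1 \<union> S n (-1))"
        proof (cases "norm (p k) \<le> 3 \<or> Re (p k) > 1")
          case False
          then have "\<bar>Im (p k)\<bar> > 1"
            using cmod_le[of "p k"] eRe[of k] e by linarith
          then have ne: "Re (p k) \<noteq> slit_x m" for m
            using slit_domain_gate[OF pD[of k], of m] slit_y_less_1[of m] by force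
          moreover have "slit_x 0 = 1" by (simp add: slit_x_def)
          ultimately have "Re (p k) < 1" using False by (metis linorder_cases)
          then obtain n where "n < N" "slit_x (Suc n) < Re (p k) \<and> Re (p k) < slit_x n"
            using in_some_strip[OF e eRe _ ne N] by blast
          then show ?thesis
            using \<open>\<bar>Im (p k)\<bar> > 1\<close> by (auto simp: S_def abs_if split: if_splits)
        qed auto
      qed
      moreover have "finite {k. Re (p k) > 1}" using False by simp
      ultimately have "\<not> finite (\<Union>n<N. S n 1 \<union> S n (-1))"
        using fin[of 3] infinite_UNIV_nat by (meson finite_Un finite_subset)
      then obtain n s where ns: "s = 1 \<or> s = (-1::real)" "infinite (S n s)"
        by auto
      from ns(2) obtain \<phi> :: "nat \<Rightarrow> nat" where \<phi>: "strict_mono \<phi>" "\<And>k. \<phi> k \<in> S n s"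
        using infinite_enumerate by blast
      define x where "x = slit_x n"
      have x: "x > 0" by (simp add: x_def slit_x_pos)
      \<comment> \<open>The logarithm of \<open>- \<i> * \<zeta>\<close>, found by solving the
        equation of \<open>strip_chart\<close> for it.\<close>
      define A where "A k = \<i> * of_real (s * 2 * pi / x) * (p (\<phi> k) - of_real (3/4 * x))" for k
      have ReA: "Re (A k) = - (2 * pi / x) * (s * Im (p (\<phi> k)))"
        and ImA: "Im (A k) = s * (2 * pi / x) * (Re (p (\<phi> k)) - 3/4 * x)" for k
        by (auto simp: A_def)
      have strip: "x / 2 < Re (p (\<phi> k))" "Re (p (\<phi> k)) < x" "s * Im (p (\<phi> k)) > 1" for k
        using \<phi>(2)[of k] by (auto simp: S_def x_def slit_x_Suc)
      have ImA_less: "\<bar>Im (A k)\<bar> < pi / 2" for k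
      proof -
        have "\<bar>Im (A k)\<bar> = 2 * pi / x * \<bar>Re (p (\<phi> k)) - 3/4 * x\<bar>"
          using ns(1) x unfolding ImA by (auto simp: abs_mult)
        also have "\<dots> < 2 * pi / x * (x / 4)"
          using strip[of k] x by (intro mult_strict_left_mono) (auto simp: abs_if)
        also have "\<dots> = pi / 2" using x by simp
        finally show ?thesis .
      qed
      show thesis
      proof (rule finish[OF boundary_chart_strip[OF ns(1)] \<phi>(1), where \<zeta> = "\<lambda>k. \<i> * exp (A k)"])
        show "Im (\<i> * exp (A k)) > 0" for k
          using ImA_less[of k] by (simp add: Re_exp cos_gt_zero_pi abs_less_iff)
        show "strip_chart n s (\<i> * exp (A k)) = p (\<phi> k)" for k
        proof -
          have "Ln (exp (A k)) = A k"
            using ImA_less[of k] pi_gt_zero by (intro Ln_exp) linarith+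
          moreover have "\<i> * of_real (s * x / (2 * pi)) * A k = - (p (\<phi> k) - of_real (3/4 * x))"
            using x ns(1) by (auto simp: A_def field_simps)
          ultimately show ?thesis
            by (simp add: strip_chart_def x_def[symmetric])
        qed
        have top: "filterlim (\<lambda>k. - 1 + norm (p (\<phi> k))) at_top sequentially"
          by (rule filterlim_tendsto_add_at_top[OF tendsto_const]) (rule filterlim_compose[OF filterlim_norm_at_top filterlim_compose[OF inf filterlim_subseq[OF \<phi>(1)]]])
        have le: "- 1 + norm (p (\<phi> k)) \<le> s * Im (p (\<phi> k))" for k
        proof -
          have "x \<le> 1" by (simp add: x_def slit_x_le_1)
          moreover have "\<bar>Im (p (\<phi> k))\<bar> = s * Im (p (\<phi> k))" using ns(1) strip(3)[of k] by auto
          ultimately show ?thesis using cmod_le[of "p (\<phi> k)"] strip[of k] x by simp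
        qed
        have "filterlim (\<lambda>k. s * Im (p (\<phi> k))) at_top sequentially"
          by (rule filterlim_at_top_mono[OF top]) (intro always_eventually allI le)
        then have "filterlim (\<lambda>k. 2 * pi / x * (s * Im (p (\<phi> k)))) at_top sequentially"
          by (rule filterlim_tendsto_pos_mult_at_top[OF tendsto_const, rotated]) (use x in auto)
        then have "filterlim (\<lambda>k. Re (A k)) at_bot sequentially"
          unfolding ReA filterlim_uminus_at_top by simp
        then have lim: "(\<lambda>k. exp (Re (A k))) \<longlonglongrightarrow> 0"
          by (rule filterlim_compose[OF exp_at_bot])
        show "(\<lambda>k. \<i> * exp (A k)) \<longlonglongrightarrow> 0"
          by (rule tendsto_norm_zero_cancel) (use lim in \<open>simp add: norm_mult\<close>)
      qed
    qed
  qed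
qed

section \<open>Limits of the normalized Riemann map\<close>

lemma norm_Moebius_identity:
  fixes w z :: complex
  shows "(cmod (1 - cnj w * z))\<^sup>2 - (cmod (z - w))\<^sup>2 = (1 - (cmod w)\<^sup>2) * (1 - (cmod z)\<^sup>2)"
  unfolding cmod_power2 by (simp add: power2_eq_square algebra_simps)

lemma eventually_at_withinI: "(\<And>x. x \<in> S \<Longrightarrow> P x) \<Longrightarrow> \<forall>\<^sub>F x in at a within S. P x"
  unfolding eventually_at_filter by (rule always_eventually) auto

text \<open>\<open>h_decreasing\<close> fixes the remaining sign: with \<open>h_1\<close> it makes
  \<open>h\<close> positive on the real interval from 0 to 1, so that \<open>norm h\<close> tending
  to 1 at the imaginary axis becomes \<open>h\<close> tending to 1 along the real axis.\<close>

locale normalized_slit_map =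
  fixes g h :: "complex \<Rightarrow> complex"
  assumes hol_g: "g holomorphic_on ball 0 1" and hol_h: "h holomorphic_on slit_domain"
    and g_in: "\<And>z. norm z < 1 \<Longrightarrow> g z \<in> slit_domain"
    and h_in: "\<And>p. p \<in> slit_domain \<Longrightarrow> norm (h p) < 1"
    and h_g: "\<And>z. norm z < 1 \<Longrightarrow> h (g z) = z"
    and g_h: "\<And>p. p \<in> slit_domain \<Longrightarrow> g (h p) = p"
    and h_cnj: "\<And>p. p \<in> slit_domain \<Longrightarrow> h (cnj p) = cnj (h p)"
    and h_1: "h 1 = 0"
    and h_decreasing: "\<And>s t. 0 < s \<Longrightarrow> s < t \<Longrightarrow> Re (h (of_real t)) < Re (h (of_real s))"
begin

lemma norm_h_tendsto_1:
  assumes "\<And>K. compact K \<Longrightarrow> K \<subseteq> slit_domain \<Longrightarrow> \<forall>\<^sub>F x in F. f x \<notin> K"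
    and "\<forall>\<^sub>F x in F. f x \<in> slit_domain"
  shows "((\<lambda>x. norm (h (f x))) \<longlongrightarrow> 1) F"
proof (rule order_tendstoI)
  fix a :: real assume a: "a < 1"
  let ?K = "g ` cball 0 (max a 0)"
  have sub: "cball 0 (max a 0) \<subseteq> ball (0::complex) 1" using a by auto
  have "compact ?K"
    using holomorphic_on_imp_continuous_on[OF hol_g] sub
    by (intro compact_continuous_image) (auto intro: continuous_on_subset)
  moreover have "?K \<subseteq> slit_domain" using sub g_in by auto
  ultimately have "\<forall>\<^sub>F x in F. f x \<notin> ?K" by (rule assms(1))
  then show "\<forall>\<^sub>F x in F. a < norm (h (f x))"
    using assms(2)
  proof eventually_elim
    case (elim x)
    show ?case
    proof (rule ccontr)
      assume "\<not> a < norm (h (f x))"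
      then have "h (f x) \<in> cball 0 (max a 0)" by auto
      then have "g (h (f x)) \<in> ?K" by (rule imageI)
      then show False using elim g_h by simp
    qed
  qed
next
  fix a :: real assume "1 < a"
  show "\<forall>\<^sub>F x in F. norm (h (f x)) < a"
    using assms(2) by eventually_elim (use h_in \<open>1 < a\<close> in fastforce)
qed

lemma g_leaves_compact:
  assumes "(z \<longlongrightarrow> \<sigma>) F" "norm \<sigma> = 1" "\<forall>\<^sub>F x in F. norm (z x) < 1"
    and K: "compact K" "K \<subseteq> slit_domain"
  shows "\<forall>\<^sub>F x in F. g (z x) \<notin> K"
proof -
  have "compact (h ` K)"
    using holomorphic_on_imp_continuous_on[OF hol_h] K
    by (intro compact_continuous_image) (auto intro: continuous_on_subset)
  moreover have "\<sigma> \<notin> h ` K" using h_in K(2) assms(2) by force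
  ultimately have "\<forall>\<^sub>F x in F. z x \<notin> h ` K"
    using assms(1) by (intro eventually_not_in_compact_tendsto)
  then show ?thesis
    using assms(3) by eventually_elim (metis h_g imageI)
qed

text \<open>Since images of small half discs cover a neighbourhood of \<sigma> in the disc, every
  \<open>z\<close> near \<sigma> is \<open>h (\<psi> \<zeta>)\<close> with small \<zeta>, and then
  \<open>g z = \<psi> \<zeta>\<close>. So the limit of the chart, and the lower bound on its real
  part, pass to \<open>g\<close>.\<close>

lemma chart_boundary_value:
  assumes ch: "boundary_chart \<psi> a L"
  obtains \<sigma> c where "norm \<sigma> = 1" "((\<lambda>z. h (\<psi> z)) \<longlongrightarrow> \<sigma>) (at 0 within half_ball 0 a)"
    "unrestricted_limit g \<sigma> L" "c > 0" "\<forall>\<^sub>F z in at \<sigma> within ball 0 1. c \<le> Re (g z)"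
proof -
  let ?H = "\<lambda>z. h (\<psi> z)"
  have a: "a > 0" and hol: "\<psi> holomorphic_on half_ball 0 a" and sub: "\<psi> ` half_ball 0 a \<subseteq> slit_domain"
    and lv: "\<And>t K. \<bar>t\<bar> < a \<Longrightarrow> compact K \<Longrightarrow> K \<subseteq> slit_domain \<Longrightarrow>
        \<forall>\<^sub>F z in at (complex_of_real t) within half_ball 0 a. \<psi> z \<notin> K"
    and L: "limitin riemann_sphere (\<lambda>z. Some (\<psi> z)) L (at 0 within half_ball 0 a)"
    using ch by (auto simp: boundary_chart_def)
  obtain c where c: "c > 0" "\<And>z. z \<in> half_ball 0 a \<Longrightarrow> c \<le> Re (\<psi> z)"
    using ch by (auto simp: boundary_chart_def)
  obtain \<sigma> where \<sigma>: "norm \<sigma> = 1" "(?H \<longlongrightarrow> \<sigma>) (at 0 within half_ball 0 a)"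
    and img: "\<And>r. r > 0 \<Longrightarrow> \<exists>d>0. ball 0 1 \<inter> ball \<sigma> d \<subseteq> ?H ` (half_ball 0 a \<inter> ball 0 r)"
  proof (rule flat_boundary_value[of ?H a])
    show "?H holomorphic_on half_ball 0 a"
      using holomorphic_on_compose_gen[OF hol hol_h sub] by (simp add: o_def)
    show "((\<lambda>z. norm (?H z)) \<longlongrightarrow> 1) (at (complex_of_real t) within half_ball 0 a)" if "\<bar>t\<bar> < a" for t
      using lv[OF that] sub by (intro norm_h_tendsto_1) (auto intro: eventually_at_withinI)
  qed (use a sub h_in in auto)
  have near: "\<forall>\<^sub>F z in at \<sigma> within ball 0 1. \<exists>\<zeta>\<in>half_ball 0 a. norm \<zeta> < r \<and> g z = \<psi> \<zeta>" if "r > 0" for r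
  proof -
    obtain d where d: "d > 0" "ball 0 1 \<inter> ball \<sigma> d \<subseteq> ?H ` (half_ball 0 a \<inter> ball 0 r)"
      using img \<open>r > 0\<close> by blast
    show ?thesis
      unfolding eventually_at
    proof (intro exI[of _ d] conjI ballI impI)
      fix z assume "z \<in> ball 0 1" "z \<noteq> \<sigma> \<and> dist z \<sigma> < d"
      then have "z \<in> ?H ` (half_ball 0 a \<inter> ball 0 r)" using d(2) by (auto simp: dist_commute)
      then obtain \<zeta> where "\<zeta> \<in> half_ball 0 a" "norm \<zeta> < r" "z = ?H \<zeta>" by auto
      then show "\<exists>\<zeta>\<in>half_ball 0 a. norm \<zeta> < r \<and> g z = \<psi> \<zeta>"
        using g_h sub by (intro bexI[of _ \<zeta>]) auto
    qed (rule d)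
  qed
  have "unrestricted_limit g \<sigma> L"
    unfolding unrestricted_limit_def limitin_def
  proof (intro conjI allI impI)
    fix U assume "openin riemann_sphere U \<and> L \<in> U"
    then have "\<forall>\<^sub>F z in at 0 within half_ball 0 a. Some (\<psi> z) \<in> U"
      using L by (auto simp: limitin_def)
    then obtain r where r: "r > 0" "\<And>z. z \<in> half_ball 0 a \<Longrightarrow> z \<noteq> 0 \<Longrightarrow> norm z < r \<Longrightarrow> Some (\<psi> z) \<in> U"
      by (auto simp: eventually_at)
    have "0 \<notin> half_ball 0 a" by (simp add: half_ball_def)
    then show "\<forall>\<^sub>F z in at \<sigma> within ball 0 1. Some (g z) \<in> U"
      using near[OF r(1)] by (auto elim!: eventually_mono) (metis r(2))
  qed simp
  moreover have "\<forall>\<^sub>F z in at \<sigma> within ball 0 1. c \<le> Re (g z)"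
    using near[OF zero_less_one] by (rule eventually_mono) (use c in auto)
  ultimately show ?thesis using that \<sigma> c by blast
qed

text \<open>One sequence is enough: a subsequence of its image runs into the centre of a chart, and
  the boundary value of \<open>h\<close> in that chart must be the limit \<sigma> of the sequence
  itself.\<close>

lemma boundary_value_of_sequence:
  assumes \<sigma>: "norm \<sigma> = 1" and z: "\<And>k. norm (z k) < 1" "z \<longlonglongrightarrow> \<sigma>"
    and e: "e > 0" "\<And>k. e \<le> Re (g (z k))"
  obtains L c where "unrestricted_limit g \<sigma> L" "c > 0" "\<forall>\<^sub>F z in at \<sigma> within ball 0 1. c \<le> Re (g z)"
proof -
  have leave: "\<forall>\<^sub>F k in sequentially. g (z k) \<notin> K" if "compact K" "K \<subseteq> slit_domain" for K
    using z(1) by (intro g_leaves_compact[OF z(2) \<sigma> _ that]) auto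
  obtain \<psi> a L \<zeta> \<phi> where ch: "boundary_chart \<psi> a L" and \<phi>: "strict_mono \<phi>"
    and \<zeta>: "\<And>k. \<zeta> k \<in> half_ball 0 a" "\<zeta> \<longlonglongrightarrow> 0" "\<And>k. \<psi> (\<zeta> k) = g (z (\<phi> k))"
    by (rule boundary_chart_cover[of "\<lambda>k. g (z k)" e, OF g_in[OF z(1)] e],
        rule leave, assumption+, rule that, assumption+)
  obtain \<sigma>' c where \<sigma>': "norm \<sigma>' = 1" "((\<lambda>z. h (\<psi> z)) \<longlongrightarrow> \<sigma>') (at 0 within half_ball 0 a)"
    and *: "unrestricted_limit g \<sigma>' L" "c > 0" "\<forall>\<^sub>F z in at \<sigma>' within ball 0 1. c \<le> Re (g z)"
    by (rule chart_boundary_value[OF ch])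
  have "0 \<notin> half_ball 0 a" by (simp add: half_ball_def)
  then have "\<zeta> k \<noteq> 0" for k using \<zeta>(1)[of k] by metis
  then have "filterlim \<zeta> (at 0 within half_ball 0 a) sequentially"
    unfolding filterlim_at using \<zeta>(1,2) by auto
  from filterlim_compose[OF \<sigma>'(2) this] have "(\<lambda>k. z (\<phi> k)) \<longlonglongrightarrow> \<sigma>'"
    by (simp add: \<zeta>(3) h_g z(1))
  moreover have "(\<lambda>k. z (\<phi> k)) \<longlonglongrightarrow> \<sigma>"
    using LIMSEQ_subseq_LIMSEQ[OF z(2) \<phi>] by (simp add: o_def)
  ultimately have "\<sigma>' = \<sigma>" by (rule LIMSEQ_unique)
  then show ?thesis using that * by blast
qed

section \<open>The end at the imaginary axis\<close>

lemma norm_h_near_1: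
  assumes "\<delta> > 0"
  obtains m where "m > 0" "\<And>p. p \<in> slit_domain \<Longrightarrow> Re p < m \<Longrightarrow> norm (h p) \<ge> 1 - \<delta>"
proof -
  define K where "K = g ` cball 0 (max 0 (1 - \<delta>))"
  have sub: "cball 0 (max 0 (1 - \<delta>)) \<subseteq> ball (0::complex) 1" using assms by auto
  have "compact K"
    unfolding K_def using holomorphic_on_imp_continuous_on[OF hol_g] sub
    by (intro compact_continuous_image) (auto intro: continuous_on_subset)
  moreover have "K \<noteq> {}" by (simp add: K_def)
  ultimately obtain q where q: "q \<in> K" "\<And>p. p \<in> K \<Longrightarrow> Re q \<le> Re p"
    using continuous_attains_inf[of K Re] continuous_on_Re[OF continuous_on_id] by auto
  show ?thesis
  proof (rule that[of "Re q"])
    show "Re q > 0" using q(1) sub g_in by (auto simp: K_def intro!: slit_domain_Re_pos)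
    fix p assume p: "p \<in> slit_domain" "Re p < Re q"
    then have "p \<notin> K" using q(2) by force
    then have "h p \<notin> cball 0 (max 0 (1 - \<delta>))" using g_h[OF p(1)] by (metis K_def imageI)
    then show "norm (h p) \<ge> 1 - \<delta>" by auto
  qed
qed

lemma Im_h_real: "t > 0 \<Longrightarrow> Im (h (of_real t)) = 0"
  using h_cnj[OF of_real_slit_domain, of t] by (simp add: complex_eq_iff)

lemma g_real:
  assumes "\<bar>r\<bar> < 1"
  obtains x where "x > 0" "g (of_real r) = of_real x"
proof -
  have gD: "g (of_real r) \<in> slit_domain" using assms by (intro g_in) simp
  have "h (cnj (g (of_real r))) = h (g (of_real r))"
    using assms by (simp add: h_cnj[OF gD] h_g)
  then have "cnj (g (of_real r)) = g (of_real r)"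
    using g_h[OF gD] g_h[OF cnj_slit_domain[OF gD]] by metis
  then have "g (of_real r) = of_real (Re (g (of_real r)))"
    by (simp add: complex_eq_iff)
  then show ?thesis using that slit_domain_Re_pos[OF gD] by metis
qed

lemma h_real_tendsto_1:
  assumes "\<epsilon> > 0"
  obtains m where "m > 0" "\<And>t. 0 < t \<Longrightarrow> t < m \<Longrightarrow> Re (h (of_real t)) \<ge> 1 - \<epsilon>"
proof -
  obtain m where m: "m > 0" "\<And>p. p \<in> slit_domain \<Longrightarrow> Re p < m \<Longrightarrow> norm (h p) \<ge> 1 - \<epsilon>"
    using norm_h_near_1[OF assms] by blast
  show ?thesis
  proof (rule that[of "min m 1"])
    fix t :: real assume t: "0 < t" "t < min m 1"
    have "Re (h (of_real t)) > 0" using h_decreasing[of t 1] t h_1 by simp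
    then have "norm (h (of_real t)) = Re (h (of_real t))"
      using Im_h_real[OF t(1)] by (simp add: cmod_def)
    then show "Re (h (of_real t)) \<ge> 1 - \<epsilon>" using m(2)[OF of_real_slit_domain[OF t(1)]] t by simp
  qed (use m in auto)
qed

text \<open>The bound depends on \<delta> only, not on the width of the gate. Up to 7/8 of its
  half-width, discs of radius \<open>y / 8\<close> stay in the domain and Schwarz-Pick gives
  \<open>14 * \<delta>\<close>; the remainder up to the tip is handled in the slit chart centred at
  the tip and gives \<open>8 * \<delta>\<close>.\<close>

lemma gate_image_small:
  assumes n: "n \<ge> 1" and \<delta>: "0 < \<delta>" "\<delta> \<le> 1/2"
    and low: "\<And>p. p \<in> slit_domain \<Longrightarrow> Re p < 3/2 * slit_x n \<Longrightarrow> norm (h p) \<ge> 1 - \<delta>"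
    and p: "p \<in> slit_domain" "Re p = slit_x n"
  shows "norm (h p - h (of_real (slit_x n))) \<le> 22 * \<delta>"
proof -
  define x where "x = slit_x n"
  define y where "y = slit_y n"
  have xy: "x > 0" "y > 0" by (auto simp: x_def y_def slit_x_pos slit_y_pos)
  \<comment> \<open>Here \<open>n \<ge> 1\<close> enters, through \<open>exp 3 \<ge> 8\<close>. The
    slit chart of radius \<open>sqrt (2 * y)\<close> requires
    \<open>4 * y \<le> x / 2\<close>.\<close>
  have "y \<le> x / 8"
  proof -
    have "(3::real) ^ 1 \<le> 3 ^ n" using n by (intro power_increasing) auto
    moreover have "(8::real) \<le> 1 + 3 + 3\<^sup>2 / 2" by simp
    then have "(8::real) \<le> exp 3" using exp_lower_Taylor_quadratic[of 3] by linarith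
    ultimately have "8 \<le> exp ((3::real) ^ n)"
      by (metis exp_le_cancel_iff order_trans power_one_right)
    then show ?thesis using xy unfolding x_def y_def slit_y_eq by (intro divide_left_mono) auto
  qed
  note y8 = this
  define S where "S = {z. Re z = x \<and> \<bar>Im z\<bar> \<le> 7/8 * y}"
  have ballD: "q \<in> slit_domain" "Re q < 3/2 * x" if z: "z \<in> S" and q: "q \<in> ball z (y/8)" for z q
  proof -
    have "norm (q - z) < y / 8" using q by (simp add: dist_norm norm_minus_commute)
    then have "\<bar>Re q - Re z\<bar> < y / 8" "\<bar>Im q - Im z\<bar> < y / 8"
      using abs_Re_le_cmod[of "q - z"] abs_Im_le_cmod[of "q - z"] by auto
    moreover have "Re z = x" "\<bar>Im z\<bar> \<le> 7/8 * y" using z by (auto simp: S_def)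
    ultimately have 1: "\<bar>Re q - x\<bar> < x / 2" and 2: "\<bar>Im q\<bar> < y"
      using y8 xy by (simp, linarith)
    show "q \<in> slit_domain"
      by (rule near_slit_in_slit_domain[of _ n]) (use 1 2 in \<open>simp_all add: x_def y_def\<close>)
    show "Re q < 3/2 * x" using 1 by linarith
  qed
  have SD: "S \<subseteq> slit_domain" using ballD(1) xy by force
  have interior: "norm (h z - h w) \<le> 16 * \<delta> / y * norm (z - w)" if "z \<in> S" "w \<in> S" for z w
  proof (rule field_differentiable_bound[where S = S and f' = "deriv h"])
    show "convex S"
    proof -
      have "S = {z. Re z \<le> x} \<inter> {z. Re z \<ge> x} \<inter> {z. Im z \<le> 7/8 * y} \<inter> {z. Im z \<ge> - (7/8 * y)}"
        by (auto simp: S_def)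
      then show ?thesis
        by (metis convex_Int convex_halfspace_Re_le convex_halfspace_Re_ge convex_halfspace_Im_le convex_halfspace_Im_ge)
    qed
    show "(h has_field_derivative deriv h u) (at u within S)" if "u \<in> S" for u
      using that SD holomorphic_derivI[OF hol_h slit_domain_simply_connected_domain(1)]
      by (blast intro: has_field_derivative_at_within)
    fix u assume u: "u \<in> S"
    have "y / 8 * norm (deriv h u) \<le> 1 - (norm (h u))\<^sup>2"
      by (rule Schwarz_Pick_deriv)
        (use ballD(1)[OF u] h_in xy in \<open>auto intro!: holomorphic_on_subset[OF hol_h] simp del: mem_ball\<close>)
    also have "\<dots> = (1 - norm (h u)) * (1 + norm (h u))"
      by (simp add: power2_eq_square algebra_simps)
    also have "\<dots> \<le> \<delta> * 2"
      using low[of u] u SD h_in[of u] \<delta> xy by (intro mult_mono) (auto simp: S_def x_def)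
    finally show "norm (deriv h u) \<le> 16 * \<delta> / y" using xy by (simp add: field_simps)
  qed (use that in auto)
  have center: "norm (h z - h (of_real x)) \<le> 14 * \<delta>" if z: "z \<in> S" for z
  proof -
    have xS: "of_real x \<in> S" using xy by (simp add: S_def)
    have "z - of_real x = \<i> * of_real (Im z)" using z by (simp add: S_def complex_eq_iff)
    then have "norm (z - of_real x) = \<bar>Im z\<bar>" by (simp add: norm_mult)
    then have "norm (h z - h (of_real x)) \<le> 16 * \<delta> / y * \<bar>Im z\<bar>"
      using interior[OF z xS] by simp
    also have "\<dots> \<le> 16 * \<delta> / y * (7/8 * y)"
      using z \<delta> xy by (intro mult_left_mono) (auto simp: S_def)
    finally show ?thesis using xy by simp
  qed
  show ?thesis
  proof (cases "\<bar>Im p\<bar> \<le> 7/8 * y")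
    case True
    then have "p \<in> S" using p by (simp add: S_def x_def)
    then show ?thesis using center[of p] \<delta> by (simp add: x_def)
  next
    case False
    define s :: real where "s = (if Im p \<ge> 0 then 1 else -1)"
    have s: "s = 1 \<or> s = -1" "s * \<bar>Im p\<bar> = Im p" by (auto simp: s_def)
    define r where "r = sqrt (2 * y)"
    have r: "r > 0" "r\<^sup>2 = 2 * y" using xy by (auto simp: r_def)
    have cond: "2 * (\<bar>0\<bar> + r) * r \<le> slit_x n / 2"
      using r y8 by (simp add: power2_eq_square[symmetric] x_def)
    let ?\<psi> = "slit_chart n s 0"
    have ch: "boundary_chart ?\<psi> r (Some (?\<psi> 0))"
      by (rule boundary_chart_slit[OF s(1) r(1) _ cond]) (use r in \<open>simp add: y_def\<close>)
    then have hol: "?\<psi> holomorphic_on half_ball 0 r" and sub: "?\<psi> ` half_ball 0 r \<subseteq> slit_domain"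
      and lv: "\<And>t K. \<bar>t\<bar> < r \<Longrightarrow> compact K \<Longrightarrow> K \<subseteq> slit_domain \<Longrightarrow>
          \<forall>\<^sub>F z in at (complex_of_real t) within half_ball 0 r. ?\<psi> z \<notin> K"
      by (auto simp: boundary_chart_def)
    have py: "\<bar>Im p\<bar> < y" using slit_domain_gate[OF p] by (simp add: y_def)
    define \<eta> where "\<eta> = sqrt (y - \<bar>Im p\<bar>)"
    have \<eta>: "\<eta> > 0" "\<eta>\<^sup>2 = y - \<bar>Im p\<bar>" using py by (auto simp: \<eta>_def)
    have "\<eta>\<^sup>2 < (r/4)\<^sup>2" using False \<eta> r by (simp add: power_divide)
    then have \<eta>r: "\<eta> < r/4" by (rule power2_less_imp_less) (use r in simp)
    have val: "?\<psi> (\<i> * of_real u) = of_real x + \<i> * of_real (s * (y - u\<^sup>2))" for u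
      by (simp add: complex_eq_iff Re_slit_chart Im_slit_chart x_def y_def)
    have p_eq: "?\<psi> (\<i> * of_real \<eta>) = p"
    proof (rule complex_eqI)
      show "Re (?\<psi> (\<i> * of_real \<eta>)) = Re p"
        using p(2) by (simp add: Re_slit_chart)
      have "Im (?\<psi> (\<i> * of_real \<eta>)) = s * (y - \<eta>\<^sup>2)"
        by (simp add: Im_slit_chart y_def)
      then show "Im (?\<psi> (\<i> * of_real \<eta>)) = Im p"
        unfolding \<eta>(2) by (simp only: diff_diff_eq2 add_diff_cancel_left' s(2))
    qed
    define p0 where "p0 = ?\<psi> (\<i> * of_real (r/4))"
    have "p0 = of_real x + \<i> * of_real (s * (7/8 * y))"
      unfolding p0_def val using r(2) by (simp add: power_divide)
    then have p0: "p0 \<in> S" using s(1) xy by (auto simp: S_def)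
    have "norm (h (?\<psi> (\<i> * of_real \<eta>)) - h (?\<psi> (\<i> * of_real (r/4))))
      \<le> 24 * \<delta> / r * norm (\<i> * of_real \<eta> - \<i> * complex_of_real (r/4))"
    proof (rule flat_boundary_Lipschitz[where H = "\<lambda>z. h (?\<psi> z)", OF _ r(1) _ _ \<delta>])
      show "(\<lambda>z. h (?\<psi> z)) holomorphic_on half_ball 0 r"
        using holomorphic_on_compose_gen[OF hol hol_h sub] by (simp add: o_def)
      show "((\<lambda>z. norm (h (?\<psi> z))) \<longlongrightarrow> 1) (at (complex_of_real t) within half_ball 0 r)" if "\<bar>t\<bar> < r" for t
        using lv[OF that] sub by (intro norm_h_tendsto_1) (auto intro: eventually_at_withinI)
      show "1 - \<delta> \<le> norm (h (?\<psi> z))" if "z \<in> half_ball 0 r" for z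
      proof (rule low)
        show "?\<psi> z \<in> slit_domain" using sub that by blast
        show "Re (?\<psi> z) < 3/2 * slit_x n"
          using slit_chart_near[OF s(1) cond that] by linarith
      qed
      show "\<i> * of_real \<eta> \<in> half_ball 0 (r/3)" "\<i> * complex_of_real (r/4) \<in> half_ball 0 (r/3)"
        using \<eta> \<eta>r r by (auto simp: half_ball_def norm_mult)
    qed (use sub h_in in auto)
    also have "\<i> * of_real \<eta> - \<i> * complex_of_real (r/4) = \<i> * of_real (\<eta> - r/4)"
      by (simp add: algebra_simps)
    also have "24 * \<delta> / r * norm (\<i> * complex_of_real (\<eta> - r/4)) \<le> 24 * \<delta> / r * (r/3)"
      unfolding norm_mult norm_of_real using \<eta> \<eta>r r \<delta> by (intro mult_left_mono) auto
    also have "\<dots> = 8 * \<delta>" using r by simp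
    finally have "norm (h p - h p0) \<le> 8 * \<delta>" by (simp only: p_eq p0_def)
    moreover have "norm (h p0 - h (of_real x)) \<le> 14 * \<delta>" by (rule center[OF p0])
    ultimately show ?thesis
      using norm_triangle_ineq[of "h p - h p0" "h p0 - h (of_real x)"] by (simp add: x_def)
  qed
qed

text \<open>A gate whose image lies close to 1 is a crosscut: the rest of the disc away from 1 is
  connected, contains 0 with \<open>g 0 = 1\<close>, and misses the image of the gate, so
  \<open>g\<close> maps it to the right of the gate.\<close>

lemma Re_g_bounded_below:
  assumes \<sigma>: "norm \<sigma> = 1" "\<sigma> \<noteq> 1"
  obtains c where "c > 0" "\<forall>\<^sub>F z in at \<sigma> within ball 0 1. c \<le> Re (g z)"
proof -
  have "Re \<sigma> < 1"
  proof (rule ccontr)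
    assume "\<not> Re \<sigma> < 1"
    moreover have "Re \<sigma> \<le> 1" using complex_Re_le_cmod[of \<sigma>] \<sigma> by simp
    ultimately have "Re \<sigma> = 1" by simp
    moreover have "(Re \<sigma>)\<^sup>2 + (Im \<sigma>)\<^sup>2 = 1" using \<sigma>(1) by (metis cmod_power2 one_power2)
    ultimately show False using \<sigma>(2) by (simp add: complex_eq_iff)
  qed
  moreover have "Re \<sigma> \<ge> -1" using abs_Re_le_cmod[of \<sigma>] \<sigma> by simp
  moreover define \<epsilon> where "\<epsilon> = (1 - Re \<sigma>) / 3"
  ultimately have \<epsilon>: "\<epsilon> > 0" "\<epsilon> < 1" "Re \<sigma> < 1 - \<epsilon>"
    by (simp_all add: \<epsilon>_def field_simps)
  \<comment> \<open>The image of the gate deviates from 1 in real part by at most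
    \<open>22 * \<delta> + \<delta>\<close>, which is below \<epsilon>.\<close>
  define \<delta> where "\<delta> = \<epsilon> / 66"
  have \<delta>: "0 < \<delta>" "\<delta> \<le> 1/2" using \<epsilon> by (auto simp: \<delta>_def)
  obtain m1 where m1: "m1 > 0" "\<And>p. p \<in> slit_domain \<Longrightarrow> Re p < m1 \<Longrightarrow> norm (h p) \<ge> 1 - \<delta>"
    using norm_h_near_1[OF \<delta>(1)] by blast
  obtain m2 where m2: "m2 > 0" "\<And>t. 0 < t \<Longrightarrow> t < m2 \<Longrightarrow> Re (h (of_real t)) \<ge> 1 - \<delta>"
    using h_real_tendsto_1[OF \<delta>(1)] by blast
  have "\<forall>\<^sub>F n in sequentially. slit_x n < min (2/3 * m1) m2"
    using m1(1) m2(1) by (intro order_tendstoD(2)[OF slit_x_tendsto_0]) auto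
  then obtain N where N: "\<And>n. n \<ge> N \<Longrightarrow> slit_x n < min (2/3 * m1) m2"
    by (auto simp: eventually_sequentially)
  define n where "n = max N 1"
  have n: "n \<ge> 1" "slit_x n < 2/3 * m1" "slit_x n < m2"
    using N[of n] by (auto simp: n_def)
  have gate: "Re (h p) > 1 - \<epsilon>" if p: "p \<in> slit_domain" "Re p = slit_x n" for p
  proof -
    have "norm (h p - h (of_real (slit_x n))) \<le> 22 * \<delta>"
      by (rule gate_image_small[OF n(1) \<delta> _ p]) (use m1(2) n(2) in auto)
    then have "\<bar>Re (h p) - Re (h (of_real (slit_x n)))\<bar> \<le> 22 * \<delta>"
      using abs_Re_le_cmod[of "h p - h (of_real (slit_x n))"] by simp
    moreover have "Re (h (of_real (slit_x n))) \<ge> 1 - \<delta>"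
      using m2(2) n(3) slit_x_pos by blast
    ultimately show ?thesis using \<epsilon>(1) unfolding \<delta>_def by linarith
  qed
  define T where "T = ball (0::complex) 1 \<inter> {z. Re z < 1 - \<epsilon>}"
  have "connected T"
    unfolding T_def by (intro convex_connected convex_Int convex_ball convex_halfspace_Re_lt)
  moreover have "continuous_on T (\<lambda>z. Re (g z))"
    by (intro continuous_on_Re continuous_on_subset[OF holomorphic_on_imp_continuous_on[OF hol_g]])
      (auto simp: T_def)
  ultimately have con: "connected ((\<lambda>z. Re (g z)) ` T)"
    by (rule connected_continuous_image[rotated])
  have low: "slit_x n \<le> Re (g z)" if z: "z \<in> T" for z
  proof (rule ccontr)
    assume "\<not> slit_x n \<le> Re (g z)"
    moreover have "0 \<in> T" using \<epsilon> by (simp add: T_def)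
    moreover have g0: "g 0 = 1" using g_h[of 1] h_1 of_real_slit_domain[of 1] by simp
    moreover have "Re (g 0) \<in> (\<lambda>z. Re (g z)) ` T" using \<open>0 \<in> T\<close> by (rule imageI)
    moreover have "slit_x n \<le> 1" by (rule slit_x_le_1)
    ultimately have "slit_x n \<in> (\<lambda>z. Re (g z)) ` T"
      using connectedD_interval[OF con, of "Re (g z)" "Re (g 0)" "slit_x n"] z by auto
    then obtain w where w: "w \<in> T" "Re (g w) = slit_x n" by auto
    then have "Re (h (g w)) > 1 - \<epsilon>" using gate[of "g w"] g_in by (auto simp: T_def)
    then show False using w h_g by (auto simp: T_def)
  qed
  have "\<forall>\<^sub>F z in at \<sigma> within ball 0 1. Re z < 1 - \<epsilon>"
    by (rule order_tendstoD(2)[OF tendsto_Re[OF tendsto_ident_at] \<epsilon>(3)])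
  moreover have "\<forall>\<^sub>F z in at \<sigma> within ball 0 1. z \<in> ball 0 1"
    by (rule eventually_at_withinI)
  ultimately have "\<forall>\<^sub>F z in at \<sigma> within ball 0 1. slit_x n \<le> Re (g z)"
    by eventually_elim (auto simp: T_def intro: low)
  then show ?thesis using that slit_x_pos by blast
qed

lemma unrestricted_limit_away_from_1:
  assumes \<sigma>: "norm \<sigma> = 1" "\<sigma> \<noteq> 1"
  shows "\<exists>L. unrestricted_limit g \<sigma> L"
proof -
  obtain c where c: "c > 0" "\<forall>\<^sub>F z in at \<sigma> within ball 0 1. c \<le> Re (g z)"
    using Re_g_bounded_below[OF \<sigma>] .
  obtain d where d: "d > 0" "\<And>z. norm z < 1 \<Longrightarrow> z \<noteq> \<sigma> \<Longrightarrow> dist z \<sigma> < d \<Longrightarrow> c \<le> Re (g z)"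
    using c(2) by (auto simp: eventually_at)
  define e where "e = min d 1 / 2"
  have e: "0 < e" "e < d" "e < 1" using d(1) by (auto simp: e_def)
  define z where "z k = of_real (1 - e / real (Suc k)) * \<sigma>" for k
  have frac: "0 < e / real (Suc k)" "e / real (Suc k) \<le> e" for k
    using e(1) by (auto simp: divide_le_eq)
  have norm_z: "norm (z k) < 1" for k
    using frac[of k] e unfolding z_def norm_mult norm_of_real \<sigma> by simp
  have dist_z: "dist (z k) \<sigma> < d" for k
  proof -
    have "z k - \<sigma> = of_real (- (e / real (Suc k))) * \<sigma>" by (simp add: z_def algebra_simps)
    then have "norm (z k - \<sigma>) = e / real (Suc k)"
      using frac(1)[of k] unfolding norm_mult norm_of_real \<sigma> by (simp only: \<open>z k - \<sigma> = _\<close> norm_mult norm_of_real \<sigma>)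
    then show ?thesis using frac(2)[of k] e by (simp add: dist_norm)
  qed
  have "(\<lambda>k. 1 - e / real (Suc k)) \<longlonglongrightarrow> 1"
    by real_asymp
  then have lim: "z \<longlonglongrightarrow> \<sigma>"
    unfolding z_def using tendsto_mult[OF tendsto_of_real tendsto_const, of _ 1 sequentially \<sigma>] by fastforce
  have "c \<le> Re (g (z k))" for k
    by (rule d(2)[OF norm_z _ dist_z]) (use norm_z[of k] \<sigma>(1) in auto)
  then show ?thesis
    using boundary_value_of_sequence[OF \<sigma>(1) norm_z lim c(1)] by blast
qed

text \<open>Otherwise some sequence tending to 1 has \<open>Re g\<close> bounded below, so
  \<open>boundary_value_of_sequence\<close> bounds \<open>Re g\<close> below near 1. But
  \<open>h t\<close> tends to 1 for real \<open>t\<close> decreasing to 0, while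
  \<open>g (h t) = t\<close>.\<close>

lemma Re_g_tendsto_0_at_1:
  assumes "\<epsilon> > 0"
  shows "\<forall>\<^sub>F z in at 1 within ball 0 1. Re (g z) < \<epsilon>"
proof (rule ccontr)
  assume neg: "\<not> ?thesis"
  have "\<exists>z. norm z < 1 \<and> dist z 1 < 1 / real (Suc k) \<and> \<epsilon> \<le> Re (g z)" for k
  proof (rule ccontr)
    assume "\<nexists>z. norm z < 1 \<and> dist z 1 < 1 / real (Suc k) \<and> \<epsilon> \<le> Re (g z)"
    then have "\<forall>\<^sub>F z in at 1 within ball 0 1. Re (g z) < \<epsilon>"
      unfolding eventually_at by (intro exI[of _ "1 / real (Suc k)"]) (auto simp: not_le)
    then show False using neg by blast
  qed
  then obtain z where z: "\<And>k. norm (z k) < 1" "\<And>k. dist (z k) 1 < 1 / real (Suc k)"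
      "\<And>k. \<epsilon> \<le> Re (g (z k))"
    by metis
  have "z \<longlonglongrightarrow> 1"
    by (rule metric_tendsto_imp_tendsto[OF LIMSEQ_inverse_real_of_nat])
      (use z(2) in \<open>auto simp: dist_norm inverse_eq_divide intro!: always_eventually less_imp_le\<close>)
  then obtain c where c: "c > 0" "\<forall>\<^sub>F z in at 1 within ball 0 1. c \<le> Re (g z)"
    by (rule boundary_value_of_sequence[OF norm_one z(1) _ assms z(3)])
  obtain d where d: "d > 0" "\<And>z. norm z < 1 \<Longrightarrow> z \<noteq> 1 \<Longrightarrow> dist z 1 < d \<Longrightarrow> c \<le> Re (g z)"
    using c(2) by (auto simp: eventually_at)
  obtain m where m: "m > 0" "\<And>t. 0 < t \<Longrightarrow> t < m \<Longrightarrow> Re (h (of_real t)) \<ge> 1 - d / 2"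
    using h_real_tendsto_1[of "d/2"] d(1) by auto
  define t where "t = min m c / 2"
  have t: "0 < t" "t < m" "t < c" using m(1) c(1) by (auto simp: t_def)
  have tD: "complex_of_real t \<in> slit_domain" by (rule of_real_slit_domain[OF t(1)])
  have "norm (h (of_real t)) < 1" by (rule h_in[OF tD])
  moreover have "dist (h (of_real t)) 1 < d"
  proof -
    have "h (of_real t) - 1 = of_real (Re (h (of_real t)) - 1)"
      using Im_h_real[OF t(1)] by (simp add: complex_eq_iff)
    then have "dist (h (of_real t)) 1 = \<bar>Re (h (of_real t)) - 1\<bar>"
      unfolding dist_norm by (simp only: norm_of_real)
    moreover have "Re (h (of_real t)) < 1"
      using complex_Re_le_cmod[of "h (of_real t)"] h_in[OF tD] by simp
    ultimately show ?thesis using m(2)[OF t(1,2)] d(1) by simp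
  qed
  moreover have "h (of_real t) \<noteq> 1" using h_in[OF tD] by auto
  ultimately have "c \<le> Re (g (h (of_real t)))" by (intro d(2))
  then show False using g_h[OF tD] t by simp
qed

text \<open>Small \<open>Re g\<close> does not control \<open>Im g\<close>, but \<open>g\<close> is
  real at \<open>norm z\<close>. In a Stolz region \<open>z\<close> stays within bounded hyperbolic
  distance of \<open>norm z\<close>, so Schwarz-Pick in the half-plane bounds
  \<open>norm (g z)\<close> by a multiple of \<open>g (norm z)\<close>.\<close>

lemma nontangential_limit_1: "nontangential_limit g 1 (Some 0)"
  unfolding nontangential_limit_def
proof (intro allI impI limitin_riemann_sphere_Some tendstoI)
  fix M \<epsilon> :: real assume M: "M > 1" and \<epsilon>: "\<epsilon> > 0"
  \<comment> \<open>An upper bound for the pseudohyperbolic distance between \<open>z\<close> and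
    \<open>norm z\<close> in the Stolz region: \<open>1 - r * z = (1 - z) + (1 - r) * z\<close> has
    modulus at most \<open>(M + 1) * (1 - r)\<close>.\<close>
  define k where "k = sqrt (1 - 1 / (M + 1)\<^sup>2)"
  have "1 / (M + 1)\<^sup>2 > 0" "1 / (M + 1)\<^sup>2 \<le> 1"
    using M by (auto simp: divide_le_eq_1 one_le_power)
  then have k: "0 \<le> k" "k < 1" "k\<^sup>2 = 1 - 1 / (M + 1)\<^sup>2" by (auto simp: k_def)
  define \<epsilon>' where "\<epsilon>' = \<epsilon> * (1 - k) / (1 + k)"
  have "\<epsilon>' > 0" using k \<epsilon> by (simp add: \<epsilon>'_def)
  then obtain d where d: "d > 0" "\<And>z. norm z < 1 \<Longrightarrow> z \<noteq> 1 \<Longrightarrow> dist z 1 < d \<Longrightarrow> Re (g z) < \<epsilon>'"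
    using Re_g_tendsto_0_at_1[of \<epsilon>'] by (auto simp: eventually_at)
  show "\<forall>\<^sub>F z in at 1 within stolz_region 1 M. dist (g z) 0 < \<epsilon>"
    unfolding eventually_at
  proof (intro exI[of _ d] conjI ballI impI)
    fix z assume z: "z \<in> stolz_region 1 M" "z \<noteq> 1 \<and> dist z 1 < d"
    define r where "r = norm z"
    have r: "0 \<le> r" "r < 1" "norm (1 - z) < M * (1 - r)"
      using z(1) by (auto simp: r_def stolz_region_def)
    obtain x where x: "x > 0" "g (of_real r) = of_real x"
      using g_real[of r] r by auto
    have "dist (complex_of_real r) 1 = 1 - r"
      using r by (metis abs_of_pos diff_gt_0_iff_gt dist_commute dist_of_real dist_real_def of_real_1)
    moreover have "1 - r \<le> norm (1 - z)" using norm_triangle_ineq2[of 1 z] by (simp add: r_def)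
    ultimately have "dist (complex_of_real r) 1 < d"
      using z(2) by (simp add: dist_norm norm_minus_commute)
    then have xe: "x < \<epsilon>'"
      using d(2)[of "of_real r"] x r by (auto simp: of_real_eq_1_iff)
    have "norm (1 - of_real r * z) \<le> norm (1 - z) + norm (of_real (1 - r) * z)"
      using norm_triangle_ineq[of "1 - z" "of_real (1 - r) * z"] by (simp add: algebra_simps)
    also have "\<dots> \<le> M * (1 - r) + (1 - r) * 1"
      using r unfolding norm_mult norm_of_real by (intro add_mono mult_mono) (auto simp: r_def)
    finally have up: "norm (1 - of_real r * z) \<le> (M + 1) * (1 - r)" by (simp add: algebra_simps)
    have nz: "1 - of_real r * z \<noteq> 0"
    proof
      assume "1 - of_real r * z = 0"
      then have "norm (of_real r * z) = 1" by simp
      then have "r * r = 1" using r by (simp add: norm_mult r_def[symmetric])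
      then show False using r by (metis abs_of_nonneg abs_square_less_1 less_irrefl power2_eq_square)
    qed
    define m where "m = norm (Moebius_function 0 (of_real r) z)"
    have m_eq: "m = norm (z - of_real r) / norm (1 - of_real r * z)"
      by (simp add: m_def Moebius_function_simple norm_divide)
    have "(norm (1 - of_real r * z))\<^sup>2 - (norm (z - of_real r))\<^sup>2 = (1 - r\<^sup>2) * (1 - r\<^sup>2)"
      using norm_Moebius_identity[of "of_real r" z] by (simp add: r_def)
    then have "1 - m\<^sup>2 = (1 - r\<^sup>2)\<^sup>2 / (norm (1 - of_real r * z))\<^sup>2"
      using nz by (simp add: m_eq power_divide field_simps power2_eq_square)
    also have "\<dots> \<ge> (1 - r)\<^sup>2 / ((M + 1) * (1 - r))\<^sup>2"
    proof (rule frac_le)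
      have "r\<^sup>2 \<le> r" using r by (simp add: power2_eq_square mult_left_le)
      then show "(1 - r)\<^sup>2 \<le> (1 - r\<^sup>2)\<^sup>2" using r by (intro power_mono) auto
    qed (use nz up in \<open>auto intro: power_mono\<close>)
    moreover have "(1 - r)\<^sup>2 / ((M + 1) * (1 - r))\<^sup>2 = 1 / (M + 1)\<^sup>2"
      using r by (simp add: power_mult_distrib)
    ultimately have "m\<^sup>2 \<le> k\<^sup>2" using k(3) by linarith
    then have mk: "m \<le> k" using k(1) by (rule power2_le_imp_le)
    have "norm (g z - of_real x) \<le> m * norm (g z + cnj (of_real x))"
      using Schwarz_Pick_halfplane[OF hol_g, of z "of_real r"] g_in slit_domain_Re_pos r x
      by (simp add: m_def r_def)
    also have "\<dots> \<le> k * norm (g z + cnj (of_real x))"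
      using mk by (intro mult_right_mono) auto
    also have "\<dots> \<le> k * (norm (g z) + x)"
      using k(1) x(1) norm_triangle_ineq[of "g z" "cnj (of_real x)"] by (intro mult_left_mono) auto
    finally have "norm (g z) - x \<le> k * (norm (g z) + x)"
      using norm_triangle_ineq2[of "g z" "of_real x"] x(1) by simp
    then have "norm (g z) * (1 - k) \<le> x * (1 + k)" by (simp add: algebra_simps)
    also have "\<dots> < \<epsilon>' * (1 + k)" using xe k by simp
    also have "\<dots> = \<epsilon> * (1 - k)" using k by (simp add: \<epsilon>'_def)
    finally show "dist (g z) 0 < \<epsilon>" using k by simp
  qed (rule d)
qed

end

section \<open>Divergence along a horocycle\<close>

lemma Harnack_half:
  assumes holf: "f holomorphic_on ball p R" and pos: "\<And>z. z \<in> ball p R \<Longrightarrow> Re (f z) > 0"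
    and q: "norm (q - p) \<le> R / 2" and R: "R > 0"
  shows "Re (f p) \<le> 3 * Re (f q)"
proof -
  define F where "F z = f (p + of_real R * z)" for z
  have l: "p + of_real R * z \<in> ball p R" if "norm z < 1" for z
    using that R by (simp add: dist_norm norm_mult)
  have "(\<lambda>z. p + of_real R * z) holomorphic_on ball 0 1" by (intro holomorphic_intros)
  then have hF: "F holomorphic_on ball 0 1"
    using holomorphic_on_compose_gen[of "\<lambda>z. p + of_real R * z" "ball 0 1" f "ball p R"] l holf
    by (auto simp: o_def F_def[abs_def] image_subset_iff)
  define z where "z = (q - p) / of_real R"
  have z: "norm z \<le> 1/2" "F z = f q" "F 0 = f p"
    using q R by (auto simp: z_def F_def norm_divide field_simps)
  have "norm (F z - F 0) \<le> norm z * norm (F z + cnj (F 0))"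
    by (rule Schwarz_Pick_halfplane_0[OF hF]) (use l pos z(1) in \<open>auto simp: F_def\<close>)
  also have "\<dots> \<le> 1/2 * norm (F z + cnj (F 0))"
    using z(1) by (rule mult_right_mono) auto
  finally have "2 * norm (f q - f p) \<le> norm (f q + cnj (f p))" using z by simp
  then have "(2 * norm (f q - f p))\<^sup>2 \<le> (norm (f q + cnj (f p)))\<^sup>2"
    by (intro power_mono) auto
  then have "4 * ((Re (f q) - Re (f p))\<^sup>2 + (Im (f q) - Im (f p))\<^sup>2)
      \<le> (Re (f q) + Re (f p))\<^sup>2 + (Im (f q) - Im (f p))\<^sup>2"
    by (simp add: power_mult_distrib cmod_power2)
  moreover have "4 * (A + B) \<le> C + B \<Longrightarrow> 0 \<le> B \<Longrightarrow> 4 * A \<le> C" for A B C :: real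
    by simp
  ultimately have "4 * (Re (f q) - Re (f p))\<^sup>2 \<le> (Re (f q) + Re (f p))\<^sup>2"
    using zero_le_power2 by blast
  then have sq: "(2 * \<bar>Re (f q) - Re (f p)\<bar>)\<^sup>2 \<le> (Re (f q) + Re (f p))\<^sup>2"
    by (simp add: power_mult_distrib)
  have "Re (f q) > 0" "Re (f p) > 0"
    using pos[of q] pos[of p] q R by (auto simp: dist_norm norm_minus_commute)
  then have "2 * \<bar>Re (f q) - Re (f p)\<bar> \<le> Re (f q) + Re (f p)"
    by (intro power2_le_imp_le[OF sq]) auto
  then show ?thesis using abs_ge_minus_self[of "Re (f q) - Re (f p)"] by simp
qed

text \<open>Inverse of \<open>w \<mapsto> (w - 1/w) / 2\<close>: maps the plane slit along the imaginary axis outside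
  the segment from \<open>-\<i>\<close> to \<open>\<i>\<close> onto the right half-plane.\<close>

definition unslit :: "complex \<Rightarrow> complex" where
  "unslit s = s + csqrt (s\<^sup>2 + 1)"

lemma unslit_radicand:
  assumes "Re s = 0 \<Longrightarrow> \<bar>Im s\<bar> < 1"
  shows "s\<^sup>2 + 1 \<notin> \<real>\<^sub>\<le>\<^sub>0"
proof
  assume "s\<^sup>2 + 1 \<in> \<real>\<^sub>\<le>\<^sub>0"
  then have re: "(Re s)\<^sup>2 - (Im s)\<^sup>2 + 1 \<le> 0" and im: "Re s * Im s = 0"
    by (auto simp: complex_nonpos_Reals_iff power2_eq_square)
  show False
  proof (cases "Re s = 0")
    case True
    then have "(Im s)\<^sup>2 \<ge> 1" using re by simp
    then show ?thesis using assms[OF True] abs_square_less_1[of "Im s"] by linarith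
  next
    case False
    then have "Im s = 0" using im by simp
    then show ?thesis using re zero_le_power2[of "Re s"] by (simp del: zero_le_power2)
  qed
qed

text \<open>With \<open>c\<close> the square root, \<open>s + c\<close> and \<open>c - s\<close> are
  reciprocal, so their real parts have the same sign, and these add up to
  \<open>2 * Re c > 0\<close>.\<close>

lemma Re_unslit_pos:
  assumes "Re s = 0 \<Longrightarrow> \<bar>Im s\<bar> < 1"
  shows "Re (unslit s) > 0"
proof -
  define c where "c = csqrt (s\<^sup>2 + 1)"
  have c: "c\<^sup>2 = s\<^sup>2 + 1" "Re c > 0"
    using Re_csqrt_pos[OF unslit_radicand[OF assms]] by (auto simp: c_def)
  have prod: "(s + c) * (c - s) = 1" using c(1) by (simp add: algebra_simps power2_eq_square)
  then have nz: "s + c \<noteq> 0" by auto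
  then have "c - s = inverse (s + c)" using prod by (simp add: field_simps)
  then have "Re (c - s) = Re (s + c) / (norm (s + c))\<^sup>2"
    by (simp only: complex_inverse cmod_power2) simp
  moreover have "Re (s + c) + Re (c - s) > 0" using c(2) by simp
  ultimately have "Re (s + c) * (1 + 1 / (norm (s + c))\<^sup>2) > 0"
    by (simp add: algebra_simps)
  moreover have "1 + 1 / (norm (s + c))\<^sup>2 > 0" by (intro add_pos_nonneg) auto
  ultimately show ?thesis by (simp add: unslit_def c_def[symmetric] zero_less_mult_iff)
qed

lemma unslit_of_real: "unslit (of_real t) = of_real (t + sqrt (t\<^sup>2 + 1))"
proof -
  have "0 \<le> t\<^sup>2 + 1" by simp
  then have "csqrt (of_real (t\<^sup>2 + 1)) = of_real (sqrt (t\<^sup>2 + 1))"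
    by (rule of_real_sqrt[symmetric])
  then show ?thesis by (simp add: unslit_def)
qed

section \<open>The Cayley transform and the horocycle through 0\<close>

definition cayley :: "complex \<Rightarrow> complex" where
  "cayley z = (1 + z) / (1 - z)"

lemma Re_cayley: "Re (cayley z) = (1 - (norm z)\<^sup>2) / (norm (1 - z))\<^sup>2"
  using Re_Cayley[of 1 "-z"] by (simp add: cayley_def)

lemma Re_cayley_pos: "norm z < 1 \<Longrightarrow> Re (cayley z) > 0"
  unfolding Re_cayley by (intro divide_pos_pos) (auto simp: power_less_one_iff)

lemma cayley_eq_iff:
  assumes "z \<noteq> 1" "w \<noteq> - 1"
  shows "cayley z = w \<longleftrightarrow> z = (w - 1) / (w + 1)"
proof -
  have "1 - z \<noteq> 0" "w + 1 \<noteq> 0" using assms by (auto simp: add_eq_0_iff2)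
  then show ?thesis by (auto simp: cayley_def field_simps)
qed

lemma norm_inv_cayley_less_1:
  assumes "Re w > 0"
  shows "norm ((w - 1) / (w + 1)) < 1"
  using norm_diff_less_norm_add_cnj[of w 1] assms by (simp add: norm_divide divide_less_eq_1)

definition horocycle :: "real \<Rightarrow> complex" where
  "horocycle t = \<i> * of_real t / (2 + \<i> * of_real t)"

lemma two_plus_ii_nz: "2 + \<i> * complex_of_real t \<noteq> 0"
  by (simp add: complex_eq_iff)

lemma horocycle_eq: "horocycle t = ((1 + \<i> * of_real t) - 1) / ((1 + \<i> * of_real t) + 1)"
  by (simp add: horocycle_def add_ac)

lemma norm_horocycle: "norm (horocycle t) < 1"
  unfolding horocycle_eq by (rule norm_inv_cayley_less_1) simp

lemma cayley_horocycle: "cayley (horocycle t) = 1 + \<i> * of_real t"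
proof (subst cayley_eq_iff)
  show "horocycle t \<noteq> 1" using norm_horocycle[of t] by auto
  show "1 + \<i> * complex_of_real t \<noteq> - 1" by (simp add: complex_eq_iff)
qed (rule horocycle_eq)

text \<open>The quotient that defines the horosphere is the reciprocal of
  \<open>Re (cayley z)\<close>. It equals 1 along the horocycle, so any bound above 1 would do in
  place of 2.\<close>

lemma horocycle_in_horosphere: "horocycle t \<in> horosphere 1 2"
proof -
  have "Re (cayley (horocycle t)) = 1" by (simp add: cayley_horocycle)
  then have "(1 - (norm (horocycle t))\<^sup>2) / (norm (1 - horocycle t))\<^sup>2 = 1" unfolding Re_cayley .
  then have "(norm (1 - horocycle t))\<^sup>2 = 1 - (norm (horocycle t))\<^sup>2"
    by (metis div_by_0 divide_eq_1_iff zero_neq_one)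
  moreover have "1 - (norm (horocycle t))\<^sup>2 > 0"
    using norm_horocycle[of t] by (simp add: power_less_one_iff)
  ultimately show ?thesis using norm_horocycle[of t] by (simp add: horosphere_def)
qed

lemma horocycle_tendsto_1: "(horocycle \<longlongrightarrow> 1) at_top"
proof -
  have eq: "horocycle t = 1 - 2 / (2 + \<i> * of_real t)" for t
    using two_plus_ii_nz[of t] by (simp add: horocycle_def field_simps)
  have "filterlim (\<lambda>t. 2 + \<i> * complex_of_real t) at_infinity at_top"
    by (intro tendsto_add_filterlim_at_infinity[OF tendsto_const] tendsto_mult_filterlim_at_infinity[OF tendsto_const])
      (auto intro: filterlim_of_real_at_infinity filterlim_at_top_imp_at_infinity filterlim_ident
        filterlim_compose[OF tendsto_of_real_iff[THEN iffD2]])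
  then have "((\<lambda>t. 1 - 2 / (2 + \<i> * complex_of_real t)) \<longlongrightarrow> 1 - 0) at_top"
    by (intro tendsto_diff tendsto_const tendsto_divide_0[OF tendsto_const])
  then show ?thesis by (simp add: eq[abs_def])
qed

lemma continuous_on_horocycle: "continuous_on A horocycle"
  unfolding horocycle_def by (intro continuous_intros) (use two_plus_ii_nz in auto)

lemma cnj_horocycle: "cnj (horocycle t) = horocycle (- t)"
  by (simp add: horocycle_def)

section \<open>Size of the Cayley transform of \<open>h\<close> in the strips\<close>

context normalized_slit_map
begin

definition \<gamma> :: "real \<Rightarrow> complex" where
  "\<gamma> t = g (horocycle t)"

lemma \<gamma>_in: "\<gamma> t \<in> slit_domain"
  by (simp add: \<gamma>_def g_in norm_horocycle)

lemma continuous_on_\<gamma>: "continuous_on A \<gamma>"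
  unfolding \<gamma>_def
  by (rule continuous_on_compose2[OF holomorphic_on_imp_continuous_on[OF hol_g] continuous_on_horocycle])
    (auto simp: norm_horocycle)

text \<open>Enlarging the domain to the plane without the \<open>n\<close>-th slits can only shrink
  hyperbolic distances. After rescaling, \<open>unslit\<close> sends that plane to the half-plane,
  with \<open>A\<close> the image of 1 and \<open>B\<close> that of \<open>3/4 * slit_x n\<close>,
  on the far side of the gate. Schwarz-Pick between 0 and \<rho> yields
  \<open>A * (1 - \<rho>) \<le> B * (1 + \<rho>)\<close>, where \<open>A\<close> is huge and
  \<open>B \<le> 1\<close>.\<close>

lemma cayley_h_large:
  assumes n: "n \<ge> 1"
  shows "exp (3 ^ n) \<le> Re (cayley (h (of_real (3/4 * slit_x n))))"
proof -
  define x y where "x = slit_x n" and "y = slit_y n"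
  have xy: "x > 0" "y > 0" by (auto simp: x_def y_def slit_x_pos slit_y_pos)
  have x2: "x \<le> 1/2" using slit_x_le[OF n] by (simp add: x_def slit_x_def)
  define \<rho> where "\<rho> = Re (h (of_real (3/4 * x)))"
  have pD: "complex_of_real (3/4 * x) \<in> slit_domain" by (rule of_real_slit_domain) (use xy in simp)
  have h_eq: "h (of_real (3/4 * x)) = of_real \<rho>"
    using Im_h_real[of "3/4 * x"] xy by (simp add: complex_eq_iff \<rho>_def)
  have \<rho>0: "\<rho> > 0" using h_decreasing[of "3/4 * x" 1] xy x2 h_1 by (simp add: \<rho>_def)
  have \<rho>1: "\<rho> < 1" using h_in[OF pD] \<rho>0 unfolding h_eq by simp
  define f where "f z = unslit ((g z - of_real x) / of_real y)" for z
  have ok: "Re ((g z - of_real x) / of_real y) = 0 \<Longrightarrow> \<bar>Im ((g z - of_real x) / of_real y)\<bar> < 1"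
    if "norm z < 1" for z
    using slit_domain_gate[OF g_in[OF that], of n] xy by (simp add: x_def y_def)
  have rad: "((g z - of_real x) / of_real y)\<^sup>2 + 1 \<notin> \<real>\<^sub>\<le>\<^sub>0" if "norm z < 1" for z
    using ok[OF that] by (rule unslit_radicand)
  have SP: "norm (f (of_real \<rho>) - f 0) \<le> norm (complex_of_real \<rho>) * norm (f (of_real \<rho>) + cnj (f 0))"
  proof (rule Schwarz_Pick_halfplane_0)
    show "f holomorphic_on ball 0 1"
      unfolding f_def unslit_def
      by (intro holomorphic_intros hol_g) (use rad xy in auto)
    show "Re (f z) > 0" if "z \<in> ball 0 1" for z
      unfolding f_def by (rule Re_unslit_pos) (use ok that in auto)
  qed (use \<rho>0 \<rho>1 in simp)
  define S where "S = (1 - x) / y"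
  define U where "U = x / (4 * y)"
  define A where "A = S + sqrt (S\<^sup>2 + 1)"
  define B where "B = sqrt (U\<^sup>2 + 1) - U"
  have "g 0 = 1" using g_h[of 1] h_1 of_real_slit_domain[of 1] by simp
  then have "f 0 = unslit (of_real S)" by (simp add: f_def S_def)
  then have f0: "f 0 = of_real A" by (simp only: unslit_of_real A_def)
  have g\<rho>: "g (of_real \<rho>) = of_real (3/4 * x)" using g_h[OF pD] h_eq by simp
  have "(g (of_real \<rho>) - of_real x) / of_real y = of_real ((3/4 * x - x) / y)"
    unfolding g\<rho> of_real_divide of_real_diff ..
  moreover have "(3/4 * x - x) / y = - U" using xy by (simp add: U_def field_simps)
  ultimately have "f (of_real \<rho>) = unslit (of_real (- U))" by (simp only: f_def)
  then have f\<rho>: "f (of_real \<rho>) = of_real B" by (simp only: unslit_of_real B_def) simp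
  from SP have "norm (complex_of_real (B - A)) \<le> norm (complex_of_real \<rho>) * norm (complex_of_real (B + A))"
    by (simp add: f0 f\<rho>)
  then have main: "\<bar>B - A\<bar> \<le> \<rho> * \<bar>B + A\<bar>"
    using \<rho>0 by (simp only: norm_of_real abs_of_pos)
  have U0: "U \<ge> 0" using xy by (simp add: U_def)
  have S0: "S \<ge> 0" using xy x2 by (simp add: S_def)
  have "sqrt (U\<^sup>2 + 1) \<le> U + 1"
    by (rule real_le_lsqrt) (use U0 in \<open>auto simp: power2_eq_square algebra_simps\<close>)
  then have B1: "B \<le> 1" by (simp add: B_def)
  have "U \<le> sqrt (U\<^sup>2 + 1)" by (rule real_le_rsqrt) simp
  then have B0: "B \<ge> 0" by (simp add: B_def)
  have A0: "A \<ge> S" "A \<ge> 0" using S0 by (auto simp: A_def)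
  have "A - B \<le> \<rho> * (A + B)" using main A0 B0 by (simp add: add_ac)
  then have "A * (1 - \<rho>) \<le> B * (1 + \<rho>)" by (simp add: algebra_simps)
  also have "\<dots> \<le> 1 * (1 + \<rho>)" using B1 \<rho>0 by (intro mult_right_mono) auto
  finally have "A \<le> (1 + \<rho>) / (1 - \<rho>)" using \<rho>1 by (simp add: pos_le_divide_eq)
  also have "\<dots> = Re (cayley (h (of_real (3/4 * x))))"
  proof -
    have "cayley (of_real \<rho>) = of_real ((1 + \<rho>) / (1 - \<rho>))" by (simp add: cayley_def)
    then show ?thesis unfolding h_eq by (simp only: Re_complex_of_real)
  qed
  finally have 1: "A \<le> Re (cayley (h (of_real (3/4 * x))))" .
  \<comment> \<open>By definition of \<open>slit_y\<close> the left side is \<open>x / y\<close>,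
    and \<open>n \<ge> 1\<close> makes both \<open>x\<close> and \<open>1 - x\<close> compare with
    1/2 in the right direction.\<close>
  have "exp (3 ^ n) \<le> (1/2) / y"
    using x2 xy by (simp add: y_def slit_y_eq x_def[symmetric] field_simps)
  also have "\<dots> \<le> S" unfolding S_def using x2 xy by (intro divide_right_mono) auto
  finally show ?thesis using A0(1) 1 by (simp add: x_def)
qed

lemma hol_cayley_h: "(\<lambda>p. cayley (h p)) holomorphic_on slit_domain"
  unfolding cayley_def by (intro holomorphic_intros hol_h) (use h_in in force)

lemma cayley_h_pos: "p \<in> slit_domain \<Longrightarrow> Re (cayley (h p)) > 0"
  by (intro Re_cayley_pos h_in)

text \<open>Discs of radius \<open>slit_x n / 4\<close> about the midline fill the width of the
  strip, and Harnack allows a step of half that radius at the cost of a factor 3.\<close>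

lemma cayley_h_climb:
  defines "u \<equiv> \<lambda>p. Re (cayley (h p))"
  shows "u (of_real (3/4 * slit_x n)) \<le> 3 ^ k * u (of_real (3/4 * slit_x n) + \<i> * of_real (real k * slit_x n / 8))"
proof (induction k)
  case (Suc k)
  define x where "x = slit_x n"
  have x: "x > 0" by (simp add: x_def slit_x_pos)
  define p where "p = of_real (3/4 * x) + \<i> * of_real (real k * x / 8)"
  define q where "q = of_real (3/4 * x) + \<i> * of_real (real (Suc k) * x / 8)"
  have sub: "ball p (x / 4) \<subseteq> slit_domain"
  proof
    fix z assume "z \<in> ball p (x / 4)"
    then have "\<bar>Re z - 3/4 * x\<bar> < x / 4"
      using abs_Re_le_cmod[of "z - p"] by (simp add: p_def dist_norm norm_minus_commute)
    then have "x / 2 < Re z" "Re z < x" by linarith+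
    then show "z \<in> slit_domain"
      by (intro strip_subset_slit_domain[of n]) (simp_all add: x_def slit_x_Suc)
  qed
  have "Re (cayley (h p)) \<le> 3 * Re (cayley (h q))"
  proof (rule Harnack_half[where f = "\<lambda>z. cayley (h z)" and R = "x / 4"])
    show "(\<lambda>z. cayley (h z)) holomorphic_on ball p (x / 4)"
      using hol_cayley_h sub by (rule holomorphic_on_subset)
    have "q - p = \<i> * of_real (x / 8)" by (simp add: p_def q_def complex_eq_iff field_simps)
    then have "norm (q - p) = \<bar>x / 8\<bar>" by (simp only: norm_mult norm_ii norm_of_real mult_1)
    then show "norm (q - p) \<le> x / 4 / 2" using x by simp
  qed (use x sub cayley_h_pos in auto)
  then have "3 ^ k * u p \<le> 3 ^ k * (3 * u q)" unfolding u_def by (intro mult_left_mono) auto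
  also have "\<dots> = 3 ^ Suc k * u q" by simp
  finally have "3 ^ k * u p \<le> 3 ^ Suc k * u q" .
  then show ?case using Suc.IH unfolding p_def q_def x_def by (rule order_trans[rotated])
qed (simp add: u_def)

text \<open>Here \<open>3 ^ n\<close> has to win against \<open>2 ^ n\<close>: height 1 is reached
  after \<open>8 * 2 ^ n\<close> steps of length \<open>slit_x n / 8\<close>, and since
  \<open>3 \<le> exp 2\<close> the total loss is at most \<open>exp (16 * 2 ^ n)\<close>.\<close>

lemma cayley_h_ge_1_at_height_1:
  "\<forall>\<^sub>F n in sequentially. 1 \<le> Re (cayley (h (of_real (3/4 * slit_x n) + \<i>)))"
proof -
  have "\<forall>\<^sub>F n in sequentially. 16 * 2 ^ n \<le> (3 ^ n :: real)" by real_asymp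
  moreover have "\<forall>\<^sub>F n in sequentially. n \<ge> (1::nat)" by (rule eventually_ge_at_top)
  ultimately show ?thesis
  proof eventually_elim
    case (elim n)
    define v where "v = Re (cayley (h (of_real (3/4 * slit_x n) + \<i>)))"
    have "real (8 * 2 ^ n) * slit_x n / 8 = 1" by (simp add: slit_x_def)
    then have "Re (cayley (h (of_real (3/4 * slit_x n)))) \<le> 3 ^ (8 * 2 ^ n) * v"
      using cayley_h_climb[of n "8 * 2 ^ n"] by (simp only: v_def of_real_1 mult_1_right)
    then have "exp (3 ^ n) \<le> 3 ^ (8 * 2 ^ n) * v"
      using cayley_h_large[OF elim(2)] by linarith
    moreover have "(3::real) ^ (8 * 2 ^ n) \<le> exp (3 ^ n)"
    proof -
      have "(3::real) \<le> exp 2" using exp_ge_add_one_self[of 2] by simp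
      then have "(3::real) ^ (8 * 2 ^ n) \<le> exp 2 ^ (8 * 2 ^ n)" by (rule power_mono) simp
      also have "\<dots> = exp (real (8 * 2 ^ n) * 2)" by (rule exp_of_nat_mult[symmetric])
      also have "\<dots> \<le> exp (3 ^ n)" using elim(1) by simp
      finally show ?thesis .
    qed
    ultimately have "(3::real) ^ (8 * 2 ^ n) * 1 \<le> 3 ^ (8 * 2 ^ n) * v" by linarith
    then show ?case unfolding v_def[symmetric] by (rule mult_left_le_imp_le) simp
  qed
qed

text \<open>If the real part stayed at least 1, then \<open>(norm (1 - h))\<^sup>2\<close> would be
  at most \<open>1 - (norm h)\<^sup>2\<close>, which tends to 0 at the slit. So \<open>h\<close>
  would tend to 1 there, although \<open>Re g\<close> tends to 0 at 1 and the points have real part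
  above \<open>3/4 * slit_x n\<close>.\<close>

lemma cayley_h_small_near_slit:
  "\<exists>\<tau>>3/4 * slit_x n. \<tau> < slit_x n \<and> Re (cayley (h (of_real \<tau> + \<i>))) < 1"
proof (rule ccontr)
  define x where "x = slit_x n"
  have x: "x > 0" by (simp add: x_def slit_x_pos)
  define f where "f \<tau> = complex_of_real \<tau> + \<i>" for \<tau>
  assume neg: "\<not> ?thesis"
  have ge: "1 \<le> Re (cayley (h (f \<tau>)))" if "3/4 * x < \<tau>" "\<tau> < x" for \<tau>
  proof (rule ccontr)
    assume "\<not> ?thesis"
    then show False using neg that unfolding x_def f_def not_le by blast
  qed
  have fD: "f \<tau> \<in> slit_domain" if "3/4 * x < \<tau>" "\<tau> < x" for \<tau>
    using that x by (intro strip_subset_slit_domain[of n]) (auto simp: f_def x_def slit_x_Suc)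
  have ev: "\<forall>\<^sub>F \<tau> in at_left x. 3/4 * x < \<tau> \<and> \<tau> < x"
    by (rule eventually_at_leftI[of "3/4 * x"]) (use x in auto)
  have "(f \<longlongrightarrow> of_real x + \<i>) (at_left x)"
    unfolding f_def by (intro tendsto_intros)
  moreover have "of_real x + \<i> \<notin> slit_domain"
    using slit_y_less_1[of n] by (intro slit_in_complement[of _ n]) (auto simp: x_def)
  ultimately have "((\<lambda>\<tau>. norm (h (f \<tau>))) \<longlongrightarrow> 1) (at_left x)"
    by (intro norm_h_tendsto_1 eventually_not_in_compact_tendsto eventually_mono[OF ev]) (use fD in auto)
  then have "((\<lambda>\<tau>. 1 - (norm (h (f \<tau>)))\<^sup>2) \<longlongrightarrow> 1 - 1\<^sup>2) (at_left x)"
    by (intro tendsto_intros)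
  then have "((\<lambda>\<tau>. 1 - (norm (h (f \<tau>)))\<^sup>2) \<longlongrightarrow> 0) (at_left x)" by simp
  moreover have "\<forall>\<^sub>F \<tau> in at_left x. norm ((norm (1 - h (f \<tau>)))\<^sup>2) \<le> 1 - (norm (h (f \<tau>)))\<^sup>2"
    using ev
  proof eventually_elim
    case (elim \<tau>)
    then have "norm (h (f \<tau>)) < 1" using fD h_in by blast
    then have "1 - h (f \<tau>) \<noteq> 0" by auto
    then show ?case using ge[of \<tau>] elim by (simp add: Re_cayley le_divide_eq)
  qed
  ultimately have "((\<lambda>\<tau>. (norm (1 - h (f \<tau>)))\<^sup>2) \<longlongrightarrow> 0) (at_left x)"
    by (rule Lim_null_comparison[rotated])
  then have "((\<lambda>\<tau>. 1 - h (f \<tau>)) \<longlongrightarrow> 0) (at_left x)"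
    by (simp add: tendsto_norm_zero_iff)
  then have "((\<lambda>\<tau>. 1 - (1 - h (f \<tau>))) \<longlongrightarrow> 1 - 0) (at_left x)"
    by (intro tendsto_intros)
  then have "((\<lambda>\<tau>. h (f \<tau>)) \<longlongrightarrow> 1) (at_left x)" by simp
  moreover have "\<forall>\<^sub>F \<tau> in at_left x. h (f \<tau>) \<in> ball 0 1 \<and> h (f \<tau>) \<noteq> 1"
    using ev by eventually_elim (use fD h_in in fastforce)
  ultimately have "filterlim (\<lambda>\<tau>. h (f \<tau>)) (at 1 within ball 0 1) (at_left x)"
    by (simp add: filterlim_at)
  moreover have "\<forall>\<^sub>F z in at 1 within ball 0 1. Re (g z) < 3/4 * x"
    by (rule Re_g_tendsto_0_at_1) (use x in simp)
  ultimately have "\<forall>\<^sub>F \<tau> in at_left x. Re (g (h (f \<tau>))) < 3/4 * x"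
    by (rule eventually_compose_filterlim[rotated])
  with ev have "\<forall>\<^sub>F \<tau> in at_left x. False"
  proof eventually_elim
    case (elim \<tau>)
    then have "Re (f \<tau>) < 3/4 * x" using g_h[OF fD] by simp
    then show ?case using elim by (simp add: f_def)
  qed
  then show False by simp
qed

text \<open>At height 1 the real part of the Cayley transform passes from at least 1 on the midline
  to below 1 beside the right slit. Where it equals 1, the point lies on the image of the
  horocycle.\<close>

lemma \<gamma>_at_height_1:
  "\<forall>\<^sub>F n in sequentially. \<exists>t. Im (\<gamma> t) = 1 \<and> Re (\<gamma> t) < slit_x n"
  using cayley_h_ge_1_at_height_1
proof eventually_elim
  case (elim n)
  define x where "x = slit_x n"
  have x: "x > 0" by (simp add: x_def slit_x_pos)
  define f where "f \<tau> = complex_of_real \<tau> + \<i>" for \<tau>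
  obtain \<tau>1 where \<tau>1: "3/4 * x < \<tau>1" "\<tau>1 < x" "Re (cayley (h (f \<tau>1))) < 1"
    using cayley_h_small_near_slit[of n] unfolding x_def f_def by blast
  have fD: "f \<tau> \<in> slit_domain" if "3/4 * x \<le> \<tau>" "\<tau> \<le> \<tau>1" for \<tau>
    using that x \<tau>1 by (intro strip_subset_slit_domain[of n]) (auto simp: f_def x_def slit_x_Suc)
  have "continuous_on {3/4 * x..\<tau>1} (\<lambda>\<tau>. Re (cayley (h (f \<tau>))))"
    by (intro continuous_on_Re continuous_on_compose2[OF holomorphic_on_imp_continuous_on[OF hol_cayley_h]])
      (use fD in \<open>auto simp: f_def intro!: continuous_intros\<close>)
  then obtain \<tau> where \<tau>: "3/4 * x \<le> \<tau>" "\<tau> \<le> \<tau>1" "Re (cayley (h (f \<tau>))) = 1"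
    using IVT2'[of "\<lambda>\<tau>. Re (cayley (h (f \<tau>)))" \<tau>1 1 "3/4 * x"] \<tau>1 elim by (auto simp: x_def f_def)
  define t where "t = Im (cayley (h (f \<tau>)))"
  have "cayley (h (f \<tau>)) = 1 + \<i> * of_real t" using \<tau>(3) by (simp add: complex_eq_iff t_def)
  moreover have "h (f \<tau>) \<noteq> 1" using h_in[OF fD[OF \<tau>(1,2)]] by auto
  moreover have "1 + \<i> * complex_of_real t \<noteq> - 1" by (simp add: complex_eq_iff)
  ultimately have "h (f \<tau>) = horocycle t"
    unfolding horocycle_eq by (metis cayley_eq_iff)
  then have "\<gamma> t = f \<tau>" using g_h[OF fD[OF \<tau>(1,2)]] by (simp add: \<gamma>_def)
  then show ?case using \<tau>(2) \<tau>1(2) by (intro exI[of _ t]) (simp add: f_def x_def)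
qed

section \<open>Oscillation of the image of the horocycle\<close>

lemma \<gamma>_minus: "\<gamma> (- t) = cnj (\<gamma> t)"
proof -
  have "h (cnj (\<gamma> t)) = horocycle (- t)"
    using h_cnj[OF \<gamma>_in] by (simp add: \<gamma>_def h_g norm_horocycle cnj_horocycle)
  then show ?thesis
    using g_h[OF cnj_slit_domain[OF \<gamma>_in[of t]]] by (simp add: \<gamma>_def)
qed

lemma Re_\<gamma>_pos: "Re (\<gamma> t) > 0"
  by (rule slit_domain_Re_pos[OF \<gamma>_in])

text \<open>A point with real part below the minimum of \<open>Re \<gamma>\<close> over the interval
  from \<open>- T'\<close> to \<open>T'\<close> has its parameter outside that interval. A negative
  parameter is reflected by conjugation, hence the absolute value of \<open>Im\<close>.\<close>

lemma \<gamma>_high: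
  assumes \<epsilon>: "\<epsilon> > 0"
  shows "\<exists>t\<ge>T. \<bar>Im (\<gamma> t)\<bar> = 1 \<and> Re (\<gamma> t) < \<epsilon>"
proof -
  define T' where "T' = max T 0"
  obtain s where s: "s \<in> {-T'..T'}" "\<And>t. t \<in> {-T'..T'} \<Longrightarrow> Re (\<gamma> s) \<le> Re (\<gamma> t)"
    using continuous_attains_inf[of "{-T'..T'}" "\<lambda>t. Re (\<gamma> t)"] continuous_on_Re[OF continuous_on_\<gamma>]
    by (auto simp: T'_def)
  have "\<forall>\<^sub>F n in sequentially. slit_x n < min \<epsilon> (Re (\<gamma> s))"
    using \<epsilon> Re_\<gamma>_pos by (intro order_tendstoD(2)[OF slit_x_tendsto_0]) auto
  with \<gamma>_at_height_1 have "\<forall>\<^sub>F n in sequentially. \<exists>t. Im (\<gamma> t) = 1 \<and> Re (\<gamma> t) < min \<epsilon> (Re (\<gamma> s))"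
    by eventually_elim force
  then obtain t where t: "Im (\<gamma> t) = 1" "Re (\<gamma> t) < \<epsilon>" "Re (\<gamma> t) < Re (\<gamma> s)"
    by (auto simp: eventually_sequentially)
  then have "t \<notin> {-T'..T'}" using s(2) by force
  then consider "t \<ge> T" | "- t \<ge> T" by (auto simp: T'_def not_le)
  then show ?thesis
  proof cases
    case 1
    then show ?thesis using t by auto
  next
    case 2
    then show ?thesis using t by (intro exI[of _ "- t"]) (simp add: \<gamma>_minus)
  qed
qed

text \<open>\<open>Re \<gamma>\<close> tends to 0, so beyond \<open>T\<close> the curve must cross
  every line \<open>Re z = slit_x n\<close> with \<open>slit_x n < Re (\<gamma> T)\<close>, and it
  can do so only through the gate.\<close>

lemma \<gamma>_low:
  assumes \<epsilon>: "\<epsilon> > 0"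
  shows "\<exists>t\<ge>T. \<bar>Im (\<gamma> t)\<bar> < \<epsilon> \<and> Re (\<gamma> t) < \<epsilon>"
proof -
  have "\<forall>\<^sub>F n in sequentially. slit_x n < min \<epsilon> (Re (\<gamma> T))"
    using \<epsilon> Re_\<gamma>_pos by (intro order_tendstoD(2)[OF slit_x_tendsto_0]) auto
  then obtain n where n: "slit_x n < \<epsilon>" "slit_x n < Re (\<gamma> T)"
    by (auto simp: eventually_sequentially)
  have "filterlim horocycle (at 1 within ball 0 1) at_top"
    unfolding filterlim_at using horocycle_tendsto_1 norm_horocycle
    by (auto intro!: always_eventually) (metis less_irrefl norm_one)
  then have "\<forall>\<^sub>F t in at_top. Re (\<gamma> t) < slit_x n"
    unfolding \<gamma>_def by (rule eventually_compose_filterlim[OF Re_g_tendsto_0_at_1[OF slit_x_pos]])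
  then obtain t1 where t1: "t1 \<ge> T" "Re (\<gamma> t1) < slit_x n"
    by (metis eventually_at_top_linorder linear order_refl)
  obtain t where t: "T \<le> t" "Re (\<gamma> t) = slit_x n"
    using IVT2'[of "\<lambda>t. Re (\<gamma> t)" t1 "slit_x n" T] t1 n(2) continuous_on_Re[OF continuous_on_\<gamma>]
    by (auto intro: less_imp_le)
  have "\<bar>Im (\<gamma> t)\<bar> < slit_y n" by (rule slit_domain_gate[OF \<gamma>_in t(2)])
  then have "\<bar>Im (\<gamma> t)\<bar> < \<epsilon>" using slit_y_le_half[of n] slit_x_pos[of n] n(1) by linarith
  then show ?thesis using t n(1) by auto
qed

lemma \<gamma>_sequences:
  obtains a b :: "nat \<Rightarrow> real"
  where "\<And>k. real k \<le> a k" "(\<lambda>k. norm (\<gamma> (a k))) \<longlonglongrightarrow> 1"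
    "\<And>k. real k \<le> b k" "(\<lambda>k. norm (\<gamma> (b k))) \<longlonglongrightarrow> 0"
proof -
  have pos: "0 < inverse (real (Suc k))" for k by simp
  have "\<forall>k. \<exists>t\<ge>real k. \<bar>Im (\<gamma> t)\<bar> = 1 \<and> Re (\<gamma> t) < inverse (real (Suc k))"
    using \<gamma>_high[OF pos] by blast
  then obtain a where a: "\<And>k. real k \<le> a k" "\<And>k. \<bar>Im (\<gamma> (a k))\<bar> = 1" "\<And>k. Re (\<gamma> (a k)) < inverse (real (Suc k))"
    by metis
  have "\<forall>k. \<exists>t\<ge>real k. \<bar>Im (\<gamma> t)\<bar> < inverse (real (Suc k)) \<and> Re (\<gamma> t) < inverse (real (Suc k))"
    using \<gamma>_low[OF pos] by blast
  then obtain b where b: "\<And>k. real k \<le> b k" "\<And>k. \<bar>Im (\<gamma> (b k))\<bar> < inverse (real (Suc k))"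
      "\<And>k. Re (\<gamma> (b k)) < inverse (real (Suc k))"
    by metis
  have null: "(\<lambda>k. f k) \<longlonglongrightarrow> 0" if "\<And>k. \<bar>f k\<bar> \<le> inverse (real (Suc k))" for f :: "nat \<Rightarrow> real"
    by (rule Lim_null_comparison[OF _ LIMSEQ_inverse_real_of_nat]) (use that in auto)
  have Ra: "(\<lambda>k. Re (\<gamma> (a k))) \<longlonglongrightarrow> 0"
    using a(3) Re_\<gamma>_pos by (intro null) (auto simp: abs_of_pos intro: less_imp_le)
  have Rb: "(\<lambda>k. Re (\<gamma> (b k))) \<longlonglongrightarrow> 0"
    using b(3) Re_\<gamma>_pos by (intro null) (auto simp: abs_of_pos intro: less_imp_le)
  have Ib: "(\<lambda>k. Im (\<gamma> (b k))) \<longlonglongrightarrow> 0"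
    using b(2) by (intro null) (auto intro: less_imp_le)
  have "(\<lambda>k. sqrt ((Re (\<gamma> (a k)))\<^sup>2 + \<bar>Im (\<gamma> (a k))\<bar>\<^sup>2)) \<longlonglongrightarrow> sqrt (0\<^sup>2 + 1\<^sup>2)"
    unfolding a(2) by (intro tendsto_intros Ra)
  then have 1: "(\<lambda>k. norm (\<gamma> (a k))) \<longlonglongrightarrow> 1" by (simp add: cmod_def)
  have "(\<lambda>k. sqrt ((Re (\<gamma> (b k)))\<^sup>2 + (Im (\<gamma> (b k)))\<^sup>2)) \<longlonglongrightarrow> sqrt (0\<^sup>2 + 0\<^sup>2)"
    by (intro tendsto_intros Rb Ib)
  then have 2: "(\<lambda>k. norm (\<gamma> (b k))) \<longlonglongrightarrow> 0" by (simp add: cmod_def)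
  show ?thesis by (rule that[OF a(1) 1 b(1) 2])
qed

text \<open>The height on the sphere depends on the modulus alone, so limits 1 and 0 of the moduli
  already give distinct limit points, at heights 0 and -1.\<close>

lemma snd_sphere_point_tendsto:
  assumes "(\<lambda>k. norm (z k)) \<longlonglongrightarrow> r" "(\<lambda>k. sphere_point (Some (z k))) \<longlonglongrightarrow> P"
  shows "snd P = (r\<^sup>2 - 1) / (r\<^sup>2 + 1)"
proof (rule LIMSEQ_unique)
  show "(\<lambda>k. snd (sphere_point (Some (z k)))) \<longlonglongrightarrow> snd P"
    by (rule tendsto_snd[OF assms(2)])
  have "r\<^sup>2 + 1 \<noteq> 0" using zero_le_power2[of r] by linarith
  then have "(\<lambda>k. ((norm (z k))\<^sup>2 - 1) / ((norm (z k))\<^sup>2 + 1)) \<longlonglongrightarrow> (r\<^sup>2 - 1) / (r\<^sup>2 + 1)"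
    by (intro tendsto_intros assms(1))
  then show "(\<lambda>k. snd (sphere_point (Some (z k)))) \<longlonglongrightarrow> (r\<^sup>2 - 1) / (r\<^sup>2 + 1)"
    by (simp add: sphere_point_def)
qed

lemma \<gamma>_diverges:
  assumes "\<And>a :: nat \<Rightarrow> real. (\<And>k. real k \<le> a k) \<Longrightarrow> (\<lambda>k. sphere_point (Some (\<gamma> (a k)))) \<longlonglongrightarrow> P"
  shows False
proof -
  obtain a b :: "nat \<Rightarrow> real" where a: "\<And>k. real k \<le> a k" "(\<lambda>k. norm (\<gamma> (a k))) \<longlonglongrightarrow> 1"
    and b: "\<And>k. real k \<le> b k" "(\<lambda>k. norm (\<gamma> (b k))) \<longlonglongrightarrow> 0"
    by (rule \<gamma>_sequences, rule that, assumption+)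
  have "snd P = 0" using snd_sphere_point_tendsto[OF a(2) assms[OF a(1)]] by simp
  moreover have "snd P = -1" using snd_sphere_point_tendsto[OF b(2) assms[OF b(1)]] by simp
  ultimately show False by simp
qed

lemma no_H_limit_at_1: "\<not> H_limit g 1 L"
proof
  assume H: "H_limit g 1 L"
  show False
  proof (rule \<gamma>_diverges)
    fix a :: "nat \<Rightarrow> real" assume a: "\<And>k. real k \<le> a k"
    have "filterlim a at_top sequentially"
      by (rule filterlim_at_top_mono[OF filterlim_real_sequentially]) (use a in auto)
    then have "(\<lambda>k. horocycle (a k)) \<longlonglongrightarrow> 1"
      by (rule filterlim_compose[OF horocycle_tendsto_1])
    then have "limitin riemann_sphere (\<lambda>k. Some (g (horocycle (a k)))) L sequentially"
      using H horocycle_in_horosphere norm_horocycle unfolding H_limit_def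
      by (elim allE[of _ "\<lambda>k. horocycle (a k)"]) (auto intro!: exI[of _ 2])
    then show "(\<lambda>k. sphere_point (Some (\<gamma> (a k)))) \<longlonglongrightarrow> sphere_point L"
      unfolding \<gamma>_def by (rule limitin_riemann_sphere_tendsto)
  qed
qed

text \<open>The parabolic automorphism of the disc that becomes the translation by \<open>\<i>\<close> in the right
  half-plane; it fixes no point of the disc, and its orbits run along horocycles at 1.\<close>

lemma not_denjoy_wolff: "\<not> denjoy_wolff_property slit_domain"
proof
  define M where "M z = (cayley z + \<i> - 1) / (cayley z + \<i> + 1)" for z
  have Mnorm: "norm (M z) < 1" if "norm z < 1" for z
    unfolding M_def using Re_cayley_pos[OF that] by (intro norm_inv_cayley_less_1) simp
  have cM: "cayley (M z) = cayley z + \<i>" if "norm z < 1" for z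
  proof (subst cayley_eq_iff)
    show "M z \<noteq> 1" using Mnorm[OF that] by auto
    show "cayley z + \<i> \<noteq> - 1" using Re_cayley_pos[OF that] by (auto simp: complex_eq_iff)
  qed (simp add: M_def)
  define f where "f p = g (M (h p))" for p
  have fD: "f p \<in> slit_domain" if "p \<in> slit_domain" for p
    using that by (simp add: f_def g_in Mnorm h_in)
  have "(\<lambda>p. M (h p)) holomorphic_on slit_domain"
    unfolding M_def
  proof (intro holomorphic_intros hol_cayley_h)
    show "cayley (h p) + \<i> + 1 \<noteq> 0" if "p \<in> slit_domain" for p
      using cayley_h_pos[OF that] by (auto simp: complex_eq_iff)
  qed
  then have "f holomorphic_on slit_domain"
    using holomorphic_on_compose_gen[OF _ hol_g] Mnorm h_in
    by (fastforce simp: f_def[abs_def] o_def)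
  moreover have "f p \<noteq> p" if p: "p \<in> slit_domain" for p
  proof
    assume "f p = p"
    then have "M (h p) = h p" using h_g[OF Mnorm[OF h_in[OF p]]] by (simp add: f_def)
    then show False using cM[OF h_in[OF p]] by simp
  qed
  moreover assume "denjoy_wolff_property slit_domain"
  ultimately obtain \<tau> where \<tau>: "\<And>K. compact K \<Longrightarrow> K \<subseteq> slit_domain \<Longrightarrow>
      uniform_limit K (\<lambda>n z. sphere_point (Some ((f ^^ n) z))) (\<lambda>_. sphere_point \<tau>) sequentially"
    using fD unfolding denjoy_wolff_property_def by (metis image_subsetI)
  have f\<gamma>: "f (\<gamma> t) = \<gamma> (t + 1)" for t
  proof -
    have "M (horocycle t) = horocycle (t + 1)"
      by (simp only: M_def cayley_horocycle horocycle_eq[of "t + 1"]) (simp add: algebra_simps)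
    then show ?thesis by (simp add: f_def \<gamma>_def h_g norm_horocycle)
  qed
  have iter: "(f ^^ n) (\<gamma> t) = \<gamma> (t + real n)" for n t
    by (induction n) (simp_all add: f\<gamma> add_ac)
  \<comment> \<open>This arc is one period of the iteration: \<open>f\<close> shifts the parameter
    of \<gamma> by 1, so uniform convergence on the arc controls \<gamma> at all large real
    parameters, split into integer and fractional parts.\<close>
  have K: "compact (\<gamma> ` {0..1})" "\<gamma> ` {0..1} \<subseteq> slit_domain"
    by (auto intro: compact_continuous_image continuous_on_\<gamma> \<gamma>_in)
  show False
  proof (rule \<gamma>_diverges)
    fix a :: "nat \<Rightarrow> real" assume a: "\<And>k. real k \<le> a k"
    show "(\<lambda>k. sphere_point (Some (\<gamma> (a k)))) \<longlonglongrightarrow> sphere_point \<tau>"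
    proof (rule tendstoI)
      fix e :: real assume "e > 0"
      then have "\<forall>\<^sub>F n in sequentially. \<forall>z\<in>\<gamma> ` {0..1}. dist (sphere_point (Some ((f ^^ n) z))) (sphere_point \<tau>) < e"
        using \<tau>[OF K] by (auto simp: uniform_limit_iff)
      then obtain N where N: "\<And>n t. n \<ge> N \<Longrightarrow> 0 \<le> t \<Longrightarrow> t \<le> 1 \<Longrightarrow>
          dist (sphere_point (Some (\<gamma> (t + real n)))) (sphere_point \<tau>) < e"
        by (force simp: eventually_sequentially iter)
      have "dist (sphere_point (Some (\<gamma> (a k)))) (sphere_point \<tau>) < e" if "k \<ge> N" for k
      proof -
        have a0: "a k \<ge> 0" using a[of k] by (meson of_nat_0_le_iff order_trans)
        define n where "n = nat \<lfloor>a k\<rfloor>"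
        have n: "real n = of_int \<lfloor>a k\<rfloor>" using a0 by (simp add: n_def)
        have "n \<ge> N" using a[of k] that by (simp add: n_def le_nat_floor le_nat_iff le_floor_iff)
        then have "dist (sphere_point (Some (\<gamma> (a k - real n + real n)))) (sphere_point \<tau>) < e"
          by (rule N) (unfold n, linarith+)
        then show ?thesis by simp
      qed
      then show "\<forall>\<^sub>F k in sequentially. dist (sphere_point (Some (\<gamma> (a k)))) (sphere_point \<tau>) < e"
        by (auto simp: eventually_sequentially)
    qed
  qed
qed

end

section \<open>Automorphisms of the disc\<close>

text \<open>The Schwarz lemma for both \<open>F\<close> and its inverse gives equality of norms at
  one nonzero point, here 1/2, and equality forces a rotation.\<close>

lemma disc_automorphism_fixing_0:
  assumes hol: "F holomorphic_on ball 0 1" "G holomorphic_on ball 0 1"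
    and F: "\<And>z. norm z < 1 \<Longrightarrow> norm (F z) < 1" and G: "\<And>z. norm z < 1 \<Longrightarrow> norm (G z) < 1"
    and inv: "\<And>z. norm z < 1 \<Longrightarrow> G (F z) = z" and "F 0 = 0"
  obtains \<nu> where "norm \<nu> = 1" "\<And>z. norm z < 1 \<Longrightarrow> F z = \<nu> * z"
proof -
  have G0: "G 0 = 0" using inv[of 0] \<open>F 0 = 0\<close> by simp
  have h: "norm (1/2 :: complex) < 1" by simp
  have "norm (F (1/2)) \<le> norm (1/2 :: complex)"
    by (rule Schwarz_Lemma(1)[OF hol(1) \<open>F 0 = 0\<close> F h])
  moreover have "norm (G (F (1/2))) \<le> norm (F (1/2))"
    by (rule Schwarz_Lemma(1)[OF hol(2) G0 G F[OF h]])
  ultimately have "norm (F (1/2)) = norm (1/2 :: complex)"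
    using inv[OF h] by simp
  then have "\<exists>z. norm z < 1 \<and> z \<noteq> 0 \<and> norm (F z) = norm z"
    by (intro exI[of _ "1/2"]) simp
  then show ?thesis
    using Schwarz_Lemma(3)[OF hol(1) \<open>F 0 = 0\<close> F h] that by blast
qed

lemma disc_automorphism:
  assumes hol: "F holomorphic_on ball 0 1" "G holomorphic_on ball 0 1"
    and F: "\<And>z. norm z < 1 \<Longrightarrow> norm (F z) < 1" and G: "\<And>z. norm z < 1 \<Longrightarrow> norm (G z) < 1"
    and inv: "\<And>z. norm z < 1 \<Longrightarrow> G (F z) = z" "\<And>z. norm z < 1 \<Longrightarrow> F (G z) = z"
  obtains \<nu> w where "norm \<nu> = 1" "norm w < 1" "\<And>z. norm z < 1 \<Longrightarrow> F z = \<nu> * Moebius_function 0 w z"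
proof -
  define w where "w = G 0"
  have w: "norm w < 1" "norm (- w) < 1" using G[of 0] by (auto simp: w_def)
  let ?m = "Moebius_function 0 w" and ?m' = "Moebius_function 0 (- w)"
  obtain \<nu> where \<nu>: "norm \<nu> = 1" "\<And>z. norm z < 1 \<Longrightarrow> F (?m' z) = \<nu> * z"
  proof (rule disc_automorphism_fixing_0[of "\<lambda>z. F (?m' z)" "\<lambda>z. ?m (G z)"])
    show "(\<lambda>z. F (?m' z)) holomorphic_on ball 0 1"
      using holomorphic_on_compose_gen[OF Moebius_function_holomorphic[OF w(2)] hol(1)]
        Moebius_function_norm_lt_1[OF w(2)] by (auto simp: o_def image_subset_iff)
    show "(\<lambda>z. ?m (G z)) holomorphic_on ball 0 1"
      using holomorphic_on_compose_gen[OF hol(2) Moebius_function_holomorphic[OF w(1)]] G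
      by (auto simp: o_def image_subset_iff)
    show "norm (F (?m' z)) < 1" "norm (?m (G z)) < 1" "?m (G (F (?m' z))) = z" if "norm z < 1" for z
      using that w F G inv(1) Moebius_function_norm_lt_1 Moebius_function_compose[of "-w" w z]
        Moebius_function_compose[of w "-w" z] by (auto simp: Moebius_function_norm_lt_1)
    show "F (?m' 0) = 0" using inv(2)[of 0] by (simp add: Moebius_function_of_zero w_def)
  qed (blast intro: that)
  have "F z = \<nu> * ?m z" if "norm z < 1" for z
    using \<nu>(2)[of "?m z"] Moebius_function_norm_lt_1[OF w(1) that] Moebius_function_compose[of "-w" w z] w that
    by simp
  then show ?thesis using that \<nu>(1) w(1) by blast
qed

text \<open>The explicit formula also defines \<open>A\<close> on the circle. The constant
  \<open>C\<close> below is its Lipschitz constant on the closed disc and also controls how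
  \<open>1 - (norm z)\<^sup>2\<close> changes; these two estimates transport all the kinds of
  approach regions.\<close>

locale disc_Moebius =
  fixes \<nu> w :: complex and A :: "complex \<Rightarrow> complex"
  assumes \<nu>: "norm \<nu> = 1" and w: "norm w < 1" and A_def: "A = (\<lambda>z. \<nu> * Moebius_function 0 w z)"
begin

definition C :: real where "C = (1 + norm w) / (1 - norm w)"

lemma C_ge_1: "C \<ge> 1"
  using w by (simp add: C_def le_divide_eq)

lemma denominator:
  assumes "norm z \<le> 1"
  shows "1 - norm w \<le> norm (1 - cnj w * z)" "norm (1 - cnj w * z) \<le> 1 + norm w" "1 - cnj w * z \<noteq> 0"
proof -
  have "norm (cnj w * z) \<le> norm w" using assms by (simp add: norm_mult mult_left_le)
  then show 1: "1 - norm w \<le> norm (1 - cnj w * z)" "norm (1 - cnj w * z) \<le> 1 + norm w"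
    using norm_triangle_ineq2[of 1 "cnj w * z"] norm_triangle_ineq4[of 1 "cnj w * z"] by simp_all
  show "1 - cnj w * z \<noteq> 0" using 1(1) w by auto
qed

lemma one_minus_norm_A:
  assumes "norm z \<le> 1"
  shows "1 - (norm (A z))\<^sup>2 = (1 - (norm w)\<^sup>2) * (1 - (norm z)\<^sup>2) / (norm (1 - cnj w * z))\<^sup>2"
proof -
  have "norm (A z) = norm (z - w) / norm (1 - cnj w * z)"
    by (simp add: A_def \<nu> norm_mult Moebius_function_simple norm_divide)
  then have "1 - (norm (A z))\<^sup>2 = ((norm (1 - cnj w * z))\<^sup>2 - (norm (z - w))\<^sup>2) / (norm (1 - cnj w * z))\<^sup>2"
    using denominator(3)[OF assms] by (simp add: power_divide diff_divide_distrib)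
  then show ?thesis by (simp only: norm_Moebius_identity)
qed

lemma one_minus_w2: "1 - (norm w)\<^sup>2 = (1 - norm w) * (1 + norm w)"
  by (simp add: power2_eq_square algebra_simps)

lemma norm_A_less: "norm z < 1 \<Longrightarrow> norm (A z) < 1"
  using Moebius_function_norm_lt_1[OF w] by (simp add: A_def \<nu> norm_mult)

lemma norm_A_circle: "norm z = 1 \<Longrightarrow> norm (A z) = 1"
  using one_minus_norm_A[of z] norm_ge_zero[of "A z"] by (simp add: power2_eq_1_iff)

lemma defect: "norm z < 1 \<Longrightarrow> 1 - (norm z)\<^sup>2 \<le> C * (1 - (norm (A z))\<^sup>2)"
proof -
  assume z: "norm z < 1"
  have "(norm (1 - cnj w * z))\<^sup>2 \<le> (1 + norm w)\<^sup>2"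
    using denominator(2)[of z] z by (intro power_mono) auto
  moreover have "(norm (1 - cnj w * z))\<^sup>2 > 0" using denominator(3)[of z] z by simp
  moreover have "1 - (norm z)\<^sup>2 > 0" using z by (simp add: power_less_one_iff)
  ultimately have "(1 - (norm z)\<^sup>2) * 1 \<le> (1 - (norm z)\<^sup>2) * ((1 + norm w)\<^sup>2 / (norm (1 - cnj w * z))\<^sup>2)"
    by (intro mult_left_mono) (auto simp: le_divide_eq)
  also have "\<dots> = C * (1 - (norm (A z))\<^sup>2)"
    unfolding one_minus_norm_A[OF less_imp_le[OF z]] one_minus_w2 C_def
    using w by (simp add: power2_eq_square)
  finally show ?thesis by simp
qed

lemma Lipschitz:
  assumes "norm z \<le> 1" "norm u \<le> 1"
  shows "norm (A z - A u) \<le> C * norm (z - u)"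
proof -
  have nz: "1 - cnj w * z \<noteq> 0" "1 - cnj w * u \<noteq> 0" using denominator(3) assms by auto
  have "A z - A u = \<nu> * ((z - u) * (1 - cnj w * w) / ((1 - cnj w * z) * (1 - cnj w * u)))"
    using nz by (simp add: A_def Moebius_function_simple field_simps)
  moreover have "norm (1 - cnj w * w) = 1 - (norm w)\<^sup>2"
  proof -
    have "1 - cnj w * w = of_real (1 - (norm w)\<^sup>2)" by (simp only: of_real_diff of_real_1 complex_norm_square mult.commute)
    moreover have "1 - (norm w)\<^sup>2 \<ge> 0" using w by (simp add: power_le_one)
    ultimately show ?thesis by (simp only: norm_of_real abs_of_nonneg)
  qed
  ultimately have "norm (A z - A u) = norm (z - u) * ((1 - norm w) * (1 + norm w)) / (norm (1 - cnj w * z) * norm (1 - cnj w * u))"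
    by (simp add: norm_mult norm_divide \<nu> one_minus_w2)
  also have "\<dots> \<le> norm (z - u) * ((1 - norm w) * (1 + norm w)) / ((1 - norm w) * (1 - norm w))"
    using denominator(1)[OF assms(1)] denominator(1)[OF assms(2)] w
    by (intro divide_left_mono mult_mono mult_nonneg_nonneg mult_pos_pos) auto
  also have "\<dots> = C * norm (z - u)"
    using w by (simp add: C_def)
  finally show ?thesis .
qed

lemma filterlim_A:
  assumes \<sigma>: "norm \<sigma> = 1" and S: "S \<subseteq> ball 0 1" "\<And>z. z \<in> S \<Longrightarrow> A z \<in> S'"
  shows "filterlim A (at (A \<sigma>) within S') (at \<sigma> within S)"
  unfolding filterlim_at
proof
  show "\<forall>\<^sub>F z in at \<sigma> within S. A z \<in> S' \<and> A z \<noteq> A \<sigma>"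
  proof (rule eventually_at_withinI)
    fix z assume "z \<in> S"
    then show "A z \<in> S' \<and> A z \<noteq> A \<sigma>"
      using S norm_A_less[of z] norm_A_circle[OF \<sigma>] by auto
  qed
  show "(A \<longlongrightarrow> A \<sigma>) (at \<sigma> within S)"
  proof (rule Lim_transform_eventually[OF Lim_null[THEN iffD2] ])
    have "((\<lambda>z. C * norm (z - \<sigma>)) \<longlongrightarrow> C * norm (\<sigma> - \<sigma>)) (at \<sigma> within S)"
      by (intro tendsto_intros)
    then have "((\<lambda>z. C * norm (z - \<sigma>)) \<longlongrightarrow> 0) (at \<sigma> within S)" by simp
    moreover have "\<forall>\<^sub>F z in at \<sigma> within S. norm (A z - A \<sigma>) \<le> C * norm (z - \<sigma>)"
      by (rule eventually_at_withinI) (use S \<sigma> in \<open>auto intro!: Lipschitz\<close>)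
    ultimately show "((\<lambda>z. A z - A \<sigma>) \<longlongrightarrow> 0) (at \<sigma> within S)"
      by (rule Lim_null_comparison[rotated])
  qed simp
qed

lemma unrestricted_limit_compose:
  assumes \<sigma>: "norm \<sigma> = 1" and lim: "unrestricted_limit g (A \<sigma>) L"
    and G: "\<And>z. norm z < 1 \<Longrightarrow> G z = g (A z)"
  shows "unrestricted_limit G \<sigma> L"
  unfolding unrestricted_limit_def
proof (rule limitin_transform_eventually)
  have fl: "filterlim A (at (A \<sigma>) within ball 0 1) (at \<sigma> within ball 0 1)"
    by (rule filterlim_A[OF \<sigma>]) (use norm_A_less in auto)
  show "limitin riemann_sphere (\<lambda>z. Some (g (A z))) L (at \<sigma> within ball 0 1)"
    using lim eventually_compose_filterlim[OF _ fl] unfolding unrestricted_limit_def limitin_def by blast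
  show "\<forall>\<^sub>F z in at \<sigma> within ball 0 1. Some (g (A z)) = Some (G z)"
    by (rule eventually_at_withinI) (simp add: G)
qed

text \<open>One factor \<open>C\<close> comes from the Lipschitz bound, one from
  \<open>defect\<close>, and the factor 2 from passing between \<open>1 - norm\<close> and
  \<open>1 - norm\<close> squared.\<close>

lemma stolz_region_image:
  assumes \<sigma>: "norm \<sigma> = 1" and z: "z \<in> stolz_region \<sigma> M"
  shows "A z \<in> stolz_region (A \<sigma>) (2 * C\<^sup>2 * M)"
proof -
  have nz: "norm z < 1" and s: "norm (\<sigma> - z) < M * (1 - norm z)" using z by (auto simp: stolz_region_def)
  have "0 \<le> M * (1 - norm z)" using s norm_ge_zero[of "\<sigma> - z"] by linarith
  then have M: "M \<ge> 0" using nz by (simp add: zero_le_mult_iff)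
  have nA: "norm (A z) < 1" by (rule norm_A_less[OF nz])
  have "norm (A \<sigma> - A z) \<le> C * norm (\<sigma> - z)"
    by (rule Lipschitz) (use \<sigma> nz in auto)
  also have "\<dots> < C * (M * (1 - norm z))"
    using s C_ge_1 by (intro mult_strict_left_mono) auto
  also have "\<dots> \<le> C * (M * (1 - (norm z)\<^sup>2))"
    using nz C_ge_1 M by (intro mult_left_mono) (auto simp: power2_eq_square mult_left_le)
  also have "\<dots> \<le> C * (M * (C * (1 - (norm (A z))\<^sup>2)))"
    using defect[OF nz] C_ge_1 M by (intro mult_left_mono) auto
  also have "\<dots> \<le> C * (M * (C * (2 * (1 - norm (A z)))))"
  proof -
    have "1 - (norm (A z))\<^sup>2 = (1 + norm (A z)) * (1 - norm (A z))"
      by (simp add: power2_eq_square algebra_simps)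
    also have "\<dots> \<le> 2 * (1 - norm (A z))"
      using nA by (intro mult_right_mono) auto
    finally show ?thesis using C_ge_1 M by (intro mult_left_mono) auto
  qed
  also have "\<dots> = 2 * C\<^sup>2 * M * (1 - norm (A z))" by (simp add: power2_eq_square)
  finally show ?thesis using nA by (simp add: stolz_region_def)
qed

lemma nontangential_limit_compose:
  assumes \<sigma>: "norm \<sigma> = 1" and lim: "nontangential_limit g (A \<sigma>) L"
    and G: "\<And>z. norm z < 1 \<Longrightarrow> G z = g (A z)"
  shows "nontangential_limit G \<sigma> L"
  unfolding nontangential_limit_def
proof (intro allI impI, rule limitin_transform_eventually)
  fix M :: real assume M: "M > 1"
  have sub: "stolz_region \<sigma> M \<subseteq> ball 0 1" by (auto simp: stolz_region_def)
  have fl: "filterlim A (at (A \<sigma>) within stolz_region (A \<sigma>) (2 * C\<^sup>2 * M)) (at \<sigma> within stolz_region \<sigma> M)"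
    by (rule filterlim_A[OF \<sigma> sub stolz_region_image[OF \<sigma>]])
  have "1 \<le> C\<^sup>2" using C_ge_1 by (simp add: one_le_power)
  then have "1 * 1 \<le> C\<^sup>2 * M" using M by (intro mult_mono) auto
  then have "2 * C\<^sup>2 * M > 1" by simp
  then have "limitin riemann_sphere (\<lambda>z. Some (g z)) L (at (A \<sigma>) within stolz_region (A \<sigma>) (2 * C\<^sup>2 * M))"
    using lim unfolding nontangential_limit_def by blast
  then show "limitin riemann_sphere (\<lambda>z. Some (g (A z))) L (at \<sigma> within stolz_region \<sigma> M)"
    using eventually_compose_filterlim[OF _ fl] unfolding limitin_def by blast
  show "\<forall>\<^sub>F z in at \<sigma> within stolz_region \<sigma> M. Some (g (A z)) = Some (G z)"
    by (rule eventually_at_withinI) (use G sub in auto)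
qed

text \<open>The squared Lipschitz bound contributes \<open>C\<^sup>2\<close> and
  \<open>defect\<close> another \<open>C\<close>. The optimal radius is irrelevant, since
  \<open>H_limit\<close> quantifies over all \<open>R\<close>.\<close>

lemma horosphere_image:
  assumes \<sigma>: "norm \<sigma> = 1" and z: "z \<in> horosphere \<sigma> R"
  shows "A z \<in> horosphere (A \<sigma>) (C ^ 3 * R)"
proof -
  have nz: "norm z < 1" and s: "(norm (\<sigma> - z))\<^sup>2 / (1 - (norm z)\<^sup>2) < R"
    using z by (auto simp: horosphere_def)
  have pz: "1 - (norm z)\<^sup>2 > 0" using nz by (simp add: power_less_one_iff)
  have nA: "norm (A z) < 1" by (rule norm_A_less[OF nz])
  have pA: "1 - (norm (A z))\<^sup>2 > 0" using nA by (simp add: power_less_one_iff)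
  have C0: "C > 0" using C_ge_1 by simp
  have "norm (A \<sigma> - A z) \<le> C * norm (\<sigma> - z)"
    by (rule Lipschitz) (use \<sigma> nz in auto)
  then have "(norm (A \<sigma> - A z))\<^sup>2 \<le> (C * norm (\<sigma> - z))\<^sup>2" by (intro power_mono) auto
  then have "(norm (A \<sigma> - A z))\<^sup>2 \<le> C\<^sup>2 * (norm (\<sigma> - z))\<^sup>2" by (simp add: power_mult_distrib)
  also have "\<dots> < C\<^sup>2 * (R * (1 - (norm z)\<^sup>2))"
    using s pz C0 by (intro mult_strict_left_mono) (auto simp: divide_less_eq)
  also have "\<dots> \<le> C\<^sup>2 * (R * (C * (1 - (norm (A z))\<^sup>2)))"
  proof -
    have "0 \<le> (norm (\<sigma> - z))\<^sup>2 / (1 - (norm z)\<^sup>2)" using pz by simp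
    then have "R \<ge> 0" using s by linarith
    then show ?thesis using defect[OF nz] by (intro mult_left_mono) auto
  qed
  also have "\<dots> = C ^ 3 * R * (1 - (norm (A z))\<^sup>2)" by (simp add: power2_eq_square power3_eq_cube)
  finally show ?thesis using nA pA by (simp add: horosphere_def divide_less_eq)
qed

lemma H_limit_compose:
  assumes \<sigma>: "norm \<sigma> = 1" and lim: "H_limit g (A \<sigma>) L"
    and G: "\<And>z. norm z < 1 \<Longrightarrow> G z = g (A z)"
  shows "H_limit G \<sigma> L"
  unfolding H_limit_def
proof (intro allI impI)
  fix z :: "nat \<Rightarrow> complex"
  assume "(\<forall>n. z n \<in> ball 0 1) \<and> z \<longlonglongrightarrow> \<sigma> \<and> (\<exists>R>0. \<forall>\<^sub>F n in sequentially. z n \<in> horosphere \<sigma> R)"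
  then obtain R where z: "\<And>n. norm (z n) < 1" "z \<longlonglongrightarrow> \<sigma>"
    and R: "R > 0" "\<forall>\<^sub>F n in sequentially. z n \<in> horosphere \<sigma> R"
    by auto
  have "filterlim z (at \<sigma> within ball 0 1) sequentially"
    unfolding filterlim_at using z \<sigma> by (auto intro!: always_eventually) (metis less_irrefl)
  moreover have "(A \<longlongrightarrow> A \<sigma>) (at \<sigma> within ball 0 1)"
    using filterlim_A[OF \<sigma>, of "ball 0 1" "ball 0 1"] norm_A_less by (simp add: filterlim_at)
  ultimately have "(\<lambda>n. A (z n)) \<longlonglongrightarrow> A \<sigma>"
    by (rule filterlim_compose[rotated])
  moreover have "\<forall>\<^sub>F n in sequentially. A (z n) \<in> horosphere (A \<sigma>) (C ^ 3 * R)"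
    using R(2) by eventually_elim (rule horosphere_image[OF \<sigma>])
  moreover have "C ^ 3 * R > 0" using C_ge_1 R(1) by simp
  ultimately have "limitin riemann_sphere (\<lambda>n. Some (g (A (z n)))) L sequentially"
    using lim norm_A_less[OF z(1)] unfolding H_limit_def
    by (elim allE[of _ "\<lambda>n. A (z n)"]) auto
  then show "limitin riemann_sphere (\<lambda>n. Some (G (z n))) L sequentially"
    by (simp add: G z(1))
qed

end

text \<open>The hypothesis concerns only the open disc; continuity of both maps up to the circle
  carries it over.\<close>

lemma disc_Moebius_inverse_circle:
  assumes "disc_Moebius \<nu> w A" "disc_Moebius \<nu>' w' B" and inv: "\<And>z. norm z < 1 \<Longrightarrow> B (A z) = z"
    and \<sigma>: "norm \<sigma> = 1"
  shows "B (A \<sigma>) = \<sigma>"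
proof -
  interpret A: disc_Moebius \<nu> w A by fact
  interpret B: disc_Moebius \<nu>' w' B by fact
  have "filterlim (\<lambda>z. B (A z)) (at (B (A \<sigma>)) within ball 0 1) (at \<sigma> within ball 0 1)"
    by (rule filterlim_compose[OF B.filterlim_A[OF A.norm_A_circle[OF \<sigma>]] A.filterlim_A[OF \<sigma>]])
      (use A.norm_A_less B.norm_A_less in auto)
  then have 1: "((\<lambda>z. B (A z)) \<longlongrightarrow> B (A \<sigma>)) (at \<sigma> within ball 0 1)" by (simp add: filterlim_at)
  have 2: "((\<lambda>z. B (A z)) \<longlongrightarrow> \<sigma>) (at \<sigma> within ball 0 1)"
    by (rule Lim_transform_eventually[OF tendsto_ident_at]) (rule eventually_at_withinI, simp add: inv)
  have "at \<sigma> within ball 0 1 \<noteq> bot"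
    using \<sigma> by (simp add: trivial_limit_within islimpt_ball)
  then show ?thesis using 1 2 tendsto_unique by blast
qed

section \<open>Reduction to the normalized Riemann map\<close>

text \<open>Conjugating a Riemann map on both sides gives another one with the same zero 1, so the
  two differ by a rotation \<alpha>. Writing \<alpha> as \<open>\<nu>\<^sup>2\<close> makes
  \<open>\<nu> * f\<close> commute with conjugation, and so does \<open>- \<nu> * f\<close>.\<close>

lemma symmetric_Riemann_map_exists:
  obtains f g \<nu> where "f holomorphic_on slit_domain" "g holomorphic_on ball 0 1"
    "\<And>p. p \<in> slit_domain \<Longrightarrow> norm (f p) < 1" "\<And>z. norm z < 1 \<Longrightarrow> g z \<in> slit_domain"
    "\<And>p. p \<in> slit_domain \<Longrightarrow> g (f p) = p" "\<And>z. norm z < 1 \<Longrightarrow> f (g z) = z" "f 1 = 0"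
    "norm \<nu> = 1" "\<And>p. p \<in> slit_domain \<Longrightarrow> cnj (f (cnj p)) = \<nu>\<^sup>2 * f p"
proof -
  have one: "1 \<in> slit_domain" using of_real_slit_domain[of 1] by simp
  have "slit_domain \<noteq> UNIV" using slit_domain_Re_pos[of 0] by auto
  then obtain f0 g0 where f0: "f0 holomorphic_on slit_domain" and g0: "g0 holomorphic_on ball 0 1"
    and fg0: "\<forall>z\<in>slit_domain. f0 z \<in> ball 0 1 \<and> g0 (f0 z) = z"
    and gf0: "\<forall>z\<in>ball 0 1. g0 z \<in> slit_domain \<and> f0 (g0 z) = z"
    using Riemann_mapping_theorem[of slit_domain] slit_domain_simply_connected_domain by auto
  define a where "a = f0 1"
  have a: "norm a < 1" "norm (- a) < 1" using fg0 one by (auto simp: a_def)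
  define f where "f p = Moebius_function 0 a (f0 p)" for p
  define g where "g z = g0 (Moebius_function 0 (- a) z)" for z
  have hf: "f holomorphic_on slit_domain"
    using holomorphic_on_compose_gen[OF f0 Moebius_function_holomorphic[OF a(1), of 0]] fg0
    by (auto simp: f_def[abs_def] o_def image_subset_iff)
  have hg: "g holomorphic_on ball 0 1"
    using holomorphic_on_compose_gen[OF Moebius_function_holomorphic[OF a(2), of 0] g0]
      Moebius_function_norm_lt_1[OF a(2)]
    by (auto simp: g_def[abs_def] o_def image_subset_iff)
  have f_in: "norm (f p) < 1" if "p \<in> slit_domain" for p
    using fg0 that by (auto simp: f_def intro!: Moebius_function_norm_lt_1 a)
  have g_in: "g z \<in> slit_domain" if "norm z < 1" for z
    using gf0 Moebius_function_norm_lt_1[OF a(2) that] by (simp add: g_def)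
  have gf: "g (f p) = p" if "p \<in> slit_domain" for p
    using fg0 that Moebius_function_compose[of "- a" a "f0 p"] a by (simp add: f_def g_def)
  have fg: "f (g z) = z" if "norm z < 1" for z
    using gf0 Moebius_function_norm_lt_1[OF a(2) that] Moebius_function_compose[of a "- a" z] a that
    by (simp add: f_def g_def)
  have f1: "f 1 = 0" by (simp add: f_def a_def Moebius_function_eq_zero)
  have g0_1: "g 0 = 1" using gf[OF one] f1 by simp
  have cnjD: "cnj ` slit_domain = slit_domain"
    using cnj_slit_domain by (force simp: image_iff intro: bexI[of _ "cnj _"])
  obtain \<alpha> where \<alpha>: "norm \<alpha> = 1" "\<And>z. norm z < 1 \<Longrightarrow> cnj (f (cnj (g z))) = \<alpha> * z"
  proof (rule disc_automorphism_fixing_0[of "\<lambda>z. cnj (f (cnj (g z)))" "\<lambda>z. f (cnj (g (cnj z)))"])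
    have "cnj \<circ> f \<circ> cnj holomorphic_on slit_domain"
      by (rule holomorphic_on_compose_cnj_cnj)
        (use hf cnjD slit_domain_simply_connected_domain in auto)
    from holomorphic_on_compose_gen[OF hg this]
    show "(\<lambda>z. cnj (f (cnj (g z)))) holomorphic_on ball 0 1"
      using g_in by (auto simp: o_def image_subset_iff)
    have cb: "cnj ` ball 0 1 = ball 0 1"
      by (force simp: image_iff intro: bexI[of _ "cnj _"])
    have "cnj \<circ> g \<circ> cnj holomorphic_on ball 0 1"
      by (rule holomorphic_on_compose_cnj_cnj) (use hg cb in auto)
    from holomorphic_on_compose_gen[OF this hf]
    show "(\<lambda>z. f (cnj (g (cnj z)))) holomorphic_on ball 0 1"
      using g_in cnj_slit_domain by (auto simp: o_def image_subset_iff)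
    show "norm (cnj (f (cnj (g z)))) < 1" "norm (f (cnj (g (cnj z)))) < 1"
      "f (cnj (g (cnj (cnj (f (cnj (g z))))))) = z" if "norm z < 1" for z
      using that f_in g_in cnj_slit_domain gf fg by auto
    show "cnj (f (cnj (g 0))) = 0" by (simp add: g0_1 f1)
  qed (blast intro: that)
  have "norm (csqrt \<alpha>) = 1" using \<alpha>(1) by (simp add: norm_csqrt)
  moreover have "cnj (f (cnj p)) = (csqrt \<alpha>)\<^sup>2 * f p" if "p \<in> slit_domain" for p
    using \<alpha>(2)[OF f_in[OF that]] gf[OF that] by simp
  ultimately show ?thesis
    using that hf hg f_in g_in gf fg f1 by blast
qed

text \<open>On the positive axis \<open>\<nu> * f\<close> is real, continuous and injective, hence
  strictly monotone; the sign of \<nu> is then chosen to make it decreasing.\<close>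

lemma normalized_slit_map_exists: "\<exists>g h. normalized_slit_map g h"
proof -
  obtain f g \<nu> where hf: "f holomorphic_on slit_domain" and hg: "g holomorphic_on ball 0 1"
    and f_in: "\<And>p. p \<in> slit_domain \<Longrightarrow> norm (f p) < 1"
    and g_in: "\<And>z. norm z < 1 \<Longrightarrow> g z \<in> slit_domain"
    and gf: "\<And>p. p \<in> slit_domain \<Longrightarrow> g (f p) = p" and fg: "\<And>z. norm z < 1 \<Longrightarrow> f (g z) = z"
    and f1: "f 1 = 0" and \<nu>: "norm \<nu> = 1" and sym: "\<And>p. p \<in> slit_domain \<Longrightarrow> cnj (f (cnj p)) = \<nu>\<^sup>2 * f p"
    by (rule symmetric_Riemann_map_exists, rule that, assumption+)
  have unit: "cnj \<mu> * \<mu> = 1" "\<mu> * cnj \<mu> = 1" if "norm \<mu> = 1" for \<mu>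
    using that by (metis complex_norm_square mult.commute of_real_1 one_power2)+
  \<comment> \<open>Stated for every \<mu> with the same square as \<nu>, since either square root
    may be the one required.\<close>
  have map: "normalized_slit_map (\<lambda>z. g (cnj \<mu> * z)) (\<lambda>p. \<mu> * f p)"
    if \<mu>: "norm \<mu> = 1" "\<mu>\<^sup>2 = \<nu>\<^sup>2"
      and dec: "\<And>s t. 0 < s \<Longrightarrow> s < t \<Longrightarrow> Re (\<mu> * f (of_real t)) < Re (\<mu> * f (of_real s))" for \<mu>
  proof
    have n: "norm (cnj \<mu> * z) = norm z" "norm (\<mu> * z) = norm z" for z
      using \<mu>(1) by (simp_all add: norm_mult)
    have "(\<lambda>z. cnj \<mu> * z) holomorphic_on ball 0 1" by (intro holomorphic_intros)
    from holomorphic_on_compose_gen[OF this hg]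
    show "(\<lambda>z. g (cnj \<mu> * z)) holomorphic_on ball 0 1" using n by (auto simp: o_def image_subset_iff)
    show "(\<lambda>p. \<mu> * f p) holomorphic_on slit_domain" by (intro holomorphic_intros hf)
    show "g (cnj \<mu> * z) \<in> slit_domain" "\<mu> * f (g (cnj \<mu> * z)) = z" if "norm z < 1" for z
      using that n g_in fg unit[OF \<mu>(1)] by (simp_all add: mult.assoc[symmetric])
    show "norm (\<mu> * f p) < 1" "g (cnj \<mu> * (\<mu> * f p)) = p" if "p \<in> slit_domain" for p
      using that n f_in gf unit[OF \<mu>(1)] by (simp_all add: mult.assoc[symmetric])
    show "\<mu> * f (cnj p) = cnj (\<mu> * f p)" if "p \<in> slit_domain" for p
    proof -
      have "f (cnj p) = cnj (\<mu> * \<mu> * f p)"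
        using sym[OF that] \<mu>(2) by (metis complex_cnj_cnj power2_eq_square)
      then have "\<mu> * f (cnj p) = (\<mu> * cnj \<mu>) * (cnj \<mu> * cnj (f p))" by simp
      then show ?thesis using unit(2)[OF \<mu>(1)] by simp
    qed
    show "\<mu> * f 1 = 0" by (simp add: f1)
  qed (rule dec)
  define k where "k t = Re (\<nu> * f (of_real t))" for t
  have real: "\<nu> * f (of_real t) = of_real (k t)" if "t > 0" for t
  proof -
    have "cnj (f (of_real t)) = \<nu> * \<nu> * f (of_real t)"
      using sym[OF of_real_slit_domain[OF that]] by (simp add: power2_eq_square)
    then have "cnj (\<nu> * f (of_real t)) = (cnj \<nu> * \<nu>) * (\<nu> * f (of_real t))" by simp
    then have "cnj (\<nu> * f (of_real t)) = \<nu> * f (of_real t)" using unit(1)[OF \<nu>] by simp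
    then show ?thesis by (simp add: k_def complex_eq_iff)
  qed
  have "\<nu> \<noteq> 0" using \<nu> by auto
  have "continuous_on {0<..} k"
    unfolding k_def
    by (intro continuous_intros continuous_on_compose2[OF holomorphic_on_imp_continuous_on[OF hf]])
      (auto intro: of_real_slit_domain)
  moreover have "inj_on k {0<..}"
  proof (rule inj_onI)
    fix s t assume st: "s \<in> {0<..}" "t \<in> {0<..}" "k s = k t"
    then have "\<nu> * f (of_real s) = \<nu> * f (of_real t)" using real by simp
    then have "f (of_real s) = f (of_real t)" using \<open>\<nu> \<noteq> 0\<close> by simp
    then have "complex_of_real s = of_real t" using st gf of_real_slit_domain by (metis greaterThan_iff)
    then show "s = t" by simp
  qed
  ultimately consider "strict_mono_on {0<..} k" | "strict_antimono_on {0<..} k"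
    using injective_eq_monotone_map[of "{0<..}" k] by (auto simp: is_interval_convex)
  then show ?thesis
  proof cases
    case 1
    have "normalized_slit_map (\<lambda>z. g (cnj (- \<nu>) * z)) (\<lambda>p. - \<nu> * f p)"
    proof (rule map)
      fix s t :: real assume "0 < s" "s < t"
      then have "k s < k t" using monotone_onD[OF 1, of s t] by simp
      then show "Re (- \<nu> * f (of_real t)) < Re (- \<nu> * f (of_real s))"
        unfolding k_def by (simp only: mult_minus_left uminus_complex.sel neg_less_iff_less)
    qed (use \<nu> in simp_all)
    then show ?thesis by blast
  next
    case 2
    have "normalized_slit_map (\<lambda>z. g (cnj \<nu> * z)) (\<lambda>p. \<nu> * f p)"
      by (rule map) (use \<nu> monotone_onD[OF 2] in \<open>auto simp: k_def\<close>)
    then show ?thesis by blast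
  qed
qed

theorem proposition4p4:
  shows "(\<forall>g. riemann_map g slit_domain \<longrightarrow>
            (\<forall>\<sigma>\<in>sphere 0 1. \<exists>L. nontangential_limit g \<sigma> L) \<and>
            (\<exists>\<sigma>\<^sub>0\<in>sphere 0 1.
               (\<forall>\<sigma>\<in>sphere 0 1 - {\<sigma>\<^sub>0}. \<exists>L. unrestricted_limit g \<sigma> L) \<and>
               \<not> (\<exists>L. H_limit g \<sigma>\<^sub>0 L))) \<and>
         \<not> denjoy_wolff_property slit_domain"
proof -
  obtain g h where "normalized_slit_map g h" using normalized_slit_map_exists by blast
  then interpret normalized_slit_map g h .
  have "(\<forall>\<sigma>\<in>sphere 0 1. \<exists>L. nontangential_limit G \<sigma> L) \<and>
      (\<exists>\<sigma>\<^sub>0\<in>sphere 0 1. (\<forall>\<sigma>\<in>sphere 0 1 - {\<sigma>\<^sub>0}. \<exists>L. unrestricted_limit G \<sigma> L) \<and> \<not> (\<exists>L. H_limit G \<sigma>\<^sub>0 L))"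
    if "riemann_map G slit_domain" for G
  proof -
    define H where "H = inv_into (ball 0 1) G"
    have holG: "G holomorphic_on ball 0 1" and holH: "H holomorphic_on slit_domain"
      and bij: "bij_betw G (ball 0 1) slit_domain"
      using that by (auto simp: riemann_map_def H_def)
    have G_in: "G z \<in> slit_domain" and H_G: "H (G z) = z" if "norm z < 1" for z
      using bij that by (auto simp: bij_betw_def H_def)
    have H_in: "norm (H p) < 1" and G_H: "G (H p) = p" if "p \<in> slit_domain" for p
      using bij_betw_apply[OF bij_betw_inv_into[OF bij] that] bij_betw_inv_into_right[OF bij that]
      by (auto simp: H_def)
    have hol1: "(\<lambda>z. h (G z)) holomorphic_on ball 0 1"
      using holomorphic_on_compose_gen[OF holG hol_h] G_in by (auto simp: o_def image_subset_iff)
    have hol2: "(\<lambda>z. H (g z)) holomorphic_on ball 0 1"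
      using holomorphic_on_compose_gen[OF hol_g holH] g_in by (auto simp: o_def image_subset_iff)
    have in1: "norm (h (G z)) < 1" and in2: "norm (H (g z)) < 1"
      and inv1: "H (g (h (G z))) = z" and inv2: "h (G (H (g z))) = z" if "norm z < 1" for z
      using that by (simp_all add: G_in H_G H_in G_H g_in h_in h_g g_h)
    \<comment> \<open>Any two Riemann maps differ by a disc automorphism, so \<open>G\<close> is
      \<open>g\<close> after a Moebius map, and the exceptional point of \<open>G\<close> is the one
      sent to 1.\<close>
    obtain \<nu> w where A: "norm \<nu> = 1" "norm w < 1" "\<And>z. norm z < 1 \<Longrightarrow> h (G z) = \<nu> * Moebius_function 0 w z"
      by (rule disc_automorphism[OF hol1 hol2 in1 in2 inv1 inv2], assumption+, rule that, assumption+)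
    obtain \<nu>' w' where B: "norm \<nu>' = 1" "norm w' < 1" "\<And>z. norm z < 1 \<Longrightarrow> H (g z) = \<nu>' * Moebius_function 0 w' z"
      by (rule disc_automorphism[OF hol2 hol1 in2 in1 inv2 inv1], assumption+, rule that, assumption+)
    define MA where "MA = (\<lambda>z. \<nu> * Moebius_function 0 w z)"
    define MB where "MB = (\<lambda>z. \<nu>' * Moebius_function 0 w' z)"
    have dA: "disc_Moebius \<nu> w MA" and dB: "disc_Moebius \<nu>' w' MB"
      using A B by (simp_all add: disc_Moebius_def MA_def MB_def)
    interpret MA: disc_Moebius \<nu> w MA by (rule dA)
    interpret MB: disc_Moebius \<nu>' w' MB by (rule dB)
    have MA_eq: "h (G z) = MA z" and MB_eq: "H (g z) = MB z" if "norm z < 1" for z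
      using A(3) B(3) that by (simp_all add: MA_def MB_def)
    have G_eq: "G z = g (MA z)" if "norm z < 1" for z
      using g_h[OF G_in[OF that]] MA_eq[OF that] by simp
    have g_eq: "g z = G (MB z)" if "norm z < 1" for z
      using G_H[OF g_in[OF that]] MB_eq[OF that] by simp
    have MAB: "MA (MB \<sigma>) = \<sigma>" and MBA: "MB (MA \<sigma>) = \<sigma>" if "norm \<sigma> = 1" for \<sigma>
      by (rule disc_Moebius_inverse_circle[OF dB dA _ that] disc_Moebius_inverse_circle[OF dA dB _ that],
          metis MA_eq MB_eq in1 in2 inv1 inv2)+
    have unr: "\<exists>L. unrestricted_limit G \<sigma> L" if \<sigma>: "norm \<sigma> = 1" "\<sigma> \<noteq> MB 1" for \<sigma>
    proof -
      have "MA \<sigma> \<noteq> 1" using MBA[OF \<sigma>(1)] \<sigma>(2) by auto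
      then show ?thesis
        using unrestricted_limit_away_from_1[OF MA.norm_A_circle[OF \<sigma>(1)]]
          MA.unrestricted_limit_compose[where g = g and G = G, OF \<sigma>(1) _ G_eq] by blast
    qed
    have nt: "\<exists>L. nontangential_limit G \<sigma> L" if \<sigma>: "norm \<sigma> = 1" for \<sigma>
    proof (cases "\<sigma> = MB 1")
      case True
      then have "MA \<sigma> = 1" using MAB[of 1] by simp
      then have "nontangential_limit g (MA \<sigma>) (Some 0)" using nontangential_limit_1 by simp
      then show ?thesis using MA.nontangential_limit_compose[where g = g and G = G, OF \<sigma> _ G_eq] by blast
    next
      case False
      then obtain L where L: "unrestricted_limit G \<sigma> L" using unr \<sigma> by blast
      have "at \<sigma> within stolz_region \<sigma> M \<le> at \<sigma> within ball 0 1" for M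
        by (rule at_le) (auto simp: stolz_region_def)
      then have "nontangential_limit G \<sigma> L"
        using L unfolding unrestricted_limit_def nontangential_limit_def limitin_def
        by (meson filter_leD)
      then show ?thesis by blast
    qed
    \<comment> \<open>Transported in the opposite direction: an H-limit of \<open>G\<close> at
      \<open>MB 1\<close> would give one of \<open>g = G \<circ> MB\<close> at 1.\<close>
    have "\<not> H_limit G (MB 1) L" for L
      using no_H_limit_at_1[of L] MB.H_limit_compose[of 1 G L g, OF _ _ g_eq] by auto
    then show ?thesis
      using unr nt MB.norm_A_circle[of 1] by (intro conjI bexI[of _ "MB 1"]) auto
  qed
  then show ?thesis using not_denjoy_wolff by blast
qed

end
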